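(* The set $\mathcal N=\{Z\in\mathfrak k_A:L_Z\neq\mathfrak g_2\}$ is a real algebraic subset of $\mathfrak k_A\cong\mathbb R^6$ of real dimension four. Its complement $\mathcal G=\mathfrak k_A\setminus\mathcal N$ has full Lebesgue measure, and any two elements of $\mathcal G$ can be joined by a path consisting of two line segments lying entirely in $\mathcal G$. In particular, $\mathcal G$ and its intersection with the unit sphere of $\mathfrak k_A\cong\mathbb R^6$ are path connected.
   Context: Octonions: $\mathbb O$ has real basis $1,e_1,\dots,e_7$ with $1$ the identity, $e_i^2=-1$, and multiplication given by the oriented triples $(123),(145),(176),(246),(257),(347),(365)$: for a triple $(abc)$, $e_ae_b=e_c$, $e_be_c=e_a$, $e_ce_a=e_b$, and reversing the order changes the sign. $V=\operatorname{Im}\mathbb O$. $G_2=\operatorname{Aut}(\mathbb O)$, $\mathfrak g_2=\operatorname{Der}(\mathbb O)$, acting on $V$. $H_A=\operatorname{span}\{1,e_1,e_2,e_3\}$ and $\mathfrak k_A=\{Z\in\mathfrak g_2:Z(H_A)\subseteq H_A\}$, a six-dimensional real vector space with basis $D_{12},D_{13},D_{23},D_{45},D_{46},D_{47}$, where $D_{ij}=D_{e_i,e_j}$, $D_{a,b}(x)=[[a,b],x]-3[a,b,x]$, $[a,b]=ab-ba$, $[a,b,x]=(ab)x-a(bx)$. $S\in G_2$ is the involution $S(e_1)=e_1$, $e_2\leftrightarrow e_4$, $e_3\leftrightarrow e_5$, $S(e_6)=-e_6$, $S(e_7)=-e_7$. $L_Z$ is the smallest real Lie subalgebra of $\mathfrak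 g_2$ containing $Z$ and $SZS^{-1}$. Real algebraic means a common zero set of real polynomials; dimension is the usual dimension of semialgebraic sets (the maximum dimension of smooth strata). Full Lebesgue measure means the complement has measure zero. *)

theory Defs
  imports "HOL-Analysis.Analysis"
begin

section \<open>The octonions\<close>

text \<open>
  The coordinates of an octonion are indexed by the eight-element type \<open>8\<close>, whose elements are
  \<open>0, \<dots>, 7\<close>; the index \<open>0\<close> stands for the identity. The library multiplication \<open>*\<close> on
  \<open>real ^ 8\<close> is the componentwise one and is not used.
\<close>

type_synonym octonion = "real ^ 8"

definition oct_unit :: "8 \<Rightarrow> octonion" where
  "oct_unit i = axis i 1"

definition oriented_triples :: "(8 \<times> 8 \<times> 8) set" where
  "oriented_triples = {(1,2,3), (1,4,5), (1,7,6), (2,4,6), (2,5,7), (3,4,7), (3,6,5)}"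

definition cyclic_triples :: "(8 \<times> 8 \<times> 8) set" where
  "cyclic_triples = {(a,b,c). (a,b,c) \<in> oriented_triples \<or> (c,a,b) \<in> oriented_triples
                              \<or> (b,c,a) \<in> oriented_triples}"

definition triple_sign :: "8 \<Rightarrow> 8 \<Rightarrow> 8 \<Rightarrow> real" where
  "triple_sign a b c =
     (if (a,b,c) \<in> cyclic_triples then 1 else if (b,a,c) \<in> cyclic_triples then - 1 else 0)"

text \<open>
  For distinct imaginary units exactly one summand in the last line is nonzero, since any two
  distinct indices among \<open>1, \<dots>, 7\<close> lie in exactly one triple.
\<close>

definition unit_mult :: "8 \<Rightarrow> 8 \<Rightarrow> octonion" where
  "unit_mult a b =
     (if a = 0 then oct_unit b
      else if b = 0 then oct_unit a
      else if a = b then - oct_unit 0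
      else (\<Sum>c\<in>UNIV. triple_sign a b c *\<^sub>R oct_unit c))"

definition oct_mult :: "octonion \<Rightarrow> octonion \<Rightarrow> octonion" (infixl "\<odot>" 70) where
  "x \<odot> y = (\<Sum>a\<in>UNIV. \<Sum>b\<in>UNIV. (x $ a * y $ b) *\<^sub>R unit_mult a b)"


section \<open>The Lie algebra of derivations\<close>

text \<open>
  Real-linear endomorphisms of the octonions are represented by their matrices in the standard
  basis, acting by \<open>*v\<close>. Derivations kill the identity and preserve the imaginary octonions, so
  acting on all octonions and acting on the imaginary ones amount to
  the same.
\<close>

type_synonym oct_endo = "real ^ 8 ^ 8"

definition g2 :: "oct_endo set" where
  "g2 = {Z. \<forall>x y. Z *v (x \<odot> y) = (Z *v x) \<odot> y + x \<odot> (Z *v y)}"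

definition lie_bracket :: "oct_endo \<Rightarrow> oct_endo \<Rightarrow> oct_endo" where
  "lie_bracket X Y = X ** Y - Y ** X"

definition lie_subalgebra :: "oct_endo set \<Rightarrow> oct_endo set \<Rightarrow> bool" where
  "lie_subalgebra L M \<longleftrightarrow> subspace L \<and> L \<subseteq> M \<and> (\<forall>X\<in>L. \<forall>Y\<in>L. lie_bracket X Y \<in> L)"

definition H_A :: "octonion set" where
  "H_A = span {oct_unit 0, oct_unit 1, oct_unit 2, oct_unit 3}"

definition k_A :: "oct_endo set" where
  "k_A = {Z \<in> g2. (\<lambda>x. Z *v x) ` H_A \<subseteq> H_A}"

definition S_unit :: "8 \<Rightarrow> octonion" where
  "S_unit i =
     (if i = 2 then oct_unit 4 else if i = 4 then oct_unit 2
      else if i = 3 then oct_unit 5 else if i = 5 then oct_unit 3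
      else if i = 6 then - oct_unit 6 else if i = 7 then - oct_unit 7
      else oct_unit i)"

definition S_mat :: oct_endo where
  "S_mat = matrix (\<lambda>x. \<Sum>i\<in>UNIV. x $ i *\<^sub>R S_unit i)"

definition L_gen :: "oct_endo \<Rightarrow> oct_endo set" where
  "L_gen Z = \<Inter> {L. lie_subalgebra L g2 \<and> Z \<in> L \<and> S_mat ** Z ** matrix_inv S_mat \<in> L}"

definition N_set :: "oct_endo set" where
  "N_set = {Z \<in> k_A. L_gen Z \<noteq> g2}"

definition G_set :: "oct_endo set" where
  "G_set = k_A - N_set"


section \<open>Real algebraic and semialgebraic sets, dimension\<close>

definition real_algebraic :: "'a::euclidean_space set \<Rightarrow> bool" where
  "real_algebraic A \<longleftrightarrow>
     (\<exists>P. (\<forall>p\<in>P. real_polynomial_function p) \<and> A = {x. \<forall>p\<in>P. p x = 0})"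

inductive semialgebraic :: "'a::euclidean_space set \<Rightarrow> bool" where
  pos: "real_polynomial_function p \<Longrightarrow> semialgebraic {x. p x > 0}"
| compl: "semialgebraic A \<Longrightarrow> semialgebraic (- A)"
| inter: "semialgebraic A \<Longrightarrow> semialgebraic B \<Longrightarrow> semialgebraic (A \<inter> B)"

text \<open>Meant for open \<open>U\<close>; the iterated derivatives are taken along the standard basis.\<close>

primrec C_k_on ::
  "nat \<Rightarrow> ('a::euclidean_space \<Rightarrow> 'b::real_normed_vector) \<Rightarrow> 'a set \<Rightarrow> bool" where
  "C_k_on 0 f U \<longleftrightarrow> continuous_on U f"
| "C_k_on (Suc k) f U \<longleftrightarrow>
     (\<forall>x\<in>U. f differentiable (at x)) \<and>
     (\<forall>b\<in>Basis. C_k_on k (\<lambda>x. frechet_derivative f (at x) b) U)"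

definition smooth_on :: "('a::euclidean_space \<Rightarrow> 'b::real_normed_vector) \<Rightarrow> 'a set \<Rightarrow> bool" where
  "smooth_on f U \<longleftrightarrow> (\<forall>k. C_k_on k f U)"

text \<open>
  Embedded submanifolds without boundary, via slice charts; \<open>M\<close> need not be closed. The empty set
  is a submanifold of every dimension.
\<close>

definition smooth_submanifold :: "nat \<Rightarrow> 'a::euclidean_space set \<Rightarrow> bool" where
  "smooth_submanifold d M \<longleftrightarrow>
     (\<forall>x\<in>M. \<exists>U V T. \<exists>(f :: 'a \<Rightarrow> 'a) g.
        open U \<and> x \<in> U \<and> open V \<and> homeomorphism U V f g \<and> smooth_on f U \<and> smooth_on g V \<and>
        subspace T \<and> dim T = d \<and> f ` (M \<inter> U) = T \<inter> V)"

text \<open>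
  The dimension of a nonempty semialgebraic set: the largest dimension of a stratum in a finite
  decomposition into smooth semialgebraic strata. It does not depend on the decomposition.
\<close>

definition has_semialgebraic_dim :: "'a::euclidean_space set \<Rightarrow> nat \<Rightarrow> bool" where
  "has_semialgebraic_dim A d \<longleftrightarrow>
     (\<exists>\<S>. finite \<S> \<and> disjoint \<S> \<and> \<Union>\<S> = A \<and>
        (\<forall>M\<in>\<S>. M \<noteq> {} \<and> semialgebraic M \<and> (\<exists>k\<le>d. smooth_submanifold k M)) \<and>
        (\<exists>M\<in>\<S>. smooth_submanifold d M))"

end

theory Submission
  imports Defs
begin

text \<open>
  In quaternion coordinates an element of \<open>k_A\<close> is a pair \<open>(a, b)\<close> of imaginary quaternions.
  Conjugation by an element of \<open>G\<^sub>2\<close> moves it into a fixed maximal torus, where its roots are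
  \<open>2|a|\<close>, \<open>2|b|\<close>, \<open>|a| \<plusminus> |b|\<close> and \<open>3|a| \<plusminus> |b|\<close>. If \<open>|a| \<noteq> |b|\<close> and \<open>|b| \<noteq> 3|a|\<close>, the root planes of
  \<open>|a| + |b|\<close> and \<open>3|a| + |b|\<close> can be separated from all others, and if moreover a certain
  cubic-linear form in \<open>(a, b)\<close> does not vanish, the second generator has a nonzero component in
  both. These are planes of simple roots, so they generate everything. Hence \<open>N\<close> lies in the union
  of three hypersurfaces. Each of them is, up to a small set, the image of a polynomial map from
  \<open>\<real>\<^sup>5\<close> and contains a point outside \<open>N\<close>. Since \<open>N\<close> is the zero set of determinants formed from
  bracket words, it has codimension at least two. It contains the four-dimensional space of elements
  killing \<open>e\<^sub>1\<close>. A codimension-two set does not meet \<open>[X, W] \<union> [W, Y]\<close> for almost all \<open>W\<close>.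

  The stratification comes from Whitney's argument: where the rank of the differentials of the ideal
  of \<open>V\<close> is maximal, differentiation along \<open>V\<close> maps the ideal to itself, so near such a point the
  common zero set of finitely many of its elements with independent differentials does not leave
  \<open>V\<close>. The remaining points form a smaller algebraic set, and Hilbert's basis theorem ends the
  recursion.
\<close>

section \<open>The octonions in coordinates\<close>

text \<open>Among the squared roots only two coincidences can merge the plane of
  \<open>|a| + |b|\<close> or of \<open>3|a| + |b|\<close> with another one, namely
  \<open>|a| = |b|\<close> and \<open>|b| = 3|a|\<close>. These are two of the hypersurfaces; on the
  third the second generator may lose its component in one of the planes. Removing hypersurfaces
  would not leave a connected set, so each of them needs a point of its own outside
  \<open>N\<close>. The root argument is silent there, and two explicit integer points are settled
  by elimination among brackets. One such point controls a whole hypersurface only if the latter is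
  irreducible. The polynomial parametrizations stand in for irreducibility: a defining polynomial of
  \<open>N\<close>, pulled back to affine space, is nonzero somewhere, hence its zero set is null.
  Thinness then serves twice. It makes the set of bad corners \<open>W\<close> null, and it bounds
  the dimension of every stratum by four, because a five-dimensional stratum moved along a normal
  direction would sweep out a ball.\<close>

lemma UNIV_8: "(UNIV :: 8 set) = {0, 1, 2, 3, 4, 5, 6, 7}"
proof (rule sym, rule card_subset_eq)
  show "card {0, 1, 2, 3, 4, 5, 6, 7 :: 8} = card (UNIV :: 8 set)"
    by simp
qed auto

lemma sum_8: "sum f (UNIV :: 8 set) = f 0 + f 1 + f 2 + f 3 + f 4 + f 5 + f 6 + f 7"
  unfolding UNIV_8 by (simp add: ac_simps)

lemma forall_8: "(\<forall>i::8. P i) \<longleftrightarrow> P 0 \<and> P 1 \<and> P 2 \<and> P 3 \<and> P 4 \<and> P 5 \<and> P 6 \<and> P 7"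
  using UNIV_8 by (metis UNIV_I insertE singletonD)

definition vec8 :: "'a \<Rightarrow> 'a \<Rightarrow> 'a \<Rightarrow> 'a \<Rightarrow> 'a \<Rightarrow> 'a \<Rightarrow> 'a \<Rightarrow> 'a \<Rightarrow> 'a ^ 8" where
  "vec8 x0 x1 x2 x3 x4 x5 x6 x7 =
     (\<chi> i. if i = 0 then x0 else if i = 1 then x1 else if i = 2 then x2 else if i = 3 then x3
           else if i = 4 then x4 else if i = 5 then x5 else if i = 6 then x6 else x7)"

lemma vec8_nth [simp]:
  "vec8 x0 x1 x2 x3 x4 x5 x6 x7 $ 0 = x0" "vec8 x0 x1 x2 x3 x4 x5 x6 x7 $ 1 = x1"
  "vec8 x0 x1 x2 x3 x4 x5 x6 x7 $ 2 = x2" "vec8 x0 x1 x2 x3 x4 x5 x6 x7 $ 3 = x3"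
  "vec8 x0 x1 x2 x3 x4 x5 x6 x7 $ 4 = x4" "vec8 x0 x1 x2 x3 x4 x5 x6 x7 $ 5 = x5"
  "vec8 x0 x1 x2 x3 x4 x5 x6 x7 $ 6 = x6" "vec8 x0 x1 x2 x3 x4 x5 x6 x7 $ 7 = x7"
  by (simp_all add: vec8_def)

lemma vec_eq_8: "(x :: 'a ^ 8) = y \<longleftrightarrow> x $ 0 = y $ 0 \<and> x $ 1 = y $ 1 \<and> x $ 2 = y $ 2 \<and> x $ 3 = y $ 3
    \<and> x $ 4 = y $ 4 \<and> x $ 5 = y $ 5 \<and> x $ 6 = y $ 6 \<and> x $ 7 = y $ 7"
  by (simp add: vec_eq_iff forall_8)

lemma oct_unit_nth: "oct_unit i $ j = (if i = j then 1 else 0)"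
  by (simp add: oct_unit_def axis_def eq_commute)

lemma index_less_distinct:
  "(0 :: 8) \<noteq> 1" "(0 :: 8) \<noteq> 2" "(0 :: 8) \<noteq> 3" "(0 :: 8) \<noteq> 4" "(0 :: 8) \<noteq> 5"
  "(0 :: 8) \<noteq> 6" "(0 :: 8) \<noteq> 7" "(1 :: 8) \<noteq> 2" "(1 :: 8) \<noteq> 3" "(1 :: 8) \<noteq> 4"
  "(1 :: 8) \<noteq> 5" "(1 :: 8) \<noteq> 6" "(1 :: 8) \<noteq> 7" "(2 :: 8) \<noteq> 3" "(2 :: 8) \<noteq> 4"
  "(2 :: 8) \<noteq> 5" "(2 :: 8) \<noteq> 6" "(2 :: 8) \<noteq> 7" "(3 :: 8) \<noteq> 4" "(3 :: 8) \<noteq> 5"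
  "(3 :: 8) \<noteq> 6" "(3 :: 8) \<noteq> 7" "(4 :: 8) \<noteq> 5" "(4 :: 8) \<noteq> 6" "(4 :: 8) \<noteq> 7"
  "(5 :: 8) \<noteq> 6" "(5 :: 8) \<noteq> 7" "(6 :: 8) \<noteq> 7"
  by simp_all

lemmas index_distinct [simp] = index_less_distinct index_less_distinct[symmetric]

lemma cyclic_triples_explicit:
  "cyclic_triples =
    {(1,2,3), (1,4,5), (1,7,6), (2,4,6), (2,5,7), (3,4,7), (3,6,5),
     (3,1,2), (5,1,4), (6,1,7), (6,2,4), (7,2,5), (7,3,4), (5,3,6),
     (2,3,1), (4,5,1), (7,6,1), (4,6,2), (5,7,2), (4,7,3), (6,5,3)}"
proof -
  have "cyclic_triples = oriented_triples \<union> (\<lambda>(a,b,c). (c,a,b)) ` oriented_triples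
      \<union> (\<lambda>(a,b,c). (b,c,a)) ` oriented_triples"
    unfolding cyclic_triples_def by force
  then show ?thesis
    unfolding oriented_triples_def by (simp only: image_insert image_empty case_prod_conv
      Un_insert_left Un_empty_left)
qed

lemmas triple_sign_eval =
  triple_sign_def cyclic_triples_explicit insert_iff empty_iff prod.inject index_distinct simp_thms
    if_True if_False

lemma unit_mult_table:
  "unit_mult 0 0 = oct_unit 0" "unit_mult 0 1 = oct_unit 1" "unit_mult 0 2 = oct_unit 2"
  "unit_mult 0 3 = oct_unit 3" "unit_mult 0 4 = oct_unit 4" "unit_mult 0 5 = oct_unit 5"
  "unit_mult 0 6 = oct_unit 6" "unit_mult 0 7 = oct_unit 7" "unit_mult 1 0 = oct_unit 1"
  "unit_mult 1 1 = - oct_unit 0" "unit_mult 1 2 = oct_unit 3" "unit_mult 1 3 = - oct_unit 2"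
  "unit_mult 1 4 = oct_unit 5" "unit_mult 1 5 = - oct_unit 4" "unit_mult 1 6 = - oct_unit 7"
  "unit_mult 1 7 = oct_unit 6" "unit_mult 2 0 = oct_unit 2" "unit_mult 2 1 = - oct_unit 3"
  "unit_mult 2 2 = - oct_unit 0" "unit_mult 2 3 = oct_unit 1" "unit_mult 2 4 = oct_unit 6"
  "unit_mult 2 5 = oct_unit 7" "unit_mult 2 6 = - oct_unit 4" "unit_mult 2 7 = - oct_unit 5"
  "unit_mult 3 0 = oct_unit 3" "unit_mult 3 1 = oct_unit 2" "unit_mult 3 2 = - oct_unit 1"
  "unit_mult 3 3 = - oct_unit 0" "unit_mult 3 4 = oct_unit 7" "unit_mult 3 5 = - oct_unit 6"
  "unit_mult 3 6 = oct_unit 5" "unit_mult 3 7 = - oct_unit 4" "unit_mult 4 0 = oct_unit 4"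
  "unit_mult 4 1 = - oct_unit 5" "unit_mult 4 2 = - oct_unit 6" "unit_mult 4 3 = - oct_unit 7"
  "unit_mult 4 4 = - oct_unit 0" "unit_mult 4 5 = oct_unit 1" "unit_mult 4 6 = oct_unit 2"
  "unit_mult 4 7 = oct_unit 3" "unit_mult 5 0 = oct_unit 5" "unit_mult 5 1 = oct_unit 4"
  "unit_mult 5 2 = - oct_unit 7" "unit_mult 5 3 = oct_unit 6" "unit_mult 5 4 = - oct_unit 1"
  "unit_mult 5 5 = - oct_unit 0" "unit_mult 5 6 = - oct_unit 3" "unit_mult 5 7 = oct_unit 2"
  "unit_mult 6 0 = oct_unit 6" "unit_mult 6 1 = oct_unit 7" "unit_mult 6 2 = oct_unit 4"
  "unit_mult 6 3 = - oct_unit 5" "unit_mult 6 4 = - oct_unit 2" "unit_mult 6 5 = oct_unit 3"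
  "unit_mult 6 6 = - oct_unit 0" "unit_mult 6 7 = - oct_unit 1" "unit_mult 7 0 = oct_unit 7"
  "unit_mult 7 1 = - oct_unit 6" "unit_mult 7 2 = oct_unit 5" "unit_mult 7 3 = oct_unit 4"
  "unit_mult 7 4 = - oct_unit 3" "unit_mult 7 5 = - oct_unit 2" "unit_mult 7 6 = oct_unit 1"
  "unit_mult 7 7 = - oct_unit 0"
  by (simp_all only: unit_mult_def sum_8 triple_sign_eval
        scaleR_one scaleR_zero_left scaleR_minus_left add_0_left add_0_right)

lemma oct_mult_nth_sum: "(x \<odot> y) $ k = (\<Sum>a\<in>UNIV. \<Sum>b\<in>UNIV. x $ a * y $ b * unit_mult a b $ k)"
  by (simp add: oct_mult_def)

lemma oct_mult_nth:
  "(x \<odot> y) $ 0 = x $ 0 * y $ 0 - x $ 1 * y $ 1 - x $ 2 * y $ 2 - x $ 3 * y $ 3 - x $ 4 * y $ 4 - x $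
    5 * y $ 5 - x $ 6 * y $ 6 - x $ 7 * y $ 7"
  "(x \<odot> y) $ 1 = x $ 0 * y $ 1 + x $ 1 * y $ 0 + x $ 2 * y $ 3 - x $ 3 * y $ 2 + x $ 4 * y $ 5 - x $
    5 * y $ 4 - x $ 6 * y $ 7 + x $ 7 * y $ 6"
  "(x \<odot> y) $ 2 = x $ 0 * y $ 2 - x $ 1 * y $ 3 + x $ 2 * y $ 0 + x $ 3 * y $ 1 + x $ 4 * y $ 6 + x $
    5 * y $ 7 - x $ 6 * y $ 4 - x $ 7 * y $ 5"
  "(x \<odot> y) $ 3 = x $ 0 * y $ 3 + x $ 1 * y $ 2 - x $ 2 * y $ 1 + x $ 3 * y $ 0 + x $ 4 * y $ 7 - x $
    5 * y $ 6 + x $ 6 * y $ 5 - x $ 7 * y $ 4"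
  "(x \<odot> y) $ 4 = x $ 0 * y $ 4 - x $ 1 * y $ 5 - x $ 2 * y $ 6 - x $ 3 * y $ 7 + x $ 4 * y $ 0 + x $
    5 * y $ 1 + x $ 6 * y $ 2 + x $ 7 * y $ 3"
  "(x \<odot> y) $ 5 = x $ 0 * y $ 5 + x $ 1 * y $ 4 - x $ 2 * y $ 7 + x $ 3 * y $ 6 - x $ 4 * y $ 1 + x $
    5 * y $ 0 - x $ 6 * y $ 3 + x $ 7 * y $ 2"
  "(x \<odot> y) $ 6 = x $ 0 * y $ 6 + x $ 1 * y $ 7 + x $ 2 * y $ 4 - x $ 3 * y $ 5 - x $ 4 * y $ 2 + x $
    5 * y $ 3 + x $ 6 * y $ 0 - x $ 7 * y $ 1"
  "(x \<odot> y) $ 7 = x $ 0 * y $ 7 - x $ 1 * y $ 6 + x $ 2 * y $ 5 + x $ 3 * y $ 4 - x $ 4 * y $ 3 - x $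
    5 * y $ 2 + x $ 6 * y $ 1 + x $ 7 * y $ 0"
  by (simp_all only: oct_mult_nth_sum sum_8 unit_mult_table oct_unit_nth index_distinct simp_thms
        vector_uminus_component if_True if_False mult_1_right mult_minus_right mult_zero_right
        add_0_left add_0_right minus_zero diff_conv_add_uminus)

lemma oct_mult_bilinear: "bounded_bilinear (\<odot>)"
proof (rule bilinear_conv_bounded_bilinear[THEN iffD1])
  show "bilinear (\<odot>)"
    unfolding bilinear_def oct_mult_def
    by (auto intro!: linearI simp: sum.distrib scaleR_sum_right algebra_simps)
qed

interpretation oct_mult: bounded_bilinear "(\<odot>)"
  by (rule oct_mult_bilinear)

lemma matrix_vector_mult_minus: "(Z :: real ^ 'n ^ 'm) *v (- x) = - (Z *v x)"
  using matrix_vector_mult_diff_distrib[of Z 0 x] by simp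

lemma mult_oct_unit_nth: "((Z :: oct_endo) *v oct_unit a) $ i = Z $ i $ a"
  by (simp add: oct_unit_def matrix_vector_mult_basis column_def)

lemma oct_unit_expansion: "(x :: octonion) = (\<Sum>a\<in>UNIV. x $ a *\<^sub>R oct_unit a)"
  by (simp add: vec_eq_iff oct_unit_nth if_distrib cong: if_cong)

lemma oct_unit_mult: "oct_unit a \<odot> oct_unit b = unit_mult a b"
proof -
  have "(oct_unit a $ c * oct_unit b $ d) *\<^sub>R unit_mult c d
      = (if c = a then if d = b then unit_mult c d else 0 else 0)" for c d
    by (simp add: oct_unit_nth)
  then have "oct_unit a \<odot> oct_unit b = (\<Sum>c\<in>UNIV. \<Sum>d\<in>UNIV. if c = a then if d = b then unit_mult c d
    else 0 else 0)"
    unfolding oct_mult_def by (intro sum.cong refl)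
  also have "\<dots> = (\<Sum>c\<in>UNIV. if c = a then unit_mult c b else 0)"
    by (intro sum.cong refl) simp
  finally show ?thesis
    by simp
qed

lemma oct_bilinear_eqI:
  assumes "bounded_bilinear f" "bounded_bilinear g"
    and "\<And>a b. f (oct_unit a) (oct_unit b) = g (oct_unit a) (oct_unit b)"
  shows "f x y = (g x y :: octonion)"
proof -
  interpret f: bounded_bilinear f by fact
  interpret g: bounded_bilinear g by fact
  have "f (\<Sum>a\<in>UNIV. x $ a *\<^sub>R oct_unit a) (\<Sum>a\<in>UNIV. y $ a *\<^sub>R oct_unit a)
      = g (\<Sum>a\<in>UNIV. x $ a *\<^sub>R oct_unit a) (\<Sum>a\<in>UNIV. y $ a *\<^sub>R oct_unit a)"
    by (simp only: f.sum_left f.sum_right g.sum_left g.sum_right f.scaleR_left f.scaleR_right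
        g.scaleR_left g.scaleR_right assms(3))
  then show ?thesis
    by (simp flip: oct_unit_expansion)
qed

section \<open>Derivations and their fourteen coordinates\<close>

lemma g2_iff_basis:
  "Z \<in> g2 \<longleftrightarrow> (\<forall>a b. Z *v unit_mult a b = (Z *v oct_unit a) \<odot> oct_unit b + oct_unit a \<odot> (Z *v oct_unit b))"
proof
  assume "Z \<in> g2"
  then show "\<forall>a b. Z *v unit_mult a b = (Z *v oct_unit a) \<odot> oct_unit b + oct_unit a \<odot> (Z *v oct_unit b)"
    by (simp add: g2_def flip: oct_unit_mult)
next
  assume *: "\<forall>a b. Z *v unit_mult a b = (Z *v oct_unit a) \<odot> oct_unit b + oct_unit a \<odot> (Z *v oct_unit b)"
  have "Z *v (x \<odot> y) = (Z *v x) \<odot> y + x \<odot> (Z *v y)" for x y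
  proof (rule oct_bilinear_eqI[of "\<lambda>x y. Z *v (x \<odot> y)" "\<lambda>x y. (Z *v x) \<odot> y + x \<odot> (Z *v y)"])
    have "bilinear (\<lambda>x y. Z *v (x \<odot> y))"
      unfolding bilinear_def
      by (auto intro!: linearI simp: oct_mult.add_left oct_mult.add_right oct_mult.scaleR_left
          oct_mult.scaleR_right matrix_vector_right_distrib matrix_vector_mult_scaleR)
    then show "bounded_bilinear (\<lambda>x y. Z *v (x \<odot> y))"
      by (rule bilinear_conv_bounded_bilinear[THEN iffD1])
  next
    have "bilinear (\<lambda>x y. (Z *v x) \<odot> y + x \<odot> (Z *v y))"
      unfolding bilinear_def
      by (auto intro!: linearI simp: oct_mult.add_left oct_mult.add_right oct_mult.scaleR_left
          oct_mult.scaleR_right matrix_vector_right_distrib matrix_vector_mult_scaleR scaleR_add_right)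
    then show "bounded_bilinear (\<lambda>x y. (Z *v x) \<odot> y + x \<odot> (Z *v y))"
      by (rule bilinear_conv_bounded_bilinear[THEN iffD1])
  qed (use * in \<open>simp add: oct_unit_mult\<close>)
  then show "Z \<in> g2"
    by (simp add: g2_def)
qed

lemma subspace_g2: "subspace g2"
  unfolding subspace_def g2_def
  by (auto simp: matrix_vector_mult_add_rdistrib oct_mult.add_left oct_mult.add_right
      oct_mult.scaleR_left oct_mult.scaleR_right scaleR_add_right oct_mult.zero_left oct_mult.zero_right
      simp flip: scaleR_matrix_vector_assoc)

lemma lie_bracket_g2: "X \<in> g2 \<Longrightarrow> Y \<in> g2 \<Longrightarrow> lie_bracket X Y \<in> g2"
  unfolding g2_def lie_bracket_def
  by (simp add: matrix_vector_mult_diff_rdistrib matrix_vector_right_distrib oct_mult.diff_left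
    oct_mult.diff_right
      flip: matrix_vector_mul_assoc)

text \<open>The units \<open>e_1\<close>, \<open>e_2\<close>, \<open>e_4\<close> generate the
  octonions as an algebra, so the Leibniz rule carries the vanishing to the other units.\<close>

lemma g2_eq_0I:
  assumes Z: "Z \<in> g2" and 1: "Z *v oct_unit 1 = 0" and 2: "Z *v oct_unit 2 = 0" and 4:
    "Z *v oct_unit 4 = 0"
  shows "Z = 0"
proof -
  have D: "Z *v unit_mult a b = (Z *v oct_unit a) \<odot> oct_unit b + oct_unit a \<odot> (Z *v oct_unit b)" for a b
    using Z g2_iff_basis by blast
  have 0: "Z *v oct_unit 0 = 0"
    using D[of 1 1] 1 by (simp add: unit_mult_table oct_mult.zero_left oct_mult.zero_right
      matrix_vector_mult_minus)
  have 3: "Z *v oct_unit 3 = 0"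
    using D[of 1 2] 1 2 by (simp add: unit_mult_table oct_mult.zero_left oct_mult.zero_right)
  have 5: "Z *v oct_unit 5 = 0"
    using D[of 1 4] 1 4 by (simp add: unit_mult_table oct_mult.zero_left oct_mult.zero_right)
  have 6: "Z *v oct_unit 6 = 0"
    using D[of 2 4] 2 4 by (simp add: unit_mult_table oct_mult.zero_left oct_mult.zero_right)
  have 7: "Z *v oct_unit 7 = 0"
    using D[of 3 4] 3 4 by (simp add: unit_mult_table oct_mult.zero_left oct_mult.zero_right)
  have "\<forall>a. Z *v oct_unit a = 0"
    unfolding forall_8 using 0 1 2 3 4 5 6 7 by simp
  then have "\<forall>i a. Z $ i $ a = 0"
    by (metis mult_oct_unit_nth zero_index)
  then show ?thesis
    by (simp add: vec_eq_iff)
qed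

text \<open>Ten relations among the 24 entries of columns 1, 2 and 4; the 14 entries left over match
  the dimension of \<open>g2\<close>. The first nine come from differentiating
  \<open>e_i e_i = -1\<close> and the anticommutation of distinct units, the last from
  \<open>e_1 e_2 = e_3\<close> together with skewness in the indices 3 and 4.\<close>

lemma g2_entries:
  assumes Z: "Z \<in> g2"
  shows "Z $ 0 $ 1 = 0" "Z $ 1 $ 1 = 0" "Z $ 0 $ 2 = 0" "Z $ 2 $ 2 = 0" "Z $ 0 $ 4 = 0" "Z $ 4 $ 4 = 0"
    "Z $ 1 $ 2 = - Z $ 2 $ 1" "Z $ 1 $ 4 = - Z $ 4 $ 1" "Z $ 2 $ 4 = - Z $ 4 $ 2"
    "Z $ 3 $ 4 = Z $ 5 $ 2 - Z $ 6 $ 1"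
proof -
  have "Z *v unit_mult a b = (Z *v oct_unit a) \<odot> oct_unit b + oct_unit a \<odot> (Z *v oct_unit b)" for a b
    using Z g2_iff_basis by blast
  then have D: "(Z *v unit_mult a b) $ i = ((Z *v oct_unit a) \<odot> oct_unit b) $ i + (oct_unit a \<odot> (Z
    *v oct_unit b)) $ i" for a b i
    by simp
  note s = unit_mult_table oct_mult_nth mult_oct_unit_nth oct_unit_nth matrix_vector_mult_minus
  have z: "Z $ i $ 0 = 0" for i
  proof -
    have "Z *v unit_mult 0 0 = (Z *v oct_unit 0) \<odot> oct_unit 0 + oct_unit 0 \<odot> (Z *v oct_unit 0)"
      using Z g2_iff_basis by blast
    moreover have "x \<odot> oct_unit 0 = x" "oct_unit 0 \<odot> x = x" for x
      by (simp_all add: vec_eq_8 oct_mult_nth oct_unit_nth)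
    ultimately show ?thesis
      by (simp add: unit_mult_table flip: mult_oct_unit_nth)
  qed
  show "Z $ 0 $ 1 = 0" using D[of 1 1 1] z by (simp add: s)
  show "Z $ 1 $ 1 = 0" using D[of 1 1 0] z by (simp add: s)
  show "Z $ 0 $ 2 = 0" using D[of 2 2 2] z by (simp add: s)
  show "Z $ 2 $ 2 = 0" using D[of 2 2 0] z by (simp add: s)
  show "Z $ 0 $ 4 = 0" using D[of 4 4 4] z by (simp add: s)
  show "Z $ 4 $ 4 = 0" using D[of 4 4 0] z by (simp add: s)
  show 12: "Z $ 1 $ 2 = - Z $ 2 $ 1" using D[of 1 2 0] D[of 2 1 0] z by (simp add: s)
  show 14: "Z $ 1 $ 4 = - Z $ 4 $ 1" using D[of 1 4 0] D[of 4 1 0] z by (simp add: s)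
  show 24: "Z $ 2 $ 4 = - Z $ 4 $ 2" using D[of 2 4 0] D[of 4 2 0] z by (simp add: s)
  have "Z $ 3 $ 4 = - Z $ 4 $ 3" using D[of 3 4 0] D[of 4 3 0] z by (simp add: s)
  moreover have "Z $ 4 $ 3 = Z $ 6 $ 1 - Z $ 5 $ 2" using D[of 1 2 4] z by (simp add: s)
  ultimately show "Z $ 3 $ 4 = Z $ 5 $ 2 - Z $ 6 $ 1" by simp
qed

text \<open>Cuts identities between derivations, such as the bracket table and the formula for
  conjugation by \<open>S\<close>, from 64 entries to 14.\<close>

lemma g2_eqI:
  assumes X: "X \<in> g2" and Y: "Y \<in> g2"
    and 1: "X $ 2 $ 1 = Y $ 2 $ 1" "X $ 3 $ 1 = Y $ 3 $ 1" "X $ 4 $ 1 = Y $ 4 $ 1" "X $ 5 $ 1 = Y $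
      5 $ 1"
      "X $ 6 $ 1 = Y $ 6 $ 1" "X $ 7 $ 1 = Y $ 7 $ 1"
    and 2: "X $ 3 $ 2 = Y $ 3 $ 2" "X $ 4 $ 2 = Y $ 4 $ 2" "X $ 5 $ 2 = Y $ 5 $ 2"
      "X $ 6 $ 2 = Y $ 6 $ 2" "X $ 7 $ 2 = Y $ 7 $ 2"
    and 4: "X $ 5 $ 4 = Y $ 5 $ 4" "X $ 6 $ 4 = Y $ 6 $ 4" "X $ 7 $ 4 = Y $ 7 $ 4"
  shows "X = Y"
proof -
  have "X - Y \<in> g2"
    by (intro subspace_diff subspace_g2 X Y)
  then have "X - Y = 0"
    by (rule g2_eq_0I)
       (simp_all add: vec_eq_8 mult_oct_unit_nth g2_entries[OF X] g2_entries[OF Y] 1 2 4)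
  then show ?thesis
    by simp
qed

text \<open>
  The general element of \<open>g2\<close>. Writing octonions as \<open>x + y l\<close> with quaternions \<open>x, y\<close> and \<open>l = e\<^sub>4\<close>,
  the imaginary quaternions \<open>a\<close>, \<open>b\<close> give the derivation \<open>x + y l \<mapsto> [a, x] + (b y - y a) l\<close>, while
  the quaternions \<open>u\<close>, \<open>w\<close> give the one sending \<open>e\<^sub>1, e\<^sub>2, e\<^sub>3\<close> to \<open>(2 u) l\<close>, \<open>(u e\<^sub>3 + w) l\<close>, \<open>(- u
  e\<^sub>2 + w e\<^sub>1) l\<close>. With this choice the coordinate pairs \<open>(a2, a3)\<close>, \<open>(b2, b3)\<close>, \<open>(u0, u1)\<close>, \<open>(u2,
  u3)\<close>, \<open>(w0, w1)\<close>, \<open>(w2, w3)\<close> are the root planes of the torus of the coordinates \<open>a1\<close>, \<open>b1\<close>.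
\<close>

definition gm :: "real \<Rightarrow> real \<Rightarrow> real \<Rightarrow> real \<Rightarrow> real \<Rightarrow> real \<Rightarrow> real \<Rightarrow> real \<Rightarrow> real \<Rightarrow> real \<Rightarrow>
    real \<Rightarrow> real \<Rightarrow> real \<Rightarrow> real \<Rightarrow> oct_endo" where
  "gm a1 a2 a3 b1 b2 b3 u0 u1 u2 u3 w0 w1 w2 w3 = vec8
     (vec8 0 0 0 0 0 0 0 0)
     (vec8 0 0 (- 2 * a3) (2 * a2) (- 2 * u0) (- 2 * u1) (- 2 * u2) (- 2 * u3))
     (vec8 0 (2 * a3) 0 (- 2 * a1) (u3 - w0) (- u2 - w1) (u1 - w2) (- u0 - w3))
     (vec8 0 (- 2 * a2) (2 * a1) 0 (- u2 + w1) (- u3 - w0) (u0 - w3) (u1 + w2))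
     (vec8 0 (2 * u0) (- u3 + w0) (u2 - w1) 0 (a1 - b1) (a2 - b2) (a3 - b3))
     (vec8 0 (2 * u1) (u2 + w1) (u3 + w0) (- a1 + b1) 0 (- a3 - b3) (a2 + b2))
     (vec8 0 (2 * u2) (- u1 + w2) (- u0 + w3) (- a2 + b2) (a3 + b3) 0 (- a1 - b1))
     (vec8 0 (2 * u3) (u0 + w3) (- u1 - w2) (- a3 + b3) (- a2 - b2) (a1 + b1) 0)"

lemma gm_g2: "gm a1 a2 a3 b1 b2 b3 u0 u1 u2 u3 w0 w1 w2 w3 \<in> g2"
  unfolding g2_iff_basis forall_8
  by (intro conjI)
     (simp_all only: vec_eq_8 unit_mult_table matrix_vector_mult_minus vector_uminus_component
       mult_oct_unit_nth
       vector_add_component oct_mult_nth oct_unit_nth gm_def vec8_nth index_distinct simp_thms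
         if_True if_False
       mult_zero_left mult_zero_right mult_1_left mult_1_right add_0_left add_0_right diff_0_right
         diff_0,
      simp_all)

lemma lie_bracket_gm:
  "lie_bracket (gm a1 a2 a3 b1 b2 b3 u0 u1 u2 u3 w0 w1 w2 w3) (gm aa1 aa2 aa3 bb1 bb2 bb3 uu0 uu1
    uu2 uu3 ww0 ww1 ww2 ww3) = gm
     (2 * a2 * aa3 - 2 * a3 * aa2 - u0 * uu1 + u1 * uu0 + u2 * uu3 - u3 * uu2 - w0 * ww1 + w1 * ww0
       + w2 * ww3 - w3 * ww2)
     (- 2 * a1 * aa3 + 2 * a3 * aa1 - 2 * u0 * uu2 + u0 * ww1 - 2 * u1 * uu3 - u1 * ww0 + 2 * u2 *
       uu0 - u2 * ww3 + 2 * u3 * uu1 + u3 * ww2 + w0 * uu1 - w1 * uu0 - w2 * uu3 + w3 * uu2)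
     (2 * a1 * aa2 - 2 * a2 * aa1 - 2 * u0 * uu3 + u0 * ww0 + 2 * u1 * uu2 + u1 * ww1 - 2 * u2 * uu1
       + u2 * ww2 + 2 * u3 * uu0 + u3 * ww3 - w0 * uu0 - w1 * uu1 - w2 * uu2 - w3 * uu3)
     (2 * b2 * bb3 - 2 * b3 * bb2 + 3 * u0 * uu1 - 3 * u1 * uu0 + 3 * u2 * uu3 - 3 * u3 * uu2 + w0 *
       ww1 - w1 * ww0 + w2 * ww3 - w3 * ww2)
     (- 2 * b1 * bb3 + 2 * b3 * bb1 + 3 * u0 * uu2 - 3 * u1 * uu3 - 3 * u2 * uu0 + 3 * u3 * uu1 + w0
       * ww2 - w1 * ww3 - w2 * ww0 + w3 * ww1)
     (2 * b1 * bb2 - 2 * b2 * bb1 + 3 * u0 * uu3 + 3 * u1 * uu2 - 3 * u2 * uu1 - 3 * u3 * uu0 + w0 *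
       ww3 + w1 * ww2 - w2 * ww1 - w3 * ww0)
     (a1 * uu1 + 2 * a2 * uu2 - a2 * ww1 + 2 * a3 * uu3 - a3 * ww0 - b1 * uu1 - b2 * uu2 - b3 * uu3
       - u1 * aa1 + u1 * bb1 - 2 * u2 * aa2 + u2 * bb2 - 2 * u3 * aa3 + u3 * bb3 + w0 * aa3 + w1 * aa2)
     (- a1 * uu0 + 2 * a2 * uu3 + a2 * ww0 - 2 * a3 * uu2 - a3 * ww1 + b1 * uu0 + b2 * uu3 - b3 *
       uu2 + u0 * aa1 - u0 * bb1 + 2 * u2 * aa3 + u2 * bb3 - 2 * u3 * aa2 - u3 * bb2 - w0 * aa2 + w1
       * aa3)
     (- a1 * uu3 - 2 * a2 * uu0 + a2 * ww3 + 2 * a3 * uu1 - a3 * ww2 - b1 * uu3 + b2 * uu0 + b3 *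
       uu1 + 2 * u0 * aa2 - u0 * bb2 - 2 * u1 * aa3 - u1 * bb3 + u3 * aa1 + u3 * bb1 + w2 * aa3 - w3
       * aa2)
     (a1 * uu2 - 2 * a2 * uu1 - a2 * ww2 - 2 * a3 * uu0 - a3 * ww3 + b1 * uu2 - b2 * uu1 + b3 * uu0
       + 2 * u0 * aa3 - u0 * bb3 + 2 * u1 * aa2 + u1 * bb2 - u2 * aa1 - u2 * bb1 + w2 * aa2 + w3 * aa3)
     (3 * a1 * ww1 - 3 * a2 * uu1 + 3 * a3 * uu0 - b1 * ww1 - b2 * ww2 - b3 * ww3 - 3 * u0 * aa3 + 3
       * u1 * aa2 - 3 * w1 * aa1 + w1 * bb1 + w2 * bb2 + w3 * bb3)
     (- 3 * a1 * ww0 + 3 * a2 * uu0 + 3 * a3 * uu1 + b1 * ww0 + b2 * ww3 - b3 * ww2 - 3 * u0 * aa2 -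
       3 * u1 * aa3 + 3 * w0 * aa1 - w0 * bb1 + w2 * bb3 - w3 * bb2)
     (- 3 * a1 * ww3 + 3 * a2 * uu3 + 3 * a3 * uu2 - b1 * ww3 + b2 * ww0 + b3 * ww1 - 3 * u2 * aa3 -
       3 * u3 * aa2 - w0 * bb2 - w1 * bb3 + 3 * w3 * aa1 + w3 * bb1)
     (3 * a1 * ww2 - 3 * a2 * uu2 + 3 * a3 * uu3 + b1 * ww2 - b2 * ww1 + b3 * ww0 + 3 * u2 * aa2 - 3
       * u3 * aa3 - w0 * bb3 + w1 * bb2 - 3 * w2 * aa1 - w2 * bb1)"
  by (rule g2_eqI[OF lie_bracket_g2[OF gm_g2 gm_g2] gm_g2];
      simp add: lie_bracket_def matrix_matrix_mult_def sum_8 gm_def field_simps)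

lemma g2_gm:
  assumes "Z \<in> g2"
  obtains a1 a2 a3 b1 b2 b3 u0 u1 u2 u3 w0 w1 w2 w3 where "Z = gm a1 a2 a3 b1 b2 b3 u0 u1 u2 u3 w0
    w1 w2 w3"
proof
  show "Z = gm (Z $ 3 $ 2 / 2) (- Z $ 3 $ 1 / 2) (Z $ 2 $ 1 / 2) (Z $ 5 $ 4 + Z $ 3 $ 2 / 2) (Z $ 6
    $ 4 - Z $ 3 $ 1 / 2) (Z $ 7 $ 4 + Z $ 2 $ 1 / 2) (Z $ 4 $ 1 / 2) (Z $ 5 $ 1 / 2) (Z $ 6 $ 1 / 2)
    (Z $ 7 $ 1 / 2) (Z $ 4 $ 2 + Z $ 7 $ 1 / 2) (Z $ 5 $ 2 - Z $ 6 $ 1 / 2) (Z $ 6 $ 2 + Z $ 5 $ 1 /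
    2) (Z $ 7 $ 2 - Z $ 4 $ 1 / 2)"
    by (rule g2_eqI[OF assms gm_g2]) (simp_all add: gm_def)
qed

lemma gm_inject:
  "gm a1 a2 a3 b1 b2 b3 u0 u1 u2 u3 w0 w1 w2 w3 = gm aa1 aa2 aa3 bb1 bb2 bb3 uu0 uu1 uu2 uu3 ww0 ww1
    ww2 ww3 \<longleftrightarrow>
    a1 = aa1 \<and> a2 = aa2 \<and> a3 = aa3 \<and> b1 = bb1 \<and> b2 = bb2 \<and> b3 = bb3 \<and> u0 = uu0 \<and> u1 = uu1 \<and> u2 = uu2
      \<and> u3 = uu3 \<and> w0 = ww0 \<and> w1 = ww1 \<and> w2 = ww2 \<and> w3 = ww3" (is "?l = ?r")
proof
  assume "?l"
  then have e: "gm a1 a2 a3 b1 b2 b3 u0 u1 u2 u3 w0 w1 w2 w3 $ i $ j = gm aa1 aa2 aa3 bb1 bb2 bb3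
    uu0 uu1 uu2 uu3 ww0 ww1 ww2 ww3 $ i $ j" for i j
    by simp
  from e[of 2 1] e[of 3 1] e[of 4 1] e[of 5 1] e[of 6 1] e[of 7 1] e[of 3 2] e[of 4 2] e[of 5 2]
    e[of 6 2]
    e[of 7 2] e[of 5 4] e[of 6 4] e[of 7 4]
  show ?r
    by (simp add: gm_def)
qed simp

lemma gm_add: "gm a1 a2 a3 b1 b2 b3 u0 u1 u2 u3 w0 w1 w2 w3 + gm aa1 aa2 aa3 bb1 bb2 bb3 uu0 uu1 uu2
  uu3 ww0 ww1 ww2 ww3
    = gm (a1 + aa1) (a2 + aa2) (a3 + aa3) (b1 + bb1) (b2 + bb2) (b3 + bb3) (u0 + uu0) (u1 + uu1) (u2
      + uu2) (u3 + uu3) (w0 + ww0) (w1 + ww1) (w2 + ww2) (w3 + ww3)"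
  by (simp add: gm_def vec_eq_8 algebra_simps)

lemma gm_scaleR: "c *\<^sub>R gm a1 a2 a3 b1 b2 b3 u0 u1 u2 u3 w0 w1 w2 w3 = gm (c * a1) (c * a2) (c * a3)
  (c * b1) (c * b2) (c * b3) (c * u0) (c * u1) (c * u2) (c * u3) (c * w0) (c * w1) (c * w2) (c * w3)"
  by (simp add: gm_def vec_eq_8 algebra_simps)

section \<open>Conjugation by automorphisms\<close>

text \<open>Only multiplicativity is recorded. Invertibility enters the conjugation lemmas as
  \<open>K ** K = mat 1\<close>, which lets \<open>K\<close> serve as its own inverse.\<close>

definition oct_automorphism :: "oct_endo \<Rightarrow> bool" where
  "oct_automorphism K \<longleftrightarrow> (\<forall>x y. K *v (x \<odot> y) = (K *v x) \<odot> (K *v y))"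

lemma oct_automorphism_basis:
  assumes "\<And>a b. K *v unit_mult a b = (K *v oct_unit a) \<odot> (K *v oct_unit b)"
  shows "oct_automorphism K"
  unfolding oct_automorphism_def
proof (intro allI)
  fix x y
  have "bilinear (\<lambda>x y. K *v (x \<odot> y))" "bilinear (\<lambda>x y. (K *v x) \<odot> (K *v y))"
    unfolding bilinear_def
    by (auto intro!: linearI simp: oct_mult.add_left oct_mult.add_right oct_mult.scaleR_left
        oct_mult.scaleR_right matrix_vector_right_distrib matrix_vector_mult_scaleR)
  then have "bounded_bilinear (\<lambda>x y. K *v (x \<odot> y))" "bounded_bilinear (\<lambda>x y. (K *v x) \<odot> (K *v y))"
    by (simp_all add: bilinear_conv_bounded_bilinear)
  then show "K *v (x \<odot> y) = (K *v x) \<odot> (K *v y)"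
    by (rule oct_bilinear_eqI) (simp only: oct_unit_mult assms)
qed

lemma involution_conj_g2:
  assumes K: "oct_automorphism K" "K ** K = mat 1" and X: "X \<in> g2"
  shows "K ** X ** K \<in> g2"
proof -
  have K2: "K *v (K *v x) = x" for x
    by (simp add: matrix_vector_mul_assoc K(2))
  show ?thesis
    using K(1) X
    by (simp add: g2_def oct_automorphism_def matrix_vector_right_distrib K2 flip:
      matrix_vector_mul_assoc)
qed

lemma involution_cancel:
  assumes "K ** K = (mat 1 :: real ^ 'n ^ 'n)"
  shows "K ** (K ** X ** K) ** K = X" "K ** X ** K = K ** Y ** K \<longleftrightarrow> X = Y"
proof -
  show *: "K ** (K ** X ** K) ** K = X" for X
  proof -
    have "K ** (K ** X ** K) ** K = (K ** K) ** X ** (K ** K)"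
      by (simp only: matrix_mul_assoc)
    then show ?thesis
      by (simp add: assms)
  qed
  show "K ** X ** K = K ** Y ** K \<longleftrightarrow> X = Y"
    by (metis *)
qed

lemma matrix_add_right: "((A :: real ^ 'n ^ 'm) + B) ** C = A ** C + B ** C"
  by (simp add: vec_eq_iff matrix_matrix_mult_def sum.distrib distrib_right)

lemma matrix_scaleR_left: "(c *\<^sub>R (A :: real ^ 'n ^ 'm)) ** C = c *\<^sub>R (A ** C)"
  by (simp add: vec_eq_iff matrix_matrix_mult_def sum_distrib_left mult.assoc)

lemma matrix_scaleR_right: "(A :: real ^ 'n ^ 'm) ** (c *\<^sub>R C) = c *\<^sub>R (A ** C)"
  by (simp add: vec_eq_iff matrix_matrix_mult_def sum_distrib_left mult.left_commute)

lemma matrix_sub_right: "((A :: real ^ 'n ^ 'm) - B) ** C = A ** C - B ** C"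
  by (simp add: vec_eq_iff matrix_matrix_mult_def sum_subtractf left_diff_distrib)

lemma matrix_sub_left: "(A :: real ^ 'n ^ 'm) ** (B - C) = A ** B - A ** C"
  by (simp add: vec_eq_iff matrix_matrix_mult_def sum_subtractf right_diff_distrib)

lemma lie_bracket_conj:
  assumes "K ** K = mat 1"
  shows "lie_bracket (K ** X ** K) (K ** Y ** K) = K ** lie_bracket X Y ** K"
proof -
  have "K ** X ** K ** (K ** Y ** K) = K ** (X ** Y) ** K" for X Y
  proof -
    have "K ** X ** K ** (K ** Y ** K) = K ** X ** (K ** K) ** Y ** K"
      by (simp only: matrix_mul_assoc)
    also have "\<dots> = K ** (X ** Y) ** K"
      by (simp only: assms matrix_mul_rid matrix_mul_assoc)
    finally show ?thesis .
  qed
  then show ?thesis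
    by (simp add: lie_bracket_def matrix_sub_left matrix_sub_right)
qed

lemma lie_subalgebra_conj:
  assumes K: "oct_automorphism K" "K ** K = mat 1" and L: "lie_subalgebra L g2"
  shows "lie_subalgebra ((\<lambda>X. K ** X ** K) ` L) g2"
proof -
  have "linear (\<lambda>X. K ** X ** K)"
    by (intro linearI) (simp_all add: matrix_add_ldistrib matrix_add_right matrix_scaleR_left
      matrix_scaleR_right)
  then show ?thesis
    using L unfolding lie_subalgebra_def
    by (auto simp: lie_bracket_conj[OF K(2)] intro!: linear_subspace_image involution_conj_g2[OF K])
qed

section \<open>The involution \<open>S\<close> and rotations into the torus\<close>

lemma S_mat_explicit: "S_mat = vec8
    (vec8 1 0 0 0 0 0 0 0) (vec8 0 1 0 0 0 0 0 0) (vec8 0 0 0 0 1 0 0 0) (vec8 0 0 0 0 0 1 0 0)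
    (vec8 0 0 1 0 0 0 0 0) (vec8 0 0 0 1 0 0 0 0) (vec8 0 0 0 0 0 0 (- 1) 0) (vec8 0 0 0 0 0 0 0 (- 1))"
  by (simp add: S_mat_def matrix_def vec_eq_8 sum_8 S_unit_def oct_unit_nth axis_def)

lemma S_mat_automorphism: "oct_automorphism S_mat"
proof (rule oct_automorphism_basis)
  have "\<forall>a b. S_mat *v unit_mult a b = (S_mat *v oct_unit a) \<odot> (S_mat *v oct_unit b)"
    unfolding forall_8
    by (intro conjI; simp only: vec_eq_8 unit_mult_table matrix_vector_mult_minus
      vector_uminus_component mult_oct_unit_nth
       oct_mult_nth S_mat_explicit vec8_nth; simp)
  then show "S_mat *v unit_mult a b = (S_mat *v oct_unit a) \<odot> (S_mat *v oct_unit b)" for a b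
    by blast
qed

lemma S_mat_involution: "S_mat ** S_mat = mat 1"
  by (simp add: vec_eq_8 matrix_matrix_mult_def sum_8 S_mat_explicit mat_def)

lemma matrix_inv_S_mat: "matrix_inv S_mat = S_mat"
proof -
  have "invertible S_mat"
    using S_mat_involution invertible_def by blast
  then have "matrix_inv S_mat ** S_mat = mat 1"
    unfolding invertible_def matrix_inv_def by (rule someI2_ex) simp
  then show ?thesis
    by (metis S_mat_involution matrix_mul_assoc matrix_mul_lid matrix_mul_rid)
qed

text \<open>\<open>S\<close> normalizes the torus of \<open>a1\<close>, \<open>b1\<close> and acts
  on it by a reflection, so it permutes the root planes: \<open>(a2, a3)\<close> is exchanged with
  \<open>(u0, u1)\<close>, \<open>(b2, b3)\<close> with \<open>(w2, w3)\<close>, and the other two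
  are preserved. This is the origin of the shape of the second generator in the lemmas
  below.\<close>

lemma S_mat_conj_gm: "S_mat ** gm a1 a2 a3 b1 b2 b3 u0 u1 u2 u3 w0 w1 w2 w3 ** S_mat
    = gm (- a1 / 2 + b1 / 2) (- u1) u0 (3 * a1 / 2 + b1 / 2) (- w2) (- w3) a3 (- a2) (- u2) (- u3)
      (- w0) w1 (- b2) (- b3)"
  by (rule g2_eqI[OF involution_conj_g2[OF S_mat_automorphism S_mat_involution gm_g2] gm_g2];
      simp add: matrix_matrix_mult_def sum_8 S_mat_explicit gm_def field_simps)

text \<open>
  The map \<open>x + y l \<mapsto> p x p\<^sup>* + (q y p\<^sup>*) l\<close> for imaginary unit quaternions \<open>p\<close>, \<open>q\<close>. Taking them
  imaginary makes it an involution.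
\<close>

definition rot :: "real \<Rightarrow> real \<Rightarrow> real \<Rightarrow> real \<Rightarrow> real \<Rightarrow> real \<Rightarrow> oct_endo" where
  "rot p1 p2 p3 q1 q2 q3 = vec8
     (vec8 1 0 0 0 0 0 0 0)
     (vec8 0 (2 * p1\<^sup>2 - 1) (2 * p1 * p2) (2 * p1 * p3) 0 0 0 0)
     (vec8 0 (2 * p1 * p2) (2 * p2\<^sup>2 - 1) (2 * p2 * p3) 0 0 0 0)
     (vec8 0 (2 * p1 * p3) (2 * p2 * p3) (2 * p3\<^sup>2 - 1) 0 0 0 0)
     (vec8 0 0 0 0 (p1 * q1 + p2 * q2 + p3 * q3) (p2 * q3 - p3 * q2) (- p1 * q3 + p3 * q1) (p1 * q2
       - p2 * q1))
     (vec8 0 0 0 0 (p2 * q3 - p3 * q2) (p1 * q1 - p2 * q2 - p3 * q3) (p1 * q2 + p2 * q1) (p1 * q3 +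
       p3 * q1))
     (vec8 0 0 0 0 (- p1 * q3 + p3 * q1) (p1 * q2 + p2 * q1) (- p1 * q1 + p2 * q2 - p3 * q3) (p2 *
       q3 + p3 * q2))
     (vec8 0 0 0 0 (p1 * q2 - p2 * q1) (p1 * q3 + p3 * q1) (p2 * q3 + p3 * q2) (- p1 * q1 - p2 * q2
       + p3 * q3))"

lemma rot_automorphism:
  assumes "p1\<^sup>2 + p2\<^sup>2 + p3\<^sup>2 = 1" "q1\<^sup>2 + q2\<^sup>2 + q3\<^sup>2 = 1"
  shows "oct_automorphism (rot p1 p2 p3 q1 q2 q3)"
proof (rule oct_automorphism_basis)
  let ?K = "rot p1 p2 p3 q1 q2 q3"
  have "\<forall>a b. ?K *v unit_mult a b = (?K *v oct_unit a) \<odot> (?K *v oct_unit b)"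
    unfolding forall_8 vec_eq_8 oct_mult_nth unit_mult_table matrix_vector_mult_minus mult_oct_unit_nth
      vector_uminus_component rot_def vec8_nth
    by (intro conjI;
        simp only: mult_zero_left mult_zero_right mult_1_left mult_1_right add_0_left add_0_right
          diff_0_right diff_0 minus_zero;
        (use assms in algebra | (simp add: algebra_simps power2_eq_square; fail)))
  then show "?K *v unit_mult a b = (?K *v oct_unit a) \<odot> (?K *v oct_unit b)" for a b
    by blast
qed

lemma rot_involution:
  assumes "p1\<^sup>2 + p2\<^sup>2 + p3\<^sup>2 = 1" "q1\<^sup>2 + q2\<^sup>2 + q3\<^sup>2 = 1"
  shows "rot p1 p2 p3 q1 q2 q3 ** rot p1 p2 p3 q1 q2 q3 = mat 1"
proof -
  have "rot p1 p2 p3 q1 q2 q3 ** rot p1 p2 p3 q1 q2 q3 = vec8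
    (vec8 1 0 0 0 0 0 0 0) (vec8 0 1 0 0 0 0 0 0) (vec8 0 0 1 0 0 0 0 0) (vec8 0 0 0 1 0 0 0 0)
    (vec8 0 0 0 0 1 0 0 0) (vec8 0 0 0 0 0 1 0 0) (vec8 0 0 0 0 0 0 1 0) (vec8 0 0 0 0 0 0 0 1)"
    unfolding vec_eq_8 matrix_matrix_mult_def vec_lambda_beta sum_8 rot_def vec8_nth
    by (intro conjI;
        simp only: mult_zero_left mult_zero_right mult_1_left mult_1_right add_0_left add_0_right
          diff_0_right diff_0 minus_zero;
        (use assms in algebra | (simp add: algebra_simps power2_eq_square; fail)))
  also have "\<dots> = mat 1"
    by (simp add: vec_eq_8 mat_def)
  finally show ?thesis .
qed

text \<open>Conjugation by an imaginary unit quaternion \<open>p\<close> is the half turn about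
  \<open>p\<close>, which sends \<open>e_1\<close> to \<open>2 p1 p - e_1\<close>; likewise for
  \<open>q\<close> on the \<open>b\<close> side. Checking \<open>K ** X = X' ** K\<close> and
  cancelling with the involution avoids triple matrix products.\<close>

lemma rot_conj_torus:
  assumes "p1\<^sup>2 + p2\<^sup>2 + p3\<^sup>2 = 1" "q1\<^sup>2 + q2\<^sup>2 + q3\<^sup>2 = 1"
  shows "rot p1 p2 p3 q1 q2 q3 ** gm A 0 0 B 0 0 0 0 0 0 0 0 0 0 ** rot p1 p2 p3 q1 q2 q3
    = gm (A * (2 * p1\<^sup>2 - 1)) (A * (2 * p1 * p2)) (A * (2 * p1 * p3))
        (B * (2 * q1\<^sup>2 - 1)) (B * (2 * q1 * q2)) (B * (2 * q1 * q3)) 0 0 0 0 0 0 0 0"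
proof -
  let ?K = "rot p1 p2 p3 q1 q2 q3"
  let ?X = "gm (A * (2 * p1\<^sup>2 - 1)) (A * (2 * p1 * p2)) (A * (2 * p1 * p3))
        (B * (2 * q1\<^sup>2 - 1)) (B * (2 * q1 * q2)) (B * (2 * q1 * q3)) 0 0 0 0 0 0 0 0"
  have "?K ** gm A 0 0 B 0 0 0 0 0 0 0 0 0 0 = ?X ** ?K"
    unfolding vec_eq_8 matrix_matrix_mult_def vec_lambda_beta sum_8 rot_def gm_def vec8_nth
    by (intro conjI;
        simp only: mult_zero_left mult_zero_right mult_1_left mult_1_right add_0_left add_0_right
          diff_0_right diff_0 minus_zero;
        (use assms in algebra | (simp add: algebra_simps power2_eq_square; fail)))
  then show ?thesis
    by (metis rot_involution[OF assms] matrix_mul_assoc matrix_mul_rid)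
qed

lemma g2_coordinates:
  assumes "Z = gm a1 a2 a3 b1 b2 b3 u0 u1 u2 u3 w0 w1 w2 w3"
  shows "u2 = Z $ 6 $ 1 / 2" "u3 = Z $ 7 $ 1 / 2" "w2 = Z $ 6 $ 2 + Z $ 5 $ 1 / 2" "w3 = Z $ 7 $ 2 -
    Z $ 4 $ 1 / 2"
  by (simp_all add: assms gm_def)

section \<open>Generating the derivation algebra\<close>

text \<open>With \<open>nu = p2 + i p3\<close> and \<open>mu = q2 + i q3\<close>, the first two
  lines are the real and imaginary part of a real combination of \<open>nu^2\<close> and
  \<open>conj(nu) mu\<close>, the last two those of a real combination of \<open>nu^3\<close> and
  \<open>mu\<close>. They read off \<open>2 * u2\<close>, \<open>2 * u3\<close>, \<open>w2\<close>,
  \<open>w3\<close> of the second generator after the first has been rotated into the torus.\<close>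

lemma rot_conj_components:
  fixes A B :: real
  assumes pq: "p1\<^sup>2 + p2\<^sup>2 + p3\<^sup>2 = 1" "q1\<^sup>2 + q2\<^sup>2 + q3\<^sup>2 = 1"
    and a: "a1 = A * (2 * p1\<^sup>2 - 1)" "a2 = A * (2 * p1 * p2)" "a3 = A * (2 * p1 * p3)"
    and b: "b1 = B * (2 * q1\<^sup>2 - 1)" "b2 = B * (2 * q1 * q2)" "b3 = B * (2 * q1 * q3)"
    and Y: "Y = rot p1 p2 p3 q1 q2 q3 ** gm ((b1 - a1) / 2) 0 0 ((3 * a1 + b1) / 2) 0 0 a3 (- a2) 0
      0 0 0 (- b2) (- b3)
        ** rot p1 p2 p3 q1 q2 q3"
  shows "Y $ 6 $ 1 = - 4 * p1 * (q1 * (A * (3 * p1\<^sup>2 - 1) + B * (1 - q1\<^sup>2)) * (p2\<^sup>2 - p3\<^sup>2)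
            - p1 * (A * (2 - 3 * p1\<^sup>2) + B * q1\<^sup>2) * (p2 * q2 + p3 * q3))"
    and "Y $ 7 $ 1 = - 4 * p1 * (q1 * (A * (3 * p1\<^sup>2 - 1) + B * (1 - q1\<^sup>2)) * (2 * p2 * p3)
            - p1 * (A * (2 - 3 * p1\<^sup>2) + B * q1\<^sup>2) * (p2 * q3 - p3 * q2))"
    and "Y $ 6 $ 2 + Y $ 5 $ 1 / 2 = - 2 * (q1 * (3 * A * p1\<^sup>2 + B * (1 - q1\<^sup>2)) * (p2 ^ 3 - 3 * p2
      * p3\<^sup>2)
            + p1 ^ 3 * (3 * A * (1 - p1\<^sup>2) + B * q1\<^sup>2) * q2)"
    and "Y $ 7 $ 2 - Y $ 4 $ 1 / 2 = - 2 * (q1 * (3 * A * p1\<^sup>2 + B * (1 - q1\<^sup>2)) * (3 * p2\<^sup>2 * p3 -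
      p3 ^ 3)
            + p1 ^ 3 * (3 * A * (1 - p1\<^sup>2) + B * q1\<^sup>2) * q3)"
proof -
  note s = Y matrix_matrix_mult_def vec_lambda_beta sum_8 rot_def gm_def vec8_nth mult_zero_left
    mult_zero_right
    mult_1_left mult_1_right add_0_left add_0_right diff_0_right diff_0 minus_zero
  show "Y $ 6 $ 1 = - 4 * p1 * (q1 * (A * (3 * p1\<^sup>2 - 1) + B * (1 - q1\<^sup>2)) * (p2\<^sup>2 - p3\<^sup>2)
            - p1 * (A * (2 - 3 * p1\<^sup>2) + B * q1\<^sup>2) * (p2 * q2 + p3 * q3))"
    unfolding s using pq a b by algebra
  show "Y $ 7 $ 1 = - 4 * p1 * (q1 * (A * (3 * p1\<^sup>2 - 1) + B * (1 - q1\<^sup>2)) * (2 * p2 * p3)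
            - p1 * (A * (2 - 3 * p1\<^sup>2) + B * q1\<^sup>2) * (p2 * q3 - p3 * q2))"
    unfolding s using pq a b by algebra
  show "Y $ 6 $ 2 + Y $ 5 $ 1 / 2 = - 2 * (q1 * (3 * A * p1\<^sup>2 + B * (1 - q1\<^sup>2)) * (p2 ^ 3 - 3 * p2 *
    p3\<^sup>2)
            + p1 ^ 3 * (3 * A * (1 - p1\<^sup>2) + B * q1\<^sup>2) * q2)"
    unfolding s using pq a b by algebra
  show "Y $ 7 $ 2 - Y $ 4 $ 1 / 2 = - 2 * (q1 * (3 * A * p1\<^sup>2 + B * (1 - q1\<^sup>2)) * (3 * p2\<^sup>2 * p3 -
    p3 ^ 3)
            + p1 ^ 3 * (3 * A * (1 - p1\<^sup>2) + B * q1\<^sup>2) * q3)"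
    unfolding s using pq a b by algebra
qed

text \<open>Applying \<open>T - \<mu> j\<close> deletes the summand \<open>v j\<close> and
  multiplies \<open>w\<close> by the nonzero number \<open>m - \<mu> j\<close>. The
  \<open>v i\<close> may share eigenvalues with each other; only \<open>m\<close> must be separated
  from them.\<close>

lemma eigencomponent_mem:
  fixes T :: "'a::real_vector \<Rightarrow> 'a"
  assumes T: "linear T" "\<And>x. x \<in> L \<Longrightarrow> T x \<in> L" and L: "subspace L" and "finite F"
    and "\<And>i. i \<in> F \<Longrightarrow> T (v i) = \<mu> i *\<^sub>R v i" "T w = m *\<^sub>R w" "\<And>i. i \<in> F \<Longrightarrow> \<mu> i \<noteq> m" "w + sum v F \<in> L"
  shows "w \<in> L"
  using assms(4-)
proof (induction F arbitrary: v w)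
  case (insert j F)
  let ?v = "\<lambda>i. (\<mu> i - \<mu> j) *\<^sub>R v i" and ?w = "(m - \<mu> j) *\<^sub>R w"
  have "T (w + sum v (insert j F)) - \<mu> j *\<^sub>R (w + sum v (insert j F)) \<in> L"
    by (intro subspace_diff subspace_scale L T insert.prems)
  moreover have "T (w + sum v (insert j F)) - \<mu> j *\<^sub>R (w + sum v (insert j F)) = ?w + sum ?v F"
    using insert.hyps insert.prems T(1)
    by (simp add: linear_add linear_sum sum_subtractf scaleR_sum_right algebra_simps)
  ultimately have mem: "?w + sum ?v F \<in> L"
    by simp
  have "?w \<in> L"
  proof (rule insert.IH[where v="?v"])
    show "T (?v i) = \<mu> i *\<^sub>R ?v i" if "i \<in> F" for i
      using insert.prems(1)[of i] T(1) that by (simp add: linear_scale mult.commute)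
    show "T ?w = m *\<^sub>R ?w"
      using insert.prems(2) T(1) by (simp add: linear_scale mult.commute)
    show "\<mu> i \<noteq> m" if "i \<in> F" for i
      using insert.prems(3) that by simp
  qed (fact mem)
  moreover have "m - \<mu> j \<noteq> 0"
    using insert.prems(3)[of j] by simp
  ultimately show ?case
    using subspace_scale[OF L, of ?w "1 / (m - \<mu> j)"] by simp
qed simp

section \<open>Subalgebras containing enough elements to be all of \<open>g2\<close>\<close>

context
  fixes L :: "oct_endo set"
  assumes L: "lie_subalgebra L g2"
begin

text \<open>Together with the coordinate form \<open>br\<close> of bracket closure this makes every
  membership below a single instance that the simplifier evaluates to numerals.\<close>

lemma lie_subalgebra_lin:
  assumes "gm a1 a2 a3 b1 b2 b3 u0 u1 u2 u3 w0 w1 w2 w3 \<in> L" "gm aa1 aa2 aa3 bb1 bb2 bb3 uu0 uu1 uu2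
    uu3 ww0 ww1 ww2 ww3 \<in> L"
  shows "gm (c * a1 + d * aa1) (c * a2 + d * aa2) (c * a3 + d * aa3) (c * b1 + d * bb1) (c * b2 + d
    * bb2) (c * b3 + d * bb3) (c * u0 + d * uu0) (c * u1 + d * uu1) (c * u2 + d * uu2) (c * u3 + d *
    uu3) (c * w0 + d * ww0) (c * w1 + d * ww1) (c * w2 + d * ww2) (c * w3 + d * ww3) \<in> L"
proof -
  have "c *\<^sub>R gm a1 a2 a3 b1 b2 b3 u0 u1 u2 u3 w0 w1 w2 w3 + d *\<^sub>R gm aa1 aa2 aa3 bb1 bb2 bb3 uu0
    uu1 uu2 uu3 ww0 ww1 ww2 ww3 \<in> L"
    using L assms unfolding lie_subalgebra_def by (intro subspace_add subspace_scale) auto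
  then show ?thesis
    by (simp add: gm_add gm_scaleR)
qed

lemma lie_subalgebra_br:
  assumes "X \<in> L" "Y \<in> L"
  shows "lie_bracket X Y \<in> L"
  using L assms unfolding lie_subalgebra_def by blast

lemmas lin = lie_subalgebra_lin[of a1 a2 a3 b1 b2 b3 u0 u1 u2 u3 w0 w1 w2 w3 for a1 a2 a3 b1 b2 b3
  u0 u1 u2 u3 w0 w1 w2 w3]

lemmas br = lie_subalgebra_br[of "gm a1 a2 a3 b1 b2 b3 u0 u1 u2 u3 w0 w1 w2 w3"
  "gm aa1 aa2 aa3 bb1 bb2 bb3 uu0 uu1 uu2 uu3 ww0 ww1 ww2 ww3" for a1 a2 a3 b1 b2 b3 u0 u1 u2 u3 w0
  w1 w2 w3 aa1 aa2 aa3 bb1 bb2 bb3 uu0 uu1 uu2 uu3 ww0 ww1 ww2 ww3, unfolded lie_bracket_gm]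

lemma g2_subset_if_basis:
  assumes "gm 1 0 0 0 0 0 0 0 0 0 0 0 0 0 \<in> L"
    "gm 0 1 0 0 0 0 0 0 0 0 0 0 0 0 \<in> L"
    "gm 0 0 1 0 0 0 0 0 0 0 0 0 0 0 \<in> L"
    "gm 0 0 0 1 0 0 0 0 0 0 0 0 0 0 \<in> L"
    "gm 0 0 0 0 1 0 0 0 0 0 0 0 0 0 \<in> L"
    "gm 0 0 0 0 0 1 0 0 0 0 0 0 0 0 \<in> L"
    "gm 0 0 0 0 0 0 1 0 0 0 0 0 0 0 \<in> L"
    "gm 0 0 0 0 0 0 0 1 0 0 0 0 0 0 \<in> L"
    "gm 0 0 0 0 0 0 0 0 1 0 0 0 0 0 \<in> L"
    "gm 0 0 0 0 0 0 0 0 0 1 0 0 0 0 \<in> L"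
    "gm 0 0 0 0 0 0 0 0 0 0 1 0 0 0 \<in> L"
    "gm 0 0 0 0 0 0 0 0 0 0 0 1 0 0 \<in> L"
    "gm 0 0 0 0 0 0 0 0 0 0 0 0 1 0 \<in> L"
    "gm 0 0 0 0 0 0 0 0 0 0 0 0 0 1 \<in> L"
  shows "g2 \<subseteq> L"
proof
  fix Z assume "Z \<in> g2"
  then obtain a1 a2 a3 b1 b2 b3 u0 u1 u2 u3 w0 w1 w2 w3 where Z: "Z = gm a1 a2 a3 b1 b2 b3 u0 u1 u2
    u3 w0 w1 w2 w3"
    using g2_gm by blast
  have sL: "subspace L"
    using L unfolding lie_subalgebra_def by blast
  have "Z = a1 *\<^sub>R gm 1 0 0 0 0 0 0 0 0 0 0 0 0 0 + (a2 *\<^sub>R gm 0 1 0 0 0 0 0 0 0 0 0 0 0 0 + (a3 *\<^sub>R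
    gm 0 0 1 0 0 0 0 0 0 0 0 0 0 0 + (b1 *\<^sub>R gm 0 0 0 1 0 0 0 0 0 0 0 0 0 0 + (b2 *\<^sub>R gm 0 0 0 0 1 0
    0 0 0 0 0 0 0 0 + (b3 *\<^sub>R gm 0 0 0 0 0 1 0 0 0 0 0 0 0 0 + (u0 *\<^sub>R gm 0 0 0 0 0 0 1 0 0 0 0 0 0
    0 + (u1 *\<^sub>R gm 0 0 0 0 0 0 0 1 0 0 0 0 0 0 + (u2 *\<^sub>R gm 0 0 0 0 0 0 0 0 1 0 0 0 0 0 + (u3 *\<^sub>R gm
    0 0 0 0 0 0 0 0 0 1 0 0 0 0 + (w0 *\<^sub>R gm 0 0 0 0 0 0 0 0 0 0 1 0 0 0 + (w1 *\<^sub>R gm 0 0 0 0 0 0 0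
    0 0 0 0 1 0 0 + (w2 *\<^sub>R gm 0 0 0 0 0 0 0 0 0 0 0 0 1 0 + (w3 *\<^sub>R gm 0 0 0 0 0 0 0 0 0 0 0 0 0
    1)))))))))))))"
    by (simp add: Z gm_add gm_scaleR)
  also have "\<dots> \<in> L"
    by (intro subspace_add subspace_scale sL assms)
  finally show "Z \<in> L" .
qed

text \<open>
  The roots of the two planes are simple roots of \<open>g\<^sub>2\<close> with respect to the torus spanned by the
  first and fourth coordinate.
\<close>

lemma g2_subset_if_simple_roots:
  assumes s1: "gm 0 0 0 0 0 0 0 0 1 0 0 0 0 0 \<in> L"
    and s2: "gm 0 0 0 0 0 0 0 0 0 1 0 0 0 0 \<in> L"
    and l1: "gm 0 0 0 0 0 0 0 0 0 0 0 0 1 0 \<in> L"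
    and l2: "gm 0 0 0 0 0 0 0 0 0 0 0 0 0 1 \<in> L"
  shows "g2 \<subseteq> L"
proof -
  have m1: "gm 0 0 1 0 0 0 0 0 0 0 0 0 0 0 \<in> L"
    using br[OF s1 l1] by simp
  have m2: "gm 0 1 0 0 0 0 0 0 0 0 0 0 0 0 \<in> L"
    using br[OF s2 l1] by simp
  have m3: "gm 1 0 0 0 0 0 0 0 0 0 0 0 0 0 \<in> L"
    using lin[OF br[OF m1 m2] s1, of "-1 / 2" "0"] by simp
  have m4: "gm 0 0 0 1 0 0 0 0 0 0 0 0 0 0 \<in> L"
    using lin[OF br[OF s1 s2] m3, of "1 / 3" "-1 / 3"] by simp
  have m5: "gm 0 0 0 0 0 0 0 1 0 0 0 0 0 0 \<in> L"
    using lin[OF br[OF s1 m1] l1, of "1 / 2" "3 / 2"] by simp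
  have m6: "gm 0 0 0 0 0 0 1 0 0 0 0 0 0 0 \<in> L"
    using br[OF m3 m5] by simp
  have m7: "gm 0 0 0 0 0 1 0 0 0 0 0 0 0 0 \<in> L"
    using lin[OF lin[OF br[OF s1 m5] m1, of "1 / 3" "2 / 3"] s1, of "-1" "0"] by simp
  have m8: "gm 0 0 0 0 0 0 0 0 0 0 0 1 0 0 \<in> L"
    using br[OF l1 m7] by simp
  have m9: "gm 0 0 0 0 0 0 0 0 0 0 1 0 0 0 \<in> L"
    using br[OF l2 m7] by simp
  have m10: "gm 0 0 0 0 1 0 0 0 0 0 0 0 0 0 \<in> L"
    using lin[OF br[OF m4 m7] s1, of "-1 / 2" "0"] by simp
  show ?thesis
    by (rule g2_subset_if_basis) (fact m3 m2 m1 m4 m10 m7 m6 m5 s1 s2 m9 m8 l1 l2)+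
qed

text \<open>Here \<open>a = b = (1, 0, 1)\<close>, where the norms agree and the cubic form
  vanishes, so root planes cannot be isolated as in the generic case. The list is a certificate:
  brackets of elements already found, reduced by elimination until all fourteen basis elements have
  appeared.\<close>

lemma g2_subset_point1:
  assumes z: "gm 1 0 1 1 0 1 0 0 0 0 0 0 0 0 \<in> L"
    and zs: "gm 0 0 0 2 0 0 1 0 0 0 0 0 0 (-1) \<in> L"
  shows "g2 \<subseteq> L"
proof -
  \<comment> \<open>With second coefficient \<open>0\<close>, \<open>lin\<close> merely rescales;
    \<open>z\<close> just fills the free place. The same device recurs throughout these
    certificates.\<close>
  have m1: "gm 0 0 0 0 1 0 0 0 0 0 1 0 1 0 \<in> L"
    using lin[OF br[OF z zs] z, of "1 / 4" "0"] by simp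
  have m2: "gm 0 0 0 0 0 2 0 0 (-1) 0 0 (-3) 0 4 \<in> L"
    using lin[OF br[OF z m1] zs, of "1" "1"] by simp
  have m3: "gm 0 0 0 0 0 0 0 0 0 (-1) 3 0 0 0 \<in> L"
    using lin[OF br[OF zs m2] m1, of "1 / 4" "2"] by simp
  have m4: "gm 0 0 1 0 0 1 0 0 0 0 0 0 0 2 \<in> L"
    using lin[OF br[OF zs m3] m2, of "1 / 4" "1 / 2"] by simp
  have m5: "gm 0 0 0 0 0 1 0 0 0 0 0 0 0 2 \<in> L"
    using lin[OF lin[OF lin[OF lin[OF br[OF m1 m4] z, of "1" "-2"] zs, of "1" "-1"] m2, of "1 / 2"
      "1 / 2"] m4, of "1 / 2" "1 / 2"] by simp
  have m6: "gm 0 0 0 0 0 0 0 0 0 0 1 0 0 0 \<in> L"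
    using lin[OF lin[OF br[OF m4 m5] m3, of "1 / 6" "-1 / 3"] z, of "-1" "0"] by simp
  have m7: "gm 0 0 0 0 0 0 0 0 0 0 0 0 1 0 \<in> L"
    using lin[OF lin[OF br[OF m1 m6] m1, of "1" "1"] m6, of "1 / 2" "-1 / 2"] by simp
  have m8: "gm 0 0 0 0 0 0 0 0 0 0 0 0 0 1 \<in> L"
    using lin[OF br[OF m5 m6] m5, of "1 / 5" "2 / 5"] by simp
  have m9: "gm 0 1 0 0 0 0 0 0 0 0 0 0 0 0 \<in> L"
    using lin[OF lin[OF lin[OF lin[OF br[OF m3 m7] m1, of "1" "-3"] m6, of "1" "3"] m7, of "1"
      "3"] z, of "-1" "0"] by simp
  have m10: "gm 0 0 0 0 0 0 0 1 0 0 0 0 0 0 \<in> L"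
    using lin[OF br[OF m6 m9] z, of "-1" "0"] by simp
  have m11: "gm 0 0 0 0 0 0 0 0 0 0 0 1 0 0 \<in> L"
    using lin[OF lin[OF lin[OF lin[OF br[OF m5 m7] z, of "1" "2"] m4, of "1" "-2"] m8, of "1"
      "4"] z, of "-1" "0"] by simp
  have m12: "gm 0 0 0 1 0 0 0 0 0 0 0 0 0 0 \<in> L"
    using lin[OF lin[OF lin[OF br[OF m3 m11] z, of "1 / 3" "1"] m4, of "1 / 2" "-1 / 2"] m8, of "1"
      "1"] by simp
  have m13: "gm 0 0 0 0 0 1 0 0 0 0 0 0 0 0 \<in> L"
    using lin[OF m5 m8, of "1" "-2"] by simp
  have m14: "gm 0 0 1 0 0 0 0 0 0 0 0 0 0 0 \<in> L"
    using lin[OF lin[OF m4 m8, of "1" "-2"] m13, of "1" "-1"] by simp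
  have m15: "gm 0 0 0 0 0 0 0 0 0 1 0 0 0 0 \<in> L"
    using lin[OF lin[OF m3 m6, of "1" "-3"] z, of "-1" "0"] by simp
  have m16: "gm 0 0 0 0 0 0 0 0 1 0 0 0 0 0 \<in> L"
    using lin[OF lin[OF lin[OF lin[OF m2 m11, of "1" "3"] m8, of "1" "-4"] m13, of "1" "-2"] z, of
      "-1" "0"] by simp
  have m17: "gm 0 0 0 0 1 0 0 0 0 0 0 0 0 0 \<in> L"
    using lin[OF lin[OF m1 m7, of "1" "-1"] m6, of "1" "-1"] by simp
  have m18: "gm 0 0 0 0 0 0 1 0 0 0 0 0 0 0 \<in> L"
    using lin[OF lin[OF zs m12, of "1" "-2"] m8, of "1" "1"] by simp
  have m19: "gm 1 0 0 0 0 0 0 0 0 0 0 0 0 0 \<in> L"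
    using lin[OF lin[OF lin[OF z m12, of "1" "-1"] m13, of "1" "-1"] m14, of "1" "-1"] by simp
  show ?thesis
    by (rule g2_subset_if_basis) (fact m19 m9 m14 m12 m17 m13 m18 m10 m16 m15 m6 m11 m7 m8)+
qed

text \<open>Here \<open>a = (0, 1, 0)\<close> and \<open>b = (0, 0, 3)\<close>, on the cone
  \<open>|b| = 3|a|\<close>, where the roots \<open>3|a| + |b|\<close> and \<open>2|b|\<close>
  coincide.\<close>

lemma g2_subset_point2:
  assumes z: "gm 0 1 0 0 0 3 0 0 0 0 0 0 0 0 \<in> L"
    and zs: "gm 0 0 0 0 0 0 0 (-1) 0 0 0 0 0 (-3) \<in> L"
  shows "g2 \<subseteq> L"
proof -
  have m1: "gm 0 0 0 0 0 0 0 0 (-3) 1 6 0 0 0 \<in> L"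
    using lin[OF br[OF z zs] z, of "1 / 2" "0"] by simp
  have m2: "gm 0 0 0 0 0 0 (-3) 0 0 0 0 0 1 (-8) \<in> L"
    using lin[OF br[OF z m1] zs, of "1 / 3" "17 / 3"] by simp
  have m3: "gm 1 0 0 (-1) 0 0 0 0 0 0 0 0 0 0 \<in> L"
    using lin[OF br[OF zs m2] z, of "1 / 6" "0"] by simp
  have m4: "gm 0 0 0 0 0 0 0 0 0 0 0 1 0 0 \<in> L"
    using lin[OF br[OF m1 m3] z, of "1 / 24" "0"] by simp
  have m5: "gm 0 0 0 0 0 0 0 0 0 0 1 0 0 0 \<in> L"
    using lin[OF br[OF m3 m4] z, of "1 / 4" "0"] by simp
  have m6: "gm 0 0 (-1) 0 (-3) 0 0 0 0 0 0 0 0 0 \<in> L"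
    using lin[OF br[OF z m3] z, of "1 / 2" "0"] by simp
  have m7: "gm 0 0 0 1 0 0 0 0 0 0 0 0 0 0 \<in> L"
    using lin[OF br[OF z m6] m3, of "1 / 16" "1 / 8"] by simp
  have m8: "gm 0 0 0 0 1 0 0 0 0 0 0 0 0 0 \<in> L"
    using lin[OF br[OF z m7] z, of "1 / 6" "0"] by simp
  have m9: "gm 0 0 0 0 0 1 0 0 0 0 0 0 0 0 \<in> L"
    using lin[OF br[OF m6 m7] z, of "1 / 6" "0"] by simp
  have m10: "gm 0 0 0 0 0 0 0 0 0 0 0 0 0 1 \<in> L"
    using br[OF m4 m8] by simp
  have m11: "gm 0 0 0 0 0 0 1 0 0 0 0 0 0 0 \<in> L"
    using lin[OF lin[OF lin[OF br[OF zs m3] m2, of "1 / 16" "3 / 8"] m10, of "1" "3"] z, of "-1"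
      "0"] by simp
  have m12: "gm 0 0 0 0 0 0 0 0 1 0 0 0 0 0 \<in> L"
    using br[OF m8 m11] by simp
  have m13: "gm 0 0 1 0 0 0 0 0 0 0 0 0 0 0 \<in> L"
    using lin[OF lin[OF m6 m8, of "1" "3"] z, of "-1" "0"] by simp
  have m14: "gm 1 0 0 0 0 0 0 0 0 0 0 0 0 0 \<in> L"
    using lin[OF m3 m7, of "1" "1"] by simp
  have m15: "gm 0 0 0 0 0 0 0 0 0 0 0 0 1 0 \<in> L"
    using lin[OF lin[OF m2 m11, of "1" "3"] m10, of "1" "8"] by simp
  have m16: "gm 0 0 0 0 0 0 0 0 0 1 0 0 0 0 \<in> L"
    using lin[OF lin[OF m1 m12, of "1" "3"] m5, of "1" "-6"] by simp
  have m17: "gm 0 0 0 0 0 0 0 1 0 0 0 0 0 0 \<in> L"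
    using lin[OF lin[OF zs m10, of "1" "3"] z, of "-1" "0"] by simp
  have m18: "gm 0 1 0 0 0 0 0 0 0 0 0 0 0 0 \<in> L"
    using lin[OF z m9, of "1" "-3"] by simp
  show ?thesis
    by (rule g2_subset_if_basis) (fact m14 m18 m13 m7 m8 m9 m11 m17 m12 m16 m5 m4 m15 m10)+
qed

text \<open>A single bracket with the torus element rotates each root plane and has no real
  eigenvectors there; applied twice it is the scalar minus the squared root. The condition
  \<open>A \<noteq> B\<close> separates \<open>A + B\<close> from \<open>2A\<close>,
  \<open>2B\<close> and \<open>3A - B\<close>, and \<open>B \<noteq> 3 * A\<close> separates
  \<open>3A + B\<close> from \<open>2B\<close>; positivity handles the other comparisons.\<close>

lemma isolate_root_planes:
  assumes T: "gm A 0 0 B 0 0 0 0 0 0 0 0 0 0 \<in> L" and Y: "gm a1 a2 a3 b1 b2 b3 u0 u1 u2 u3 w0 w1 w2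
    w3 \<in> L"
    and AB: "A > 0" "B > 0" "A \<noteq> B" "B \<noteq> 3 * A"
  shows "gm 0 0 0 0 0 0 0 0 u2 u3 0 0 0 0 \<in> L" "gm 0 0 0 0 0 0 0 0 0 0 0 0 w2 w3 \<in> L"
proof -
  let ?Z = "gm A 0 0 B 0 0 0 0 0 0 0 0 0 0"
  let ?T = "\<lambda>X. lie_bracket ?Z (lie_bracket ?Z X)"
  have sL: "subspace L"
    using L unfolding lie_subalgebra_def by blast
  have lin: "linear ?T"
    by (intro linearI)
      (simp_all add: lie_bracket_def matrix_add_ldistrib matrix_add_right matrix_sub_left
        matrix_sub_right
        matrix_scaleR_left matrix_scaleR_right scaleR_diff_right)
  have inv: "?T X \<in> L" if "X \<in> L" for X
    by (intro lie_subalgebra_br T that)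
  have sq: "x\<^sup>2 \<noteq> y\<^sup>2" if "x \<noteq> y" "x \<noteq> - y" for x y :: real
    using that by (simp add: power2_eq_iff)
  define v \<mu> where "v i = (if i = 0 then gm a1 0 0 b1 0 0 0 0 0 0 0 0 0 0 else if i = 1 then gm 0 a2
    a3 0 0 0 0 0 0 0 0 0 0 0 else if i = 2 then gm 0 0 0 0 b2 b3 0 0 0 0 0 0 0 0 else if i = 3 then
    gm 0 0 0 0 0 0 u0 u1 0 0 0 0 0 0 else if i = 4 then gm 0 0 0 0 0 0 0 0 0 0 w0 w1 0 0 else if i =
    5 then gm 0 0 0 0 0 0 0 0 u2 u3 0 0 0 0 else gm 0 0 0 0 0 0 0 0 0 0 0 0 w2 w3)"
    and "\<mu> i = (if i = 0 then 0 else if i = 1 then - (4 * A\<^sup>2) else if i = 2 then - (4 * B\<^sup>2) else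
      if i = 3 then - (B - A)\<^sup>2 else if i = 4 then - (B - 3 * A)\<^sup>2 else if i = 5 then - (A + B)\<^sup>2
      else - (3 * A + B)\<^sup>2)" for i :: nat
  have all7: "(\<forall>i\<in>{..<7}. P i) \<longleftrightarrow> P 0 \<and> P 1 \<and> P 2 \<and> P 3 \<and> P 4 \<and> P 5 \<and> P (6::nat)" for P
    by (auto simp: eval_nat_numeral less_Suc_eq)
  have eig: "\<forall>i\<in>{..<7}. ?T (v i) = \<mu> i *\<^sub>R v i"
    by (simp add: all7 v_def \<mu>_def lie_bracket_gm gm_scaleR gm_inject) (simp add: power2_eq_square
      algebra_simps)
  have mem: "v k \<in> L" if k: "k < 7" and ne: "\<forall>i\<in>{..<7}. i \<noteq> k \<longrightarrow> \<mu> i \<noteq> \<mu> k" for k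
  proof (rule eigencomponent_mem[OF lin inv sL, of "{..<7} - {k}"])
    have "sum v {..<7} = gm a1 a2 a3 b1 b2 b3 u0 u1 u2 u3 w0 w1 w2 w3"
      by (simp add: eval_nat_numeral v_def gm_add)
    then show "v k + sum v ({..<7} - {k}) \<in> L"
      using Y k by (simp flip: sum.remove)
  qed (use eig k ne in auto)
  show "gm 0 0 0 0 0 0 0 0 u2 u3 0 0 0 0 \<in> L"
    using mem[of 5] sq[of "A + B" "2 * A"] sq[of "A + B" "2 * B"] sq[of "A + B" "B - A"] sq[of
      "A + B" "B - 3 * A"]
      sq[of "A + B" "3 * A + B"] AB by (simp add: all7 v_def \<mu>_def power_mult_distrib eq_commute[of
        _ "(A + B)\<^sup>2"])
  show "gm 0 0 0 0 0 0 0 0 0 0 0 0 w2 w3 \<in> L"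
    using mem[of 6] sq[of "3 * A + B" "2 * A"] sq[of "3 * A + B" "2 * B"] sq[of "3 * A + B"
      "B - A"] sq[of "3 * A + B" "B - 3 * A"]
      sq[of "3 * A + B" "A + B"] AB by (simp add: all7 v_def \<mu>_def power_mult_distrib eq_commute[of
        _ "(3 * A + B)\<^sup>2"])
qed

text \<open>On a root plane the bracket with the torus element is a quarter turn times the root, so
  a nonzero vector and its bracket already span the plane.\<close>

lemma rotate_root_plane:
  assumes T: "gm A 0 0 B 0 0 0 0 0 0 0 0 0 0 \<in> L" and AB: "A > 0" "B > 0"
  shows "gm 0 0 0 0 0 0 0 0 u2 u3 0 0 0 0 \<in> L \<Longrightarrow> (u2, u3) \<noteq> (0, 0) \<Longrightarrow>
      gm 0 0 0 0 0 0 0 0 1 0 0 0 0 0 \<in> L \<and> gm 0 0 0 0 0 0 0 0 0 1 0 0 0 0 \<in> L"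
    and "gm 0 0 0 0 0 0 0 0 0 0 0 0 w2 w3 \<in> L \<Longrightarrow> (w2, w3) \<noteq> (0, 0) \<Longrightarrow>
      gm 0 0 0 0 0 0 0 0 0 0 0 0 1 0 \<in> L \<and> gm 0 0 0 0 0 0 0 0 0 0 0 0 0 1 \<in> L"
proof -
  {
    assume m: "gm 0 0 0 0 0 0 0 0 u2 u3 0 0 0 0 \<in> L" and nz: "(u2, u3) \<noteq> (0, 0)"
    define n c where "n = u2\<^sup>2 + u3\<^sup>2" and "c = A + B"
    have n: "n \<noteq> 0" and c: "c \<noteq> 0"
      using AB nz by (auto simp: n_def c_def sum_power2_eq_zero_iff)
    have "lie_bracket (gm A 0 0 B 0 0 0 0 0 0 0 0 0 0) (gm 0 0 0 0 0 0 0 0 u2 u3 0 0 0 0) = gm 0 0 0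
      0 0 0 0 0 (- c * u3) (c * u2) 0 0 0 0"
      by (simp add: lie_bracket_gm gm_inject c_def algebra_simps)
    then have r: "gm 0 0 0 0 0 0 0 0 (- c * u3) (c * u2) 0 0 0 0 \<in> L"
      using lie_subalgebra_br[OF T m] by simp
    \<comment> \<open>The coefficients invert the matrix with rows \<open>(u2, u3)\<close> and
      \<open>(- c * u3, c * u2)\<close>, whose determinant is \<open>c * n\<close>.\<close>
    have e: "u2 / n * u2 + - u3 / (c * n) * (- c * u3) = 1"
      "u2 / n * u3 + - u3 / (c * n) * (c * u2) = 0"
      "u3 / n * u2 + u2 / (c * n) * (- c * u3) = 0"
      "u3 / n * u3 + u2 / (c * n) * (c * u2) = 1"
      using n c by (simp_all add: field_simps) (simp_all add: n_def power2_eq_square)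
    have "gm 0 0 0 0 0 0 0 0 1 0 0 0 0 0 \<in> L \<and> gm 0 0 0 0 0 0 0 0 0 1 0 0 0 0 \<in> L"
      using lin[OF m r, of "u2 / n" "- u3 / (c * n)"]
        lin[OF m r, of "u3 / n" "u2 / (c * n)"]
      unfolding e mult_zero_right add_0_left ..
  }
  then show "gm 0 0 0 0 0 0 0 0 u2 u3 0 0 0 0 \<in> L \<Longrightarrow> (u2, u3) \<noteq> (0, 0) \<Longrightarrow>
      gm 0 0 0 0 0 0 0 0 1 0 0 0 0 0 \<in> L \<and> gm 0 0 0 0 0 0 0 0 0 1 0 0 0 0 \<in> L" .
  {
    assume m: "gm 0 0 0 0 0 0 0 0 0 0 0 0 w2 w3 \<in> L" and nz: "(w2, w3) \<noteq> (0, 0)"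
    define n c where "n = w2\<^sup>2 + w3\<^sup>2" and "c = 3 * A + B"
    have n: "n \<noteq> 0" and c: "c \<noteq> 0"
      using AB nz by (auto simp: n_def c_def sum_power2_eq_zero_iff)
    have "lie_bracket (gm A 0 0 B 0 0 0 0 0 0 0 0 0 0) (gm 0 0 0 0 0 0 0 0 0 0 0 0 w2 w3) = gm 0 0 0
      0 0 0 0 0 0 0 0 0 (- c * w3) (c * w2)"
      by (simp add: lie_bracket_gm gm_inject c_def algebra_simps)
    then have r: "gm 0 0 0 0 0 0 0 0 0 0 0 0 (- c * w3) (c * w2) \<in> L"
      using lie_subalgebra_br[OF T m] by simp
    have e: "w2 / n * w2 + - w3 / (c * n) * (- c * w3) = 1"
      "w2 / n * w3 + - w3 / (c * n) * (c * w2) = 0"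
      "w3 / n * w2 + w2 / (c * n) * (- c * w3) = 0"
      "w3 / n * w3 + w2 / (c * n) * (c * w2) = 1"
      using n c by (simp_all add: field_simps) (simp_all add: n_def power2_eq_square)
    have "gm 0 0 0 0 0 0 0 0 0 0 0 0 1 0 \<in> L \<and> gm 0 0 0 0 0 0 0 0 0 0 0 0 0 1 \<in> L"
      using lin[OF m r, of "w2 / n" "- w3 / (c * n)"]
        lin[OF m r, of "w3 / n" "w2 / (c * n)"]
      unfolding e mult_zero_right add_0_left ..
  }
  then show "gm 0 0 0 0 0 0 0 0 0 0 0 0 w2 w3 \<in> L \<Longrightarrow> (w2, w3) \<noteq> (0, 0) \<Longrightarrow>
      gm 0 0 0 0 0 0 0 0 0 0 0 0 1 0 \<in> L \<and> gm 0 0 0 0 0 0 0 0 0 0 0 0 0 1 \<in> L" .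
qed

end

text \<open>\<open>p\<close> is the unit vector bisecting the angle between \<open>e_1\<close> and
  \<open>a\<close>, that is \<open>a / A + e_1\<close> normalized; the half turn about it sends
  \<open>e_1\<close> to \<open>a / A\<close>. The hypothesis excludes that \<open>a\<close> points
  along \<open>- e_1\<close>, where no bisector is determined.\<close>

lemma half_angle:
  fixes a1 a2 a3 :: real
  assumes "(a2, a3) \<noteq> (0, 0)"
  obtains A p1 p2 p3 where "A > 0" "A\<^sup>2 = a1\<^sup>2 + a2\<^sup>2 + a3\<^sup>2" "p1 > 0" "p1\<^sup>2 + p2\<^sup>2 + p3\<^sup>2 = 1"
    "a1 = A * (2 * p1\<^sup>2 - 1)" "a2 = A * (2 * p1 * p2)" "a3 = A * (2 * p1 * p3)"
proof -
  define A where "A = sqrt (a1\<^sup>2 + a2\<^sup>2 + a3\<^sup>2)"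
  have pos: "a2\<^sup>2 + a3\<^sup>2 > 0"
    using assms by (simp add: sum_power2_gt_zero_iff)
  have A2: "A\<^sup>2 = a1\<^sup>2 + a2\<^sup>2 + a3\<^sup>2"
    unfolding A_def by (rule real_sqrt_pow2) simp
  have "\<bar>a1\<bar> < A"
    unfolding A_def using pos by (intro real_less_rsqrt) simp
  then have A: "A > 0" "A + a1 > 0"
    by auto
  define p1 where "p1 = sqrt ((A + a1) / (2 * A))"
  have p1: "p1 > 0" "p1\<^sup>2 = (A + a1) / (2 * A)"
    using A by (auto simp: p1_def)
  have "p1\<^sup>2 + (a2 / (2 * A * p1))\<^sup>2 + (a3 / (2 * A * p1))\<^sup>2 = p1\<^sup>2 + (a2\<^sup>2 + a3\<^sup>2) / (4 * A\<^sup>2 * p1\<^sup>2)"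
    by (simp add: power_divide power_mult_distrib add_divide_distrib)
  also have "4 * A\<^sup>2 * p1\<^sup>2 = 2 * A * (A + a1)"
    unfolding p1(2) using A by (simp add: field_simps power2_eq_square)
  also have "a2\<^sup>2 + a3\<^sup>2 = (A - a1) * (A + a1)"
    using A2 by (simp add: algebra_simps power2_eq_square)
  also have "(A - a1) * (A + a1) / (2 * A * (A + a1)) = (A - a1) / (2 * A)"
    using A by (intro nonzero_mult_divide_mult_cancel_right) simp
  also have "p1\<^sup>2 + (A - a1) / (2 * A) = 1"
    unfolding p1(2) using A by (simp add: field_simps)
  finally have "p1\<^sup>2 + (a2 / (2 * A * p1))\<^sup>2 + (a3 / (2 * A * p1))\<^sup>2 = 1" .
  moreover have "a1 = A * (2 * p1\<^sup>2 - 1)"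
    using A by (simp add: p1(2) field_simps)
  ultimately show ?thesis
    using A p1(1) A2 by (intro that[of A p1 "a2 / (2 * A * p1)" "a3 / (2 * A * p1)"]) auto
qed

text \<open>
  Here \<open>\<nu> = a2 + i a3\<close> and \<open>\<mu> = b2 + i b3\<close>, and the assumption \<open>c\<close> says that \<open>\<nu>\<^sup>3\<close> is not a real
  multiple of \<open>\<mu>\<close>.
\<close>

lemma g2_subset_generic:
  fixes a1 a2 a3 b1 b2 b3 :: real
  assumes L: "lie_subalgebra L g2"
    and z: "gm a1 a2 a3 b1 b2 b3 0 0 0 0 0 0 0 0 \<in> L"
    and zs: "gm ((b1 - a1) / 2) 0 0 ((3 * a1 + b1) / 2) 0 0 a3 (- a2) 0 0 0 0 (- b2) (- b3) \<in> L"
    and c: "(3 * a2\<^sup>2 * a3 - a3 ^ 3) * b2 - (a2 ^ 3 - 3 * a2 * a3\<^sup>2) * b3 \<noteq> 0"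
    and ab: "a1\<^sup>2 + a2\<^sup>2 + a3\<^sup>2 \<noteq> b1\<^sup>2 + b2\<^sup>2 + b3\<^sup>2" "b1\<^sup>2 + b2\<^sup>2 + b3\<^sup>2 \<noteq> 9 * (a1\<^sup>2 + a2\<^sup>2 + a3\<^sup>2)"
  shows "g2 \<subseteq> L"
proof -
  have "(a2, a3) \<noteq> (0, 0)" "(b2, b3) \<noteq> (0, 0)"
    using c by auto
  obtain A p1 p2 p3 where A: "A > 0" "A\<^sup>2 = a1\<^sup>2 + a2\<^sup>2 + a3\<^sup>2" and p: "p1 > 0" "p1\<^sup>2 + p2\<^sup>2 + p3\<^sup>2 = 1"
    and a: "a1 = A * (2 * p1\<^sup>2 - 1)" "a2 = A * (2 * p1 * p2)" "a3 = A * (2 * p1 * p3)"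
    using half_angle[OF \<open>(a2, a3) \<noteq> (0, 0)\<close>, of a1] by blast
  obtain B q1 q2 q3 where B: "B > 0" "B\<^sup>2 = b1\<^sup>2 + b2\<^sup>2 + b3\<^sup>2" and q: "q1 > 0" "q1\<^sup>2 + q2\<^sup>2 + q3\<^sup>2 = 1"
    and b: "b1 = B * (2 * q1\<^sup>2 - 1)" "b2 = B * (2 * q1 * q2)" "b3 = B * (2 * q1 * q3)"
    using half_angle[OF \<open>(b2, b3) \<noteq> (0, 0)\<close>, of b1] by blast
  have AB: "A \<noteq> B" "B \<noteq> 3 * A"
    using ab A(2) B(2) by (auto simp: power_mult_distrib)
  define C where "C = (3 * p2\<^sup>2 * p3 - p3 ^ 3) * q2 - (p2 ^ 3 - 3 * p2 * p3\<^sup>2) * q3"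
  have "(3 * a2\<^sup>2 * a3 - a3 ^ 3) * b2 - (a2 ^ 3 - 3 * a2 * a3\<^sup>2) * b3 = 16 * A ^ 3 * B * p1 ^ 3 * q1 * C"
    unfolding a b C_def by algebra
  with c have C: "C \<noteq> 0"
    by auto
  define K where "K = rot p1 p2 p3 q1 q2 q3"
  have K: "oct_automorphism K" "K ** K = mat 1"
    unfolding K_def by (rule rot_automorphism[OF p(2) q(2)] rot_involution[OF p(2) q(2)])+
  \<comment> \<open>In \<open>L'\<close> the first generator lies in the torus. Since
    \<open>K\<close> is an involution, \<open>g2 \<subseteq> L'\<close> can be carried back to
    \<open>L\<close>.\<close>
  define L' where "L' = (\<lambda>X. K ** X ** K) ` L"
  have L': "lie_subalgebra L' g2"
    unfolding L'_def by (rule lie_subalgebra_conj[OF K L])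
  have "K ** gm A 0 0 B 0 0 0 0 0 0 0 0 0 0 ** K = gm a1 a2 a3 b1 b2 b3 0 0 0 0 0 0 0 0"
    unfolding K_def a b by (rule rot_conj_torus[OF p(2) q(2)])
  then have T: "gm A 0 0 B 0 0 0 0 0 0 0 0 0 0 \<in> L'"
    unfolding L'_def using z involution_cancel(1)[OF K(2)] by (metis image_eqI)
  define Y where "Y = K ** gm ((b1 - a1) / 2) 0 0 ((3 * a1 + b1) / 2) 0 0 a3 (- a2) 0 0 0 0 (- b2)
    (- b3) ** K"
  have YL: "Y \<in> L'"
    unfolding L'_def Y_def using zs by (rule imageI)
  then have "Y \<in> g2"
    using L' unfolding lie_subalgebra_def by blast
  then obtain c1 c2 c3 d1 d2 d3 u0 u1 u2 u3 w0 w1 w2 w3 where Yg: "Y = gm c1 c2 c3 d1 d2 d3 u0 u1 u2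
    u3 w0 w1 w2 w3"
    using g2_gm by blast
  note uw = g2_coordinates[OF Yg]
  note Yc = rot_conj_components[OF p(2) q(2) a b Y_def[unfolded K_def]]
  have "(u2, u3) \<noteq> (0, 0)"
  proof
    assume "(u2, u3) = (0, 0)"
    then have "Y $ 6 $ 1 = 0" "Y $ 7 $ 1 = 0"
      using uw by auto
    define s d where "s = q1 * (A * (3 * p1\<^sup>2 - 1) + B * (1 - q1\<^sup>2))" and "d = p1 * (A * (2 - 3 *
      p1\<^sup>2) + B * q1\<^sup>2)"
    have e: "s * (p2\<^sup>2 - p3\<^sup>2) = d * (p2 * q2 + p3 * q3)" "s * (2 * p2 * p3) = d * (p2 * q3 - p3 * q2)"
      using \<open>Y $ 6 $ 1 = 0\<close> \<open>Y $ 7 $ 1 = 0\<close> p(1) unfolding Yc s_def d_def by auto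
    \<comment> \<open>\<open>C\<close> measures the independence of \<open>nu^2\<close> and
      \<open>conj(nu) mu\<close>, so both coefficients vanish. Without their factors
      \<open>q1\<close> and \<open>p1\<close> they add up to \<open>A + B\<close>, which is
      positive.\<close>
    have "s * C = 0" "d * C = 0"
      unfolding C_def using e by algebra+
    then have "A * (3 * p1\<^sup>2 - 1) + B * (1 - q1\<^sup>2) = 0" "A * (2 - 3 * p1\<^sup>2) + B * q1\<^sup>2 = 0"
      using C p(1) q(1) by (auto simp: s_def d_def)
    then have "A + B = 0"
      by algebra
    then show False
      using A(1) B(1) by simp
  qed
  moreover have "(w2, w3) \<noteq> (0, 0)"
  proof
    assume "(w2, w3) = (0, 0)"
    then have "Y $ 6 $ 2 + Y $ 5 $ 1 / 2 = 0" "Y $ 7 $ 2 - Y $ 4 $ 1 / 2 = 0"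
      using uw by auto
    define s d where "s = q1 * (3 * A * p1\<^sup>2 + B * (1 - q1\<^sup>2))" and "d = p1 ^ 3 * (3 * A * (1 -
      p1\<^sup>2) + B * q1\<^sup>2)"
    have e: "s * (p2 ^ 3 - 3 * p2 * p3\<^sup>2) + d * q2 = 0" "s * (3 * p2\<^sup>2 * p3 - p3 ^ 3) + d * q3 = 0"
      using \<open>Y $ 6 $ 2 + Y $ 5 $ 1 / 2 = 0\<close> \<open>Y $ 7 $ 2 - Y $ 4 $ 1 / 2 = 0\<close> unfolding Yc s_def d_def
        by algebra+
    have "s * C = 0"
      unfolding C_def using e by algebra
    \<comment> \<open>In this plane the coefficient of \<open>nu^3\<close> alone gives the
      contradiction: it is strictly positive because of its term
      \<open>3 * A * p1\<^sup>2\<close>.\<close>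
    moreover have "1 - q1\<^sup>2 \<ge> 0"
      using q(2) by (smt (verit) zero_le_power2)
    then have "s > 0"
      unfolding s_def using A(1) B(1) p(1) q(1) by (intro mult_pos_pos add_pos_nonneg
        mult_nonneg_nonneg) auto
    ultimately show False
      using C by simp
  qed
  moreover have Y': "gm c1 c2 c3 d1 d2 d3 u0 u1 u2 u3 w0 w1 w2 w3 \<in> L'"
    using YL unfolding Yg .
  note planes = isolate_root_planes[OF L' T Y' A(1) B(1) AB]
  ultimately have "g2 \<subseteq> L'"
    using rotate_root_plane(1)[OF L' T A(1) B(1) planes(1)] rotate_root_plane(2)[OF L' T A(1) B(1)
      planes(2)]
    by (meson g2_subset_if_simple_roots[OF L'])
  show ?thesis
  proof
    fix X assume X: "X \<in> g2"
    then have "K ** X ** K \<in> L'"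
      using involution_conj_g2[OF K] \<open>g2 \<subseteq> L'\<close> by blast
    then show "X \<in> L"
      unfolding L'_def using involution_cancel(2)[OF K(2)] by auto
  qed
qed

text \<open>\<open>H_A\<close> is generated as an algebra by \<open>e_1\<close> and
  \<open>e_2\<close>. That these two are sent into \<open>H_A\<close> is a condition on the lower
  halves of columns 1 and 2, which encode exactly the coordinates \<open>u\<close> and
  \<open>w\<close>.\<close>

lemma k_A_iff: "Z \<in> k_A \<longleftrightarrow> (\<exists>a1 a2 a3 b1 b2 b3. Z = gm a1 a2 a3 b1 b2 b3 0 0 0 0 0 0 0 0)"
proof -
  have S: "subspace {x :: octonion. x $ 4 = 0 \<and> x $ 5 = 0 \<and> x $ 6 = 0 \<and> x $ 7 = 0}"
    by (auto simp: subspace_def)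
  have "H_A = {x. x $ 4 = 0 \<and> x $ 5 = 0 \<and> x $ 6 = 0 \<and> x $ 7 = 0}"
  proof
    show "H_A \<subseteq> {x. x $ 4 = 0 \<and> x $ 5 = 0 \<and> x $ 6 = 0 \<and> x $ 7 = 0}"
      unfolding H_A_def by (rule span_minimal) (auto simp: oct_unit_nth S)
    show "{x. x $ 4 = 0 \<and> x $ 5 = 0 \<and> x $ 6 = 0 \<and> x $ 7 = 0} \<subseteq> H_A"
    proof
      fix x :: octonion assume "x \<in> {x. x $ 4 = 0 \<and> x $ 5 = 0 \<and> x $ 6 = 0 \<and> x $ 7 = 0}"
      then have "x = x $ 0 *\<^sub>R oct_unit 0 + x $ 1 *\<^sub>R oct_unit 1 + x $ 2 *\<^sub>R oct_unit 2 + x $ 3 *\<^sub>R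
        oct_unit 3"
        by (simp add: vec_eq_8 oct_unit_nth)
      also have "\<dots> \<in> H_A"
        unfolding H_A_def by (intro span_add span_scale span_base) auto
      finally show "x \<in> H_A" .
    qed
  qed
  note H = this
  show ?thesis
  proof
    assume Z: "Z \<in> k_A"
    then have "Z \<in> g2"
      by (simp add: k_A_def)
    then obtain a1 a2 a3 b1 b2 b3 u0 u1 u2 u3 w0 w1 w2 w3 where Zg: "Z = gm a1 a2 a3 b1 b2 b3 u0 u1
      u2 u3 w0 w1 w2 w3"
      by (rule g2_gm)
    have "oct_unit 1 \<in> H_A" "oct_unit 2 \<in> H_A"
      by (simp_all add: H oct_unit_nth)
    then have "Z *v oct_unit 1 \<in> H_A" "Z *v oct_unit 2 \<in> H_A"
      using Z unfolding k_A_def image_subset_iff by blast+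
    then have "u0 = 0 \<and> u1 = 0 \<and> u2 = 0 \<and> u3 = 0 \<and> w0 = 0 \<and> w1 = 0 \<and> w2 = 0 \<and> w3 = 0"
      by (simp add: H mult_oct_unit_nth Zg gm_def)
    then show "\<exists>a1 a2 a3 b1 b2 b3. Z = gm a1 a2 a3 b1 b2 b3 0 0 0 0 0 0 0 0"
      using Zg by blast
  next
    assume "\<exists>a1 a2 a3 b1 b2 b3. Z = gm a1 a2 a3 b1 b2 b3 0 0 0 0 0 0 0 0"
    then show "Z \<in> k_A"
      unfolding k_A_def H image_subset_iff
      by (auto simp: gm_g2) (simp_all add: matrix_vector_mult_def sum_8 gm_def)
  qed
qed

section \<open>Hilbert's basis theorem\<close>

text \<open>Rings of functions containing the constants replace abstract polynomial rings, so that
  the basis theorem applies to \<open>real_polynomial_function\<close> directly. Negation is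
  multiplication by the constant \<open>- 1\<close>.\<close>

definition fun_subring :: "('a \<Rightarrow> real) set \<Rightarrow> bool" where
  "fun_subring R \<longleftrightarrow> (\<forall>c. (\<lambda>_. c) \<in> R) \<and>
     (\<forall>f\<in>R. \<forall>g\<in>R. (\<lambda>x. f x + g x) \<in> R \<and> (\<lambda>x. f x * g x) \<in> R)"

inductive_set fun_ideal :: "('a \<Rightarrow> real) set \<Rightarrow> ('a \<Rightarrow> real) set \<Rightarrow> ('a \<Rightarrow> real) set"
  for R S where
  zero: "(\<lambda>_. 0) \<in> fun_ideal R S"
| base: "s \<in> S \<Longrightarrow> s \<in> fun_ideal R S"
| add: "f \<in> fun_ideal R S \<Longrightarrow> g \<in> fun_ideal R S \<Longrightarrow> (\<lambda>x. f x + g x) \<in> fun_ideal R S"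
| mult: "r \<in> R \<Longrightarrow> f \<in> fun_ideal R S \<Longrightarrow> (\<lambda>x. r x * f x) \<in> fun_ideal R S"

text \<open>The finite generating set is drawn from \<open>S\<close> itself, so a system of
  equations reduces to finitely many of its own members.\<close>

definition noetherian :: "('a \<Rightarrow> real) set \<Rightarrow> bool" where
  "noetherian R \<longleftrightarrow> (\<forall>S\<subseteq>R. \<exists>F\<subseteq>S. finite F \<and> S \<subseteq> fun_ideal R F)"

lemma fun_ideal_mono: "S \<subseteq> T \<Longrightarrow> fun_ideal R S \<subseteq> fun_ideal R T"
proof
  fix f assume "S \<subseteq> T" "f \<in> fun_ideal R S"
  from this(2,1) show "f \<in> fun_ideal R T"
    by induction (auto intro: fun_ideal.intros)
qed

lemma fun_ideal_subset: "S \<subseteq> fun_ideal R T \<Longrightarrow> fun_ideal R S \<subseteq> fun_ideal R T"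
proof
  fix f assume "S \<subseteq> fun_ideal R T" "f \<in> fun_ideal R S"
  from this(2,1) show "f \<in> fun_ideal R T"
    by induction (auto intro: fun_ideal.intros)
qed

lemma fun_ideal_finite_support:
  "f \<in> fun_ideal R S \<Longrightarrow> \<exists>F\<subseteq>S. finite F \<and> f \<in> fun_ideal R F"
proof (induction rule: fun_ideal.induct)
  case (base s)
  then show ?case
    by (intro exI[of _ "{s}"]) (auto intro: fun_ideal.base)
next
  case (add f g)
  then obtain F G where "F \<subseteq> S" "finite F" "f \<in> fun_ideal R F" "G \<subseteq> S" "finite G" "g \<in> fun_ideal R G"
    by blast
  then show ?case
    by (intro exI[of _ "F \<union> G"])
      (auto intro!: fun_ideal.add intro: fun_ideal_mono[THEN subsetD, rotated])
qed (auto intro: fun_ideal.intros)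

lemma fun_ideal_finite_support_set:
  assumes "finite G" "G \<subseteq> fun_ideal R S"
  shows "\<exists>F\<subseteq>S. finite F \<and> G \<subseteq> fun_ideal R F"
  using assms
proof (induction G)
  case (insert g G)
  then obtain F where F: "F \<subseteq> S" "finite F" "G \<subseteq> fun_ideal R F"
    by auto
  obtain F' where F': "F' \<subseteq> S" "finite F'" "g \<in> fun_ideal R F'"
    using fun_ideal_finite_support[of g R S] insert.prems by auto
  have "insert g G \<subseteq> fun_ideal R (F \<union> F')"
    using F(3) F'(3) fun_ideal_mono[of F "F \<union> F'" R] fun_ideal_mono[of F' "F \<union> F'" R] by blast
  then show ?case
    using F F' by (intro exI[of _ "F \<union> F'"]) auto
qed auto

lemma noetherian_sequence:
  assumes "noetherian R" "\<And>n. c n \<in> R"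
  shows "\<exists>m::nat. c m \<in> fun_ideal R (c ` {..<m})"
proof -
  obtain F where F: "F \<subseteq> range c" "finite F" "range c \<subseteq> fun_ideal R F"
    using assms unfolding noetherian_def by (metis image_subsetI)
  then obtain N where N: "finite N" "F = c ` N"
    by (meson finite_subset_image)
  then have "F \<subseteq> c ` {..<Suc (Max N)}"
    by (auto simp: less_Suc_eq_le)
  then show ?thesis
    using F(3) fun_ideal_mono by (metis rangeI subset_iff)
qed

text \<open>Polynomials in \<open>x\<close> over \<open>R\<close> of degree strictly below the last
  argument; at \<open>0\<close> only the zero function remains. As \<open>x\<close> may satisfy
  relations over \<open>R\<close>, a function need not determine its coefficients.\<close>

primrec low_degree :: "('a \<Rightarrow> real) set \<Rightarrow> ('a \<Rightarrow> real) \<Rightarrow> nat \<Rightarrow> ('a \<Rightarrow> real) set" where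
  "low_degree R x 0 = {\<lambda>_. 0}"
| "low_degree R x (Suc n) = {\<lambda>z. c z * x z ^ n + l z |c l. c \<in> R \<and> l \<in> low_degree R x n}"

definition adjoin :: "('a \<Rightarrow> real) set \<Rightarrow> ('a \<Rightarrow> real) \<Rightarrow> ('a \<Rightarrow> real) set" where
  "adjoin R x = (\<Union>n. low_degree R x n)"

context
  fixes R :: "('a \<Rightarrow> real) set" and x :: "'a \<Rightarrow> real"
  assumes R: "fun_subring R"
begin

lemma R_const: "(\<lambda>_. c) \<in> R" and R_add: "f \<in> R \<Longrightarrow> g \<in> R \<Longrightarrow> (\<lambda>x. f x + g x) \<in> R"
  and R_mult: "f \<in> R \<Longrightarrow> g \<in> R \<Longrightarrow> (\<lambda>x. f x * g x) \<in> R"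
  using R by (auto simp: fun_subring_def)

lemma low_degree_SucI: "c \<in> R \<Longrightarrow> l \<in> low_degree R x n \<Longrightarrow> (\<lambda>z. c z * x z ^ n + l z) \<in> low_degree R x
  (Suc n)"
  by auto

lemma low_degree_Suc: "l \<in> low_degree R x n \<Longrightarrow> l \<in> low_degree R x (Suc n)"
  using low_degree_SucI[OF R_const[of 0], of l n] by simp

lemma low_degree_mono: "m \<le> n \<Longrightarrow> low_degree R x m \<subseteq> low_degree R x n"
  by (rule lift_Suc_mono_le) (auto intro: low_degree_Suc simp del: low_degree.simps)

lemma low_degree_0: "(\<lambda>_. 0) \<in> low_degree R x n"
  using low_degree_mono[of 0 n] by auto

lemma low_degree_add: "f \<in> low_degree R x n \<Longrightarrow> g \<in> low_degree R x n \<Longrightarrow> (\<lambda>z. f z + g z) \<in> low_degree R x n"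
proof (induction n arbitrary: f g)
  case (Suc n)
  then obtain c l c' l' where "f = (\<lambda>z. c z * x z ^ n + l z)" "g = (\<lambda>z. c' z * x z ^ n + l' z)"
    "c \<in> R" "c' \<in> R" "l \<in> low_degree R x n" "l' \<in> low_degree R x n"
    by auto
  then show ?case
    using low_degree_SucI[OF R_add[of c c'] Suc.IH[of l l']] by (simp add: algebra_simps)
qed auto

lemma low_degree_cmult: "r \<in> R \<Longrightarrow> f \<in> low_degree R x n \<Longrightarrow> (\<lambda>z. r z * f z) \<in> low_degree R x n"
proof (induction n arbitrary: f)
  case (Suc n)
  then obtain c l where "f = (\<lambda>z. c z * x z ^ n + l z)" "c \<in> R" "l \<in> low_degree R x n"
    by auto
  then show ?case
    using low_degree_SucI[OF R_mult[of r c] Suc.IH[of l]] Suc.prems by (simp add: algebra_simps)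
qed auto

lemma low_degree_times_x: "f \<in> low_degree R x n \<Longrightarrow> (\<lambda>z. x z * f z) \<in> low_degree R x (Suc n)"
proof (induction n arbitrary: f)
  case 0
  then show ?case
    using low_degree_0[of "Suc 0"] by (simp del: low_degree.simps(2))
next
  case (Suc n)
  then obtain c l where "f = (\<lambda>z. c z * x z ^ n + l z)" "c \<in> R" "l \<in> low_degree R x n"
    by auto
  then show ?case
    using low_degree_SucI[OF _ Suc.IH[of l], of c] by (simp add: algebra_simps)
qed

lemma low_degree_times_x_power:
  "f \<in> low_degree R x n \<Longrightarrow> (\<lambda>z. x z ^ k * f z) \<in> low_degree R x (n + k)"
proof (induction k)
  case (Suc k)
  then show ?case
    using low_degree_times_x[of "\<lambda>z. x z ^ k * f z" "n + k"]
    by (simp add: mult.assoc del: low_degree.simps)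
qed simp

lemma adjoin_coeff: "r \<in> R \<Longrightarrow> r \<in> adjoin R x"
proof -
  assume "r \<in> R"
  from low_degree_SucI[OF this low_degree_0[of 0]] have "r \<in> low_degree R x (Suc 0)"
    by (simp del: low_degree.simps)
  then show ?thesis
    unfolding adjoin_def by blast
qed

lemma adjoin_add: "f \<in> adjoin R x \<Longrightarrow> g \<in> adjoin R x \<Longrightarrow> (\<lambda>z. f z + g z) \<in> adjoin R x"
proof -
  assume "f \<in> adjoin R x" "g \<in> adjoin R x"
  then obtain m n where "f \<in> low_degree R x m" "g \<in> low_degree R x n"
    unfolding adjoin_def by auto
  then show ?thesis
    using low_degree_mono[of m "max m n"] low_degree_mono[of n "max m n"] low_degree_add[of f
      "max m n" g]
    unfolding adjoin_def by (auto simp del: low_degree.simps)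
qed

lemma adjoin_times_x_power: "f \<in> adjoin R x \<Longrightarrow> (\<lambda>z. x z ^ k * f z) \<in> adjoin R x"
  unfolding adjoin_def using low_degree_times_x_power by blast

lemma adjoin_mult: "f \<in> adjoin R x \<Longrightarrow> g \<in> adjoin R x \<Longrightarrow> (\<lambda>z. f z * g z) \<in> adjoin R x"
proof -
  assume g: "g \<in> adjoin R x"
  then have c: "(\<lambda>z. c z * g z) \<in> adjoin R x" if "c \<in> R" for c
    using that low_degree_cmult unfolding adjoin_def by blast
  have "(\<lambda>z. f z * g z) \<in> adjoin R x" if "f \<in> low_degree R x n" for n f
    using that
  proof (induction n arbitrary: f)
    case 0
    then show ?case
      using adjoin_coeff[OF R_const[of 0]] by simp
  next
    case (Suc n)
    then obtain c l where "f = (\<lambda>z. c z * x z ^ n + l z)" "c \<in> R" "l \<in> low_degree R x n"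
      by auto
    then show ?case
      using adjoin_add[OF adjoin_times_x_power[OF c[of c], of n] Suc.IH[of l]] by (simp add:
        algebra_simps)
  qed
  moreover assume "f \<in> adjoin R x"
  ultimately show ?thesis
    unfolding adjoin_def by blast
qed

lemma fun_subring_adjoin: "fun_subring (adjoin R x)"
  unfolding fun_subring_def using adjoin_coeff R_const adjoin_add adjoin_mult by blast

lemma adjoin_x_power: "(\<lambda>z. x z ^ k) \<in> adjoin R x"
  using adjoin_times_x_power[OF adjoin_coeff[OF R_const[of 1]], of k] by simp

lemma adjoin_x: "x \<in> adjoin R x"
  using adjoin_x_power[of 1] by simp

text \<open>
  Choose \<open>g k\<close> of least degree among the elements of the ideal that are not generated by the earlier
  ones. Once the leading coefficient of \<open>g m\<close> is a combination of the earlier ones, cancelling it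
  produces an element of smaller degree.
\<close>

theorem noetherian_adjoin:
  assumes noeth: "noetherian R"
  shows "noetherian (adjoin R x)"
proof (rule ccontr)
  let ?A = "adjoin R x"
  let ?I = "fun_ideal ?A"
  assume "\<not> noetherian ?A"
  then obtain S where S: "S \<subseteq> ?A" and nf: "\<And>F. F \<subseteq> S \<Longrightarrow> finite F \<Longrightarrow> \<not> S \<subseteq> ?I F"
    unfolding noetherian_def by blast
  have SA: "?I S \<subseteq> ?A"
  proof
    fix f assume "f \<in> ?I S"
    then show "f \<in> ?A"
      by induction (use S adjoin_add adjoin_mult adjoin_coeff R_const in blast)+
  qed
  have new: "\<exists>f \<in> ?I S. f \<notin> ?I G" if "finite G" "G \<subseteq> ?I S" for G
  proof (rule ccontr)
    assume "\<not> ?thesis"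
    moreover obtain F where "F \<subseteq> S" "finite F" "G \<subseteq> ?I F"
      using fun_ideal_finite_support_set[of G ?A S] \<open>finite G\<close> \<open>G \<subseteq> ?I S\<close> by blast
    ultimately show False
      using nf[of F] fun_ideal_subset[of G ?A F] fun_ideal.base[of _ S ?A] by blast
  qed
  \<comment> \<open>By the strict bound in \<open>low_degree\<close> this is one more than the usual
    degree, and \<open>0\<close> for the zero function. The minimum is taken over all
    representations.\<close>
  define deg where "deg f = (LEAST n. f \<in> low_degree R x n)" for f
  have deg: "f \<in> low_degree R x (deg f)" if "f \<in> ?A" for f
    using that unfolding deg_def adjoin_def by (metis (mono_tags, lifting) LeastI UN_E)
  have deg_le: "deg f \<le> n" if "f \<in> low_degree R x n" for f n
    using that unfolding deg_def by (rule Least_le)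
  define P where "P f k r \<longleftrightarrow> r \<in> ?I S \<and> r \<notin> ?I (f ` {..<k}) \<and>
    (\<forall>h \<in> ?I S. h \<notin> ?I (f ` {..<k}) \<longrightarrow> deg r \<le> deg h)" for f :: "nat \<Rightarrow> 'a \<Rightarrow> real" and k r
  have "\<exists>g. \<forall>k. P g k (g k)"
  proof (rule dependent_wellorder_choice)
    show "P f k r = P g k r" if "\<And>y. y < k \<Longrightarrow> f y = g y" for r f g k
    proof -
      have "f ` {..<k} = g ` {..<k}"
        using that by (intro image_cong) auto
      then show ?thesis
        by (simp add: P_def)
    qed
    show "\<exists>r. P f k r" if "\<And>y. y < k \<Longrightarrow> P f y (f y)" for k f
    proof -
      have "f ` {..<k} \<subseteq> ?I S"
        using that by (auto simp: P_def)
      then have "\<exists>h. h \<in> ?I S \<and> h \<notin> ?I (f ` {..<k})"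
        using new[of "f ` {..<k}"] by auto
      then obtain r where "r \<in> ?I S \<and> r \<notin> ?I (f ` {..<k})"
          "\<And>h. h \<in> ?I S \<and> h \<notin> ?I (f ` {..<k}) \<Longrightarrow> deg r \<le> deg h"
        using ex_has_least_nat[of "\<lambda>h. h \<in> ?I S \<and> h \<notin> ?I (f ` {..<k})" _ deg] by blast
      then show ?thesis
        unfolding P_def by blast
    qed
  qed
  then obtain g where g: "\<And>k. P g k (g k)"
    by blast
  have gA: "g k \<in> ?A" for k
    using g[of k] SA by (auto simp: P_def)
  have "\<exists>e c l. deg (g k) = Suc e \<and> c \<in> R \<and> l \<in> low_degree R x e \<and> g k = (\<lambda>z. c z * x z ^ e + l z)" for k
  proof (cases "deg (g k)")
    case 0
    then have "g k = (\<lambda>_. 0)"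
      using deg[OF gA[of k]] by simp
    then have "g k \<in> ?I (g ` {..<k})"
      by (metis fun_ideal.zero)
    then show ?thesis
      using g[of k] unfolding P_def by blast
  next
    case (Suc e)
    then show ?thesis
      using deg[OF gA[of k]] by auto
  qed
  then have "\<forall>k. \<exists>t. deg (g k) = Suc (fst t) \<and> fst (snd t) \<in> R \<and> snd (snd t) \<in> low_degree R x (fst t) \<and>
      g k = (\<lambda>z. fst (snd t) z * x z ^ fst t + snd (snd t) z)"
    by (simp add: split_paired_Ex)
  from choice[OF this] obtain t where t: "\<And>k. deg (g k) = Suc (fst (t k)) \<and> fst (snd (t k)) \<in> R \<and>
      snd (snd (t k)) \<in> low_degree R x (fst (t k)) \<and>
      g k = (\<lambda>z. fst (snd (t k)) z * x z ^ fst (t k) + snd (snd (t k)) z)"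
    by blast
  define e c l where "e k = fst (t k)" and "c k = fst (snd (t k))" and "l k = snd (snd (t k))" for k
  note ecl = this
  have e: "\<And>k. deg (g k) = Suc (e k)" and c: "\<And>k. c k \<in> R"
    and l: "\<And>k. l k \<in> low_degree R x (e k)" and gk: "\<And>k. g k = (\<lambda>z. c k z * x z ^ e k + l k z)"
    using t unfolding ecl by blast+
  have mono: "e k \<le> e m" if "k < m" for k m
  proof -
    have "g m \<notin> ?I (g ` {..<k})"
    proof
      assume "g m \<in> ?I (g ` {..<k})"
      moreover have "?I (g ` {..<k}) \<subseteq> ?I (g ` {..<m})"
        using that by (intro fun_ideal_mono image_mono) auto
      ultimately show False
        using g[of m] by (auto simp: P_def)
    qed
    then have "deg (g k) \<le> deg (g m)"
      using g[of k] g[of m] by (auto simp: P_def)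
    then show ?thesis
      by (simp add: e)
  qed
  obtain m where "c m \<in> fun_ideal R (c ` {..<m})"
    using noetherian_sequence[of R c] noeth c by blast
  \<comment> \<open>Every element of the ideal spanned by the earlier leading coefficients is the
    coefficient at \<open>x ^ e m\<close> of an element generated by the earlier \<open>g k\<close>.
    For a generator \<open>c k\<close>, multiply \<open>g k\<close> by
    \<open>x ^ (e m - e k)\<close>; the exponents are monotone.\<close>
  then have "\<exists>h l'. h \<in> ?I (g ` {..<m}) \<and> l' \<in> low_degree R x (e m) \<and> h = (\<lambda>z. c m z * x z ^ e m + l' z)"
  proof (induction rule: fun_ideal.induct)
    case zero
    show ?case
      using fun_ideal.zero low_degree_0 by (intro exI[of _ "\<lambda>_. 0"]) auto
  next
    case (base s)
    then obtain k where k: "k < m" "s = c k"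
      by auto
    let ?d = "e m - e k"
    have d: "e k + ?d = e m"
      using mono[OF k(1)] by simp
    have "(\<lambda>z. x z ^ ?d * g k z) \<in> ?I (g ` {..<m})"
      using k by (intro fun_ideal.mult adjoin_x_power fun_ideal.base) auto
    moreover have "(\<lambda>z. x z ^ ?d * l k z) \<in> low_degree R x (e m)"
      using low_degree_times_x_power[OF l[of k], of ?d] d by simp
    moreover have "(\<lambda>z. x z ^ ?d * g k z) = (\<lambda>z. s z * x z ^ e m + x z ^ ?d * l k z)"
      by (subst d[symmetric], subst gk) (simp add: k power_add algebra_simps)
    ultimately show ?case
      by blast
  next
    case (add s t)
    then obtain h l' k l'' where "h \<in> ?I (g ` {..<m})" "l' \<in> low_degree R x (e m)" "h = (\<lambda>z. s z * x
      z ^ e m + l' z)"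
      "k \<in> ?I (g ` {..<m})" "l'' \<in> low_degree R x (e m)" "k = (\<lambda>z. t z * x z ^ e m + l'' z)"
      by blast
    then show ?case
      using fun_ideal.add[of h ?A "g ` {..<m}" k] low_degree_add[of l' "e m" l'']
      by (intro exI[of _ "\<lambda>z. h z + k z"] exI[of _ "\<lambda>z. l' z + l'' z"]) (simp add: algebra_simps)
  next
    case (mult r s)
    then obtain h l' where "h \<in> ?I (g ` {..<m})" "l' \<in> low_degree R x (e m)" "h = (\<lambda>z. s z * x z ^ e
      m + l' z)"
      by blast
    then show ?case
      using fun_ideal.mult[OF adjoin_coeff[OF mult(1)], of h
        "g ` {..<m}"] low_degree_cmult[OF mult(1), of l' "e m"]
      by (intro exI[of _ "\<lambda>z. r z * h z"] exI[of _ "\<lambda>z. r z * l' z"]) (simp add: algebra_simps)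
  qed
  then obtain h l' where h: "h \<in> ?I (g ` {..<m})" "l' \<in> low_degree R x (e m)" "h = (\<lambda>z. c m z * x z
    ^ e m + l' z)"
    by blast
  \<comment> \<open>The terms with \<open>x ^ e m\<close> cancel, so
    \<open>deg f \<le> e m < deg (g m)\<close>. Yet \<open>f\<close> is still not generated by the
    earlier elements, against the minimal choice of \<open>g m\<close>.\<close>
  define f where "f = (\<lambda>z. g m z + - 1 * h z)"
  have "(\<lambda>z. - 1 * l' z) \<in> low_degree R x (e m)"
    using low_degree_cmult[OF R_const h(2), of "- 1"] by simp
  then have "(\<lambda>z. l m z + - 1 * l' z) \<in> low_degree R x (e m)"
    by (rule low_degree_add[OF l])
  moreover have "f = (\<lambda>z. l m z + - 1 * l' z)"
    unfolding f_def h(3) by (subst gk) simp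
  ultimately have "deg f \<le> e m"
    using deg_le by simp
  moreover have "f \<in> ?I S"
  proof -
    have "g ` {..<m} \<subseteq> ?I S"
      using g by (auto simp: P_def)
    then have "h \<in> ?I S"
      using h(1) fun_ideal_subset by blast
    then show ?thesis
      using g[of m] fun_ideal.mult[OF adjoin_coeff[OF R_const[of "- 1"]]]
      unfolding f_def P_def by (intro fun_ideal.add) auto
  qed
  moreover have "f \<notin> ?I (g ` {..<m})"
  proof
    assume "f \<in> ?I (g ` {..<m})"
    from fun_ideal.add[OF this h(1)] have "g m \<in> ?I (g ` {..<m})"
      by (simp add: f_def)
    then show False
      using g[of m] by (simp add: P_def)
  qed
  ultimately show False
    using g[of m] e[of m] by (auto simp: P_def)
qed

end

lemma noetherian_constants: "noetherian (range (\<lambda>c (_ :: 'a). c :: real))"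
  unfolding noetherian_def
proof (intro allI impI)
  fix S :: "('a \<Rightarrow> real) set"
  let ?R = "range (\<lambda>c (_ :: 'a). c :: real)"
  assume S: "S \<subseteq> ?R"
  show "\<exists>F\<subseteq>S. finite F \<and> S \<subseteq> fun_ideal ?R F"
  proof (cases "S \<subseteq> {\<lambda>_. 0}")
    case True
    then show ?thesis
      by (intro exI[of _ "{}"]) (auto intro: fun_ideal.zero)
  next
    case False
    then obtain c where c: "(\<lambda>_. c) \<in> S" "c \<noteq> 0"
      using S by auto
    have "(\<lambda>_. d) \<in> fun_ideal ?R {\<lambda>_. c}" for d
      using fun_ideal.mult[of "\<lambda>_. d / c" ?R "\<lambda>_. c" "{\<lambda>_. c}"] c by (auto intro: fun_ideal.base)
    then show ?thesis
      using S c by (intro exI[of _ "{\<lambda>_. c}"]) auto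
  qed
qed

lemma adjoin_subset:
  assumes "R \<subseteq> Collect real_polynomial_function" "real_polynomial_function x"
  shows "adjoin R x \<subseteq> Collect real_polynomial_function"
proof -
  have "low_degree R x n \<subseteq> Collect real_polynomial_function" for n
    by (induction n) (use assms in \<open>auto intro!: real_polynomial_function.intros(3,4)
      real_polynomial_function_power\<close>)
  then show ?thesis
    by (auto simp: adjoin_def)
qed

text \<open>The coordinates are adjoined one by one to the constants. The resulting ring contains
  every linear functional, as a combination of coordinates, and hence every polynomial.\<close>

theorem noetherian_polynomials: "noetherian (Collect (real_polynomial_function :: (real ^ 'n \<Rightarrow> real)
  \<Rightarrow> bool))"
proof -
  have "\<exists>R. fun_subring R \<and> noetherian R \<and> R \<subseteq> Collect real_polynomial_function \<and> (\<forall>i\<in>A. (\<lambda>x. x $ i)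
    \<in> R)"
    if "finite A" for A :: "'n set"
    using that
  proof (induction A)
    case empty
    have "fun_subring (range (\<lambda>c (_ :: real ^ 'n). c :: real))"
      unfolding fun_subring_def by auto
    then show ?case
      using noetherian_constants by (intro exI[of _ "range (\<lambda>c (_ :: real ^ 'n). c :: real)"]) auto
  next
    case (insert i A)
    then obtain R where R: "fun_subring R" "noetherian R" "R \<subseteq> Collect real_polynomial_function"
        "\<forall>i\<in>A. (\<lambda>x. x $ i) \<in> R"
      by auto
    let ?A = "adjoin R (\<lambda>x. x $ i)"
    have "real_polynomial_function (\<lambda>x :: real ^ 'n. x $ i)"
      by (intro real_polynomial_function.intros(1) bounded_linear_vec_nth)
    then have "?A \<subseteq> Collect real_polynomial_function"
      by (rule adjoin_subset[OF R(3)])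
    moreover have "(\<lambda>x. x $ j) \<in> ?A" if "j \<in> insert i A" for j
    proof (cases "j = i")
      case True
      then show ?thesis
        using adjoin_x[OF R(1)] by simp
    next
      case False
      then show ?thesis
        using that R(4) adjoin_coeff[OF R(1)] by blast
    qed
    ultimately show ?case
      using fun_subring_adjoin[OF R(1)] noetherian_adjoin[OF R(1,2)] by blast
  qed
  from this[OF finite[of UNIV]] obtain R :: "(real ^ 'n \<Rightarrow> real) set"
    where R: "fun_subring R" "noetherian R" "R \<subseteq> Collect real_polynomial_function" "\<And>i. (\<lambda>x. x $ i) \<in> R"
    by auto
  have "p \<in> R" if "real_polynomial_function p" for p
    using that
  proof induction
    case (linear f)
    have "(\<lambda>x. \<Sum>i\<in>A. f (axis i 1) * x $ i) \<in> R" if "finite A" for A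
      using that by induction (use R(1,4) in \<open>auto simp: fun_subring_def\<close>)
    moreover have "f = (\<lambda>x. \<Sum>i\<in>UNIV. f (axis i 1) * x $ i)"
    proof
      fix x
      have "f x = f (\<Sum>i\<in>UNIV. x $ i *\<^sub>R axis i 1)"
        by (metis basis_expansion scalar_mult_eq_scaleR)
      also have "\<dots> = (\<Sum>i\<in>UNIV. f (axis i 1) * x $ i)"
        using bounded_linear.linear[OF linear] by (simp add: linear_sum linear_scale mult.commute)
      finally show "f x = (\<Sum>i\<in>UNIV. f (axis i 1) * x $ i)" .
    qed
    ultimately show ?case
      by (metis finite)
  qed (use R(1) in \<open>auto simp: fun_subring_def\<close>)
  then have "R = Collect real_polynomial_function"
    using R(3) by auto
  then show ?thesis
    using R(2) by simp
qed

section \<open>Stratification of real algebraic sets\<close>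

abbreviation rpf :: "('a::real_normed_vector \<Rightarrow> real) \<Rightarrow> bool" where
  "rpf \<equiv> real_polynomial_function"

lemmas rpf_intros = real_polynomial_function.intros(2-4) real_polynomial_function_minus
  real_polynomial_function_diff real_polynomial_function_sum real_polynomial_function_prod
  real_polynomial_function_power

lemma rpf_nth [intro]: "rpf (\<lambda>x :: real ^ 'n. x $ i)"
  by (intro real_polynomial_function.intros(1) bounded_linear_vec_nth)

lemma rpf_det:
  fixes M :: "'a::real_normed_vector \<Rightarrow> real ^ 'n ^ 'n"
  assumes "\<And>i j. rpf (\<lambda>x. M x $ i $ j)"
  shows "rpf (\<lambda>x. det (M x))"
  unfolding det_def by (intro rpf_intros finite_permutations finite assms)

definition partial :: "(real ^ 'n \<Rightarrow> real) \<Rightarrow> 'n \<Rightarrow> real ^ 'n \<Rightarrow> real" where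
  "partial p i x = frechet_derivative p (at x) (axis i 1)"

lemma partial_unique:
  assumes "(p has_derivative (\<lambda>h. \<Sum>i\<in>UNIV. c i * h $ i)) (at x)"
  shows "partial p i x = c i"
  unfolding partial_def frechet_derivative_at[OF assms, symmetric]
  by (simp add: axis_def if_distrib cong: if_cong)

lemma rpf_derivative_exists:
  assumes "rpf (p :: real ^ 'n \<Rightarrow> real)"
  shows "\<exists>D. (\<forall>i. rpf (D i)) \<and> (\<forall>x. (p has_derivative (\<lambda>h. \<Sum>i\<in>UNIV. D i x * h $ i)) (at x))"
  using assms
proof induction
  case (linear f)
  have "f h = (\<Sum>i\<in>UNIV. f (axis i 1) * h $ i)" for h
  proof -
    have "f h = f (\<Sum>i\<in>UNIV. h $ i *\<^sub>R axis i 1)"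
      by (metis basis_expansion scalar_mult_eq_scaleR)
    also have "\<dots> = (\<Sum>i\<in>UNIV. f (axis i 1) * h $ i)"
      using bounded_linear.linear[OF linear] by (simp add: linear_sum linear_scale mult.commute)
    finally show ?thesis .
  qed
  then have "f = (\<lambda>h. \<Sum>i\<in>UNIV. f (axis i 1) * h $ i)"
    by blast
  then show ?case
    using bounded_linear_imp_has_derivative[OF linear]
    by (intro exI[of _ "\<lambda>i x. f (axis i 1)"]) (auto intro: rpf_intros)
next
  case (const c)
  then show ?case
    by (intro exI[of _ "\<lambda>i x. 0"]) (auto intro: rpf_intros)
next
  case (add f g)
  then obtain D E where "\<forall>i. rpf (D i)" "\<And>x. (f has_derivative (\<lambda>h. \<Sum>i\<in>UNIV. D i x * h $ i)) (at x)"
    "\<forall>i. rpf (E i)" "\<And>x. (g has_derivative (\<lambda>h. \<Sum>i\<in>UNIV. E i x * h $ i)) (at x)"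
    by blast
  then show ?case
    using has_derivative_add[of f _ _ g]
    by (intro exI[of _ "\<lambda>i x. D i x + E i x"]) (simp add: sum.distrib distrib_right rpf_intros)
next
  case (mult f g)
  then obtain D E where *: "\<forall>i. rpf (D i)" "\<And>x. (f has_derivative (\<lambda>h. \<Sum>i\<in>UNIV. D i x * h $ i)) (at x)"
    "\<forall>i. rpf (E i)" "\<And>x. (g has_derivative (\<lambda>h. \<Sum>i\<in>UNIV. E i x * h $ i)) (at x)"
    by blast
  have "((\<lambda>x. f x * g x) has_derivative (\<lambda>h. \<Sum>i\<in>UNIV. (f x * E i x + D i x * g x) * h $ i)) (at x)" for x
    using has_derivative_mult[OF *(2)[of x] *(4)[of x]]
    by (simp add: sum.distrib sum_distrib_left sum_distrib_right algebra_simps)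
  moreover have "rpf (\<lambda>x. f x * E i x + D i x * g x)" for i
    using * mult.hyps by (intro real_polynomial_function.intros(3,4)) auto
  ultimately show ?case
    by (intro exI[of _ "\<lambda>i x. f x * E i x + D i x * g x"]) simp
qed

lemma
  assumes "rpf (p :: real ^ 'n \<Rightarrow> real)"
  shows rpf_partial: "rpf (partial p i)"
    and rpf_has_derivative: "(p has_derivative (\<lambda>h. \<Sum>i\<in>UNIV. partial p i x * h $ i)) (at x)"
proof -
  obtain D where D: "\<And>i. rpf (D i)" "\<And>x. (p has_derivative (\<lambda>h. \<Sum>i\<in>UNIV. D i x * h $ i)) (at x)"
    using rpf_derivative_exists[OF assms] by blast
  then have "partial p i = D i" for i
    using partial_unique[OF D(2)] by blast
  with D show "rpf (partial p i)" "(p has_derivative (\<lambda>h. \<Sum>i\<in>UNIV. partial p i x * h $ i)) (at x)"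
    by auto
qed

lemma rpf_continuous_on: "rpf (p :: real ^ 'n \<Rightarrow> real) \<Longrightarrow> continuous_on S p"
  by (intro continuous_at_imp_continuous_on ballI has_derivative_continuous[OF rpf_has_derivative])

lemma partial_nth: "partial (\<lambda>x. x $ k) i x = (if i = k then 1 else 0)"
proof (rule partial_unique)
  have "((\<lambda>x. x $ k) has_derivative (\<lambda>h. h $ k)) (at x)"
    by (intro bounded_linear_imp_has_derivative bounded_linear_vec_nth)
  then show "((\<lambda>x. x $ k) has_derivative (\<lambda>h. \<Sum>i\<in>UNIV. (if i = k then 1 else 0) * h $ i)) (at x)"
    by (simp add: if_distribR if_distrib cong: if_cong)
qed

lemma has_derivative_vec:
  fixes f :: "'a::real_normed_vector \<Rightarrow> real ^ 'n"
  assumes "\<And>i. ((\<lambda>x. f x $ i) has_derivative (\<lambda>h. f' h $ i)) (at x)"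
  shows "(f has_derivative f') (at x)"
  by (auto simp: has_derivative_componentwise_within[of f f' x UNIV] Basis_vec_def inner_axis assms)

lemma C_k_on_polynomial:
  fixes f :: "real ^ 'n \<Rightarrow> real ^ 'm"
  shows "(\<And>i. rpf (\<lambda>x. f x $ i)) \<Longrightarrow> C_k_on k f U"
proof (induction k arbitrary: f)
  case 0
  have "continuous_on U (\<lambda>x. \<chi> i. f x $ i)"
    by (intro continuous_on_vec_lambda rpf_continuous_on 0)
  then show ?case
    by simp
next
  case (Suc k)
  let ?f' = "\<lambda>x h. \<chi> i. \<Sum>j\<in>UNIV. partial (\<lambda>x. f x $ i) j x * h $ j"
  have d: "(f has_derivative ?f' x) (at x)" for x
    by (rule has_derivative_vec) (simp add: rpf_has_derivative Suc.prems)
  have "C_k_on k (\<lambda>x. ?f' x b) U" for b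
    by (rule Suc.IH) (auto intro!: rpf_intros rpf_partial Suc.prems)
  then have "C_k_on k (\<lambda>x. frechet_derivative f (at x) b) U" for b
    by (simp flip: frechet_derivative_at[OF d])
  then show ?case
    using d by (auto simp: differentiable_def)
qed

lemma C_k_on_cong:
  assumes "open U" "\<And>x. x \<in> U \<Longrightarrow> f x = g x"
  shows "C_k_on k f U \<longleftrightarrow> C_k_on k g U"
  using assms(2)
proof (induction k arbitrary: f g)
  case (Suc k)
  have *: "(f has_derivative f') (at x) \<longleftrightarrow> (g has_derivative f') (at x)" if "x \<in> U" for x f'
    using Suc.prems has_derivative_transform_within_open[OF _ assms(1) that, of f f' UNIV g]
      has_derivative_transform_within_open[OF _ assms(1) that, of g f' UNIV f] by auto
  then have "frechet_derivative f (at x) = frechet_derivative g (at x)" if "x \<in> U" for x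
    using that by (simp add: frechet_derivative_def)
  then have "C_k_on k (\<lambda>x. frechet_derivative f (at x) b) U \<longleftrightarrow> C_k_on k (\<lambda>x. frechet_derivative g (at
    x) b) U" for b
    by (intro Suc.IH) simp
  then show ?case
    using * by (simp add: differentiable_def)
qed (simp cong: continuous_on_cong)

lemma has_derivative_quotient_power:
  fixes p d :: "'a::real_normed_vector \<Rightarrow> real"
  assumes "(p has_derivative p') (at x)" "(d has_derivative d') (at x)" "d x \<noteq> 0"
  shows "((\<lambda>x. p x / d x ^ m) has_derivative
           (\<lambda>h. (p' h * d x - of_nat m * p x * d' h) / d x ^ Suc m)) (at x)"
proof -
  have "((\<lambda>x. p x / d x ^ m) has_derivative
     (\<lambda>h. (p' h * d x ^ m - p x * (of_nat m * d' h * d x ^ (m - 1))) / (d x ^ m * d x ^ m))) (at x)"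
    using assms by (intro has_derivative_divide' has_derivative_power) auto
  moreover have "(p' h * d x ^ m - p x * (of_nat m * d' h * d x ^ (m - 1))) / (d x ^ m * d x ^ m)
      = (p' h * d x - of_nat m * p x * d' h) / d x ^ Suc m" for h
    using assms(3) by (cases m) (simp_all add: field_simps)
  ultimately show ?thesis
    by simp
qed

text \<open>
  Quotients of polynomials in \<open>g\<close> by powers of \<open>\<delta> \<circ> g\<close> are closed under differentiation, which gives
  the smoothness of the local inverse \<open>g\<close>.
\<close>

lemma C_k_on_inverse:
  fixes g :: "real ^ 'n \<Rightarrow> real ^ 'n" and \<delta> :: "real ^ 'n \<Rightarrow> real"
  assumes "open V" and g: "\<And>y. y \<in> V \<Longrightarrow> (g has_derivative g' y) (at y)"
    and \<delta>: "rpf \<delta>" "\<And>y. y \<in> V \<Longrightarrow> \<delta> (g y) \<noteq> 0"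
    and A: "\<And>b l. rpf (A b l)" "\<And>y b l. y \<in> V \<Longrightarrow> g' y b $ l = A b l (g y) / \<delta> (g y)"
    and P: "\<And>i. rpf (P i)"
  shows "C_k_on k (\<lambda>y. (\<chi> i. P i (g y) / \<delta> (g y) ^ m) :: real ^ 'm) V"
  using P
proof (induction k arbitrary: P m)
  case 0
  have "continuous_on V g"
    using g by (intro continuous_at_imp_continuous_on ballI has_derivative_continuous)
  then have "continuous_on V (\<lambda>y. p (g y))" if "rpf p" for p
    using rpf_continuous_on[OF that, of UNIV] continuous_on_compose2 by blast
  then show ?case
    using 0 \<delta> by (auto intro!: continuous_on_vec_lambda continuous_intros)
next
  case (Suc k)
  let ?h = "\<lambda>y. (\<chi> i. P i (g y) / \<delta> (g y) ^ m) :: real ^ 'm"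
  have comp: "((\<lambda>y. p (g y)) has_derivative (\<lambda>v. \<Sum>l\<in>UNIV. partial p l (g y) * g' y v $ l)) (at y)"
    if "rpf p" "y \<in> V" for p y
    using has_derivative_compose[OF g[OF that(2)] rpf_has_derivative[OF that(1)]] by simp
  let ?h' = "\<lambda>y v. \<chi> i. ((\<Sum>l\<in>UNIV. partial (P i) l (g y) * g' y v $ l) * \<delta> (g y)
      - of_nat m * P i (g y) * (\<Sum>l\<in>UNIV. partial \<delta> l (g y) * g' y v $ l)) / \<delta> (g y) ^ Suc m"
  have d: "(?h has_derivative ?h' y) (at y)" if "y \<in> V" for y
    using has_derivative_quotient_power[OF comp[OF Suc.prems that] comp[OF \<delta>(1) that] \<delta>(2)[OF that]]
    by (intro has_derivative_vec) (simp del: power_Suc)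
  define Q where "Q b i x = (\<Sum>l\<in>UNIV. partial (P i) l x * A b l x) * \<delta> x
      - of_nat m * P i x * (\<Sum>l\<in>UNIV. partial \<delta> l x * A b l x)" for b i x
  have Q: "rpf (Q b i)" for b i
    unfolding Q_def by (intro rpf_intros rpf_partial \<delta> A Suc.prems finite)
  have "?h' y b = (\<chi> i. Q b i (g y) / \<delta> (g y) ^ (m + 2))" if "y \<in> V" for y b
  proof -
    have *: "(\<Sum>l\<in>UNIV. c l * g' y b $ l) = (\<Sum>l\<in>UNIV. c l * A b l (g y)) / \<delta> (g y)" for c
      using A(2)[OF that] by (simp add: sum_divide_distrib)
    have "(s / d * d - of_nat m * p * (t / d)) / d ^ Suc m = (s * d - of_nat m * p * t) / d ^ (m + 2)"
      if "d \<noteq> 0" for s t d p :: real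
      using that by (simp add: field_simps)
    from this[OF \<delta>(2)[OF that]] show ?thesis
      by (simp only: vec_eq_iff vec_lambda_beta Q_def * simp_thms)
  qed
  moreover have "frechet_derivative ?h (at y) = ?h' y" if "y \<in> V" for y
    using frechet_derivative_at[OF d[OF that]] by simp
  ultimately have "C_k_on k (\<lambda>y. frechet_derivative ?h (at y) b) V" for b
    using Suc.IH[of "Q b" "m + 2"] Q
    by (subst C_k_on_cong[OF \<open>open V\<close>, where g="\<lambda>y. \<chi> i. Q b i (g y) / \<delta> (g y) ^ (m + 2)"]) auto
  then show ?case
    using d by (auto simp: differentiable_def)
qed

section \<open>Uniqueness for linear differential equations\<close>

lemma gronwall_zero:
  fixes \<phi> \<phi>' :: "real \<Rightarrow> real"
  assumes d: "\<And>t. t \<in> {0..1} \<Longrightarrow> (\<phi> has_real_derivative \<phi>' t) (at t)"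
    and le: "\<And>t. t \<in> {0..1} \<Longrightarrow> \<phi>' t \<le> C * \<phi> t" and nonneg: "\<And>t. \<phi> t \<ge> 0" and "\<phi> 0 = 0"
  shows "\<phi> 1 = 0"
proof -
  let ?f = "\<lambda>t. exp (- C * t) * \<phi> t"
  have "?f 1 \<le> ?f 0"
  proof (rule DERIV_nonpos_imp_nonincreasing[of 0 1 ?f])
    fix t :: real assume t: "0 \<le> t" "t \<le> 1"
    have "(?f has_real_derivative exp (- C * t) * (\<phi>' t - C * \<phi> t)) (at t)"
      using d[of t] t by (auto intro!: derivative_eq_intros simp: algebra_simps)
    moreover have "exp (- C * t) * (\<phi>' t - C * \<phi> t) \<le> 0"
      using le[of t] t by (simp add: mult_nonneg_nonpos)
    ultimately show "\<exists>y. (?f has_real_derivative y) (at t) \<and> y \<le> 0"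
      by blast
  qed simp
  then have "exp (- C) * \<phi> 1 \<le> 0"
    using \<open>\<phi> 0 = 0\<close> by simp
  then show ?thesis
    using nonneg[of 1] by (simp add: mult_le_0_iff)
qed

text \<open>The sum of squares of the solution satisfies a Gronwall inequality; its constant comes
  from bounds of the continuous coefficients on the compact interval.\<close>

lemma linear_ode_zero:
  fixes u :: "'i \<Rightarrow> real \<Rightarrow> real"
  assumes "finite F"
    and d: "\<And>f t. f \<in> F \<Longrightarrow> t \<in> {0..1} \<Longrightarrow> (u f has_real_derivative (\<Sum>h\<in>F. c f h t * u h t)) (at t)"
    and c: "\<And>f h. f \<in> F \<Longrightarrow> h \<in> F \<Longrightarrow> continuous_on {0..1} (c f h)"
    and 0: "\<And>f. f \<in> F \<Longrightarrow> u f 0 = 0"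
  shows "\<And>f. f \<in> F \<Longrightarrow> u f 1 = 0"
proof -
  have "\<exists>K\<ge>0. \<forall>t\<in>{0..1}. \<bar>c f h t\<bar> \<le> K" if "f \<in> F" "h \<in> F" for f h
  proof -
    have "bounded (c f h ` {0..1})"
      by (intro compact_imp_bounded compact_continuous_image c that) simp
    then show ?thesis
      by (metis bounded_iff imageI real_norm_def abs_ge_zero order_trans order_refl)
  qed
  then obtain K where K: "\<And>f h. f \<in> F \<Longrightarrow> h \<in> F \<Longrightarrow> K f h \<ge> 0"
    "\<And>f h t. f \<in> F \<Longrightarrow> h \<in> F \<Longrightarrow> t \<in> {0..1} \<Longrightarrow> \<bar>c f h t\<bar> \<le> K f h"
    by metis
  define \<phi> where "\<phi> t = (\<Sum>f\<in>F. (u f t)\<^sup>2)" for t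
  define C where "C = 2 * (\<Sum>f\<in>F. \<Sum>h\<in>F. K f h)"
  have "\<phi> 1 = 0"
  proof (rule gronwall_zero)
    fix t :: real assume t: "t \<in> {0..1}"
    show "(\<phi> has_real_derivative (\<Sum>f\<in>F. 2 * u f t * (\<Sum>h\<in>F. c f h t * u h t))) (at t)"
      unfolding \<phi>_def by (auto intro!: derivative_eq_intros d t sum.cong simp: algebra_simps)
    have "2 * (u f t * (c f h t * u h t)) \<le> 2 * K f h * \<phi> t" if "f \<in> F" "h \<in> F" for f h
    proof -
      have le: "\<bar>u k t\<bar> \<le> sqrt (\<phi> t)" if "k \<in> F" for k
      proof -
        have "(u k t)\<^sup>2 \<le> \<phi> t"
          unfolding \<phi>_def using assms(1) that by (intro member_le_sum) auto
        then show ?thesis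
          by (simp add: real_le_rsqrt)
      qed
      have "u f t * (c f h t * u h t) \<le> \<bar>c f h t\<bar> * (\<bar>u f t\<bar> * \<bar>u h t\<bar>)"
        by (metis abs_ge_self abs_mult mult.left_commute)
      also have "\<dots> \<le> K f h * (sqrt (\<phi> t) * sqrt (\<phi> t))"
        using le that K t by (intro mult_mono) (auto simp: \<phi>_def sum_nonneg)
      also have "\<dots> = K f h * \<phi> t"
        by (simp add: \<phi>_def sum_nonneg)
      finally show ?thesis
        by simp
    qed
    then have "(\<Sum>f\<in>F. \<Sum>h\<in>F. 2 * (u f t * (c f h t * u h t))) \<le> (\<Sum>f\<in>F. \<Sum>h\<in>F. 2 * K f h * \<phi> t)"
      by (intro sum_mono) auto
    then show "(\<Sum>f\<in>F. 2 * u f t * (\<Sum>h\<in>F. c f h t * u h t)) \<le> C * \<phi> t"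
      by (simp add: C_def sum_distrib_left sum_distrib_right mult.assoc)
  qed (auto simp: \<phi>_def 0 sum_nonneg)
  then show "u f 1 = 0" if "f \<in> F" for f
    using that assms(1) by (simp add: \<phi>_def sum_nonneg_eq_0_iff)
qed

section \<open>Consequences of the basis theorem for algebraic sets\<close>

lemma fun_ideal_vanishes: "f \<in> fun_ideal R S \<Longrightarrow> (\<And>s. s \<in> S \<Longrightarrow> s x = 0) \<Longrightarrow> f x = 0"
  by (induction rule: fun_ideal.induct) auto

lemma fun_ideal_combination:
  assumes "fun_subring R" "finite F" "f \<in> fun_ideal R F"
  shows "\<exists>q. (\<forall>h. q h \<in> R) \<and> f = (\<lambda>x. \<Sum>h\<in>F. q h x * h x)"
  using assms(3)
proof (induction rule: fun_ideal.induct)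
  case zero
  show ?case
    using assms(1) by (intro exI[of _ "\<lambda>h x. 0"]) (auto simp: fun_subring_def)
next
  case (base s)
  have "(\<Sum>h\<in>F. (if h = s then 1 else 0) * h x) = s x" for x
  proof -
    have "(\<Sum>h\<in>F. (if h = s then 1 else 0) * h x) = (\<Sum>h\<in>F. if h = s then h x else 0)"
      by (intro sum.cong) auto
    then show ?thesis
      using base assms(2) by simp
  qed
  then show ?case
    using assms(1) by (intro exI[of _ "\<lambda>h x. if h = s then 1 else 0"]) (auto simp: fun_subring_def)
next
  case (add f g)
  then obtain q r where "\<forall>h. q h \<in> R" "f = (\<lambda>x. \<Sum>h\<in>F. q h x * h x)" "\<forall>h. r h \<in> R"
    "g = (\<lambda>x. \<Sum>h\<in>F. r h x * h x)"
    by blast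
  then show ?case
    using assms(1) by (intro exI[of _ "\<lambda>h x. q h x + r h x"]) (auto simp: fun_subring_def
      sum.distrib distrib_right)
next
  case (mult r f)
  then obtain q where "\<forall>h. q h \<in> R" "f = (\<lambda>x. \<Sum>h\<in>F. q h x * h x)"
    by blast
  then show ?case
    using assms(1) mult by (intro exI[of _ "\<lambda>h x. r x * q h x"]) (auto simp: fun_subring_def
      sum_distrib_left mult.assoc)
qed

lemma fun_subring_polynomials: "fun_subring (Collect rpf)"
  unfolding fun_subring_def by (auto intro: real_polynomial_function.intros)

lemma real_algebraic_finite:
  fixes V :: "(real ^ 'n) set"
  assumes "real_algebraic V"
  shows "\<exists>P. finite P \<and> (\<forall>p\<in>P. rpf p) \<and> V = {x. \<forall>p\<in>P. p x = 0}"
proof -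
  obtain P where P: "\<forall>p\<in>P. rpf p" "V = {x. \<forall>p\<in>P. p x = 0}"
    using assms unfolding real_algebraic_def by blast
  then have "P \<subseteq> Collect rpf"
    by blast
  from noetherian_polynomials[unfolded noetherian_def, rule_format, OF this]
  obtain F where F: "F \<subseteq> P" "finite F" "P \<subseteq> fun_ideal (Collect rpf) F"
    by blast
  have "p x = 0" if "\<forall>p\<in>F. p x = 0" "p \<in> P" for p x
    using fun_ideal_vanishes[of p "Collect rpf" F x] subsetD[OF F(3) that(2)] that(1) by simp
  then have "V = {x. \<forall>p\<in>F. p x = 0}"
    unfolding P(2) using F(1) by (intro Collect_cong) (metis subsetD)
  moreover have "\<forall>p\<in>F. rpf p"
    using P(1) F(1) by (meson subsetD)
  ultimately show ?thesis
    using F(2) by (intro exI[of _ F] conjI)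
qed

text \<open>Along an infinite descent choose \<open>p i\<close> vanishing on the next set but not at
  some \<open>x i\<close> of the present one. Some \<open>p m\<close> lies in the ideal of its
  predecessors, and all of these vanish at \<open>x m\<close>.\<close>

lemma wf_real_algebraic: "wf {(W, V :: (real ^ 'n) set). real_algebraic W \<and> W \<subset> V}"
  unfolding wf_iff_no_infinite_down_chain
proof
  assume "\<exists>f. \<forall>i. (f (Suc i), f i) \<in> {(W, V :: (real ^ 'n) set). real_algebraic W \<and> W \<subset> V}"
  then obtain f :: "nat \<Rightarrow> (real ^ 'n) set"
    where "\<forall>i. (f (Suc i), f i) \<in> {(W, V). real_algebraic W \<and> W \<subset> V}"
    by blast
  then have f: "\<And>i. real_algebraic (f (Suc i))" "\<And>i. f (Suc i) \<subset> f i"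
    by auto
  have "\<exists>p x. rpf p \<and> (\<forall>y\<in>f (Suc i). p y = 0) \<and> x \<in> f i \<and> p x \<noteq> 0" for i
  proof -
    obtain P where P: "\<forall>p\<in>P. rpf p" "f (Suc i) = {x. \<forall>p\<in>P. p x = 0}"
      using f(1)[of i] unfolding real_algebraic_def by blast
    obtain x where x: "x \<in> f i" "x \<notin> f (Suc i)"
      using f(2)[of i] by blast
    obtain q where q: "q \<in> P" "q x \<noteq> 0"
      using x(2) unfolding P(2) by blast
    have "\<forall>y\<in>f (Suc i). q y = 0"
      unfolding P(2) using q(1) by simp
    moreover have "rpf q"
      using P(1) q(1) by (rule bspec)
    ultimately show ?thesis
      using x(1) q(2) by (intro exI[of _ q] exI[of _ x] conjI)
  qed
  then obtain p x where p: "\<And>i. rpf (p i)" "\<And>i y. y \<in> f (Suc i) \<Longrightarrow> p i y = 0" "\<And>i. x i \<in> f i"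
    "\<And>i. p i (x i) \<noteq> 0"
    by metis
  obtain m where m: "p m \<in> fun_ideal (Collect rpf) (p ` {..<m})"
    using noetherian_sequence[OF noetherian_polynomials[where 'n='n], of p] p(1) by auto
  have anti: "f j \<subseteq> f i" if "i \<le> j" for i j
    using lift_Suc_antimono_le[of f, OF _ that] f(2) by blast
  have "p m (x m) = 0"
  proof (rule fun_ideal_vanishes[OF m])
    fix s assume "s \<in> p ` {..<m}"
    then obtain i where "i < m" "s = p i"
      by auto
    then show "s (x m) = 0"
      using p(2)[of "x m" i] p(3)[of m] anti[of "Suc i" m] by auto
  qed
  then show False
    using p(4) by simp
qed

lemma semialgebraic_zero: "rpf p \<Longrightarrow> semialgebraic {x. p x = 0}"
proof -
  assume p: "rpf p"
  have "{x. p x = 0} = - {x. p x > 0} \<inter> - {x. - p x > 0}"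
    by auto
  moreover have "semialgebraic {x. - p x > 0}"
    using p by (intro semialgebraic.pos real_polynomial_function_minus)
  ultimately show ?thesis
    using p by (simp only: semialgebraic.intros)
qed

lemma semialgebraic_UNIV: "semialgebraic UNIV"
  using semialgebraic.pos[of "\<lambda>_. 1"] real_polynomial_function.intros(2)[of 1] by simp

lemma semialgebraic_real_algebraic:
  fixes V :: "(real ^ 'n) set"
  assumes "real_algebraic V"
  shows "semialgebraic V"
proof -
  obtain P where P: "finite P" "\<forall>p\<in>P. rpf p" "V = {x. \<forall>p\<in>P. p x = 0}"
    using real_algebraic_finite[OF assms] by blast
  have "semialgebraic {x. \<forall>p\<in>P. p x = 0}"
    using P(1,2)
  proof (induction P)
    case (insert p P)
    have "{x. \<forall>q\<in>insert p P. q x = 0} = {x. p x = 0} \<inter> {x. \<forall>q\<in>P. q x = 0}"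
      by auto
    then show ?case
      using insert by (auto intro!: semialgebraic.inter semialgebraic_zero)
  qed (simp add: semialgebraic_UNIV)
  then show ?thesis
    by (simp add: P(3))
qed

text \<open>Cramer's rule for the transposed system: writing \<open>c\<close> as a combination of
  the rows of \<open>J\<close>, the coefficient of row \<open>b\<close> is the determinant with that
  row replaced, over \<open>det J\<close>. It expresses a directional derivative by determinants
  polynomial in the point.\<close>

lemma det_replace_row:
  fixes J :: "real ^ 'n ^ 'n"
  assumes "det J \<noteq> 0" "J *v w = v"
  shows "(\<Sum>l\<in>UNIV. c l * w $ l) = (\<Sum>b\<in>UNIV. v $ b * det (\<chi> i j. if i = b then c j else J $ i $ j)) /
    det J"
proof -
  have "invertible (transpose J)"
    using assms(1) by (simp add: invertible_det_nz)
  then obtain x where x: "transpose J *v x = (\<chi> l. c l)"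
    by (metis invertible_def matrix_vector_mul_assoc matrix_vector_mul_lid)
  have c: "c l = (\<Sum>i\<in>UNIV. x $ i * J $ i $ l)" for l
    using arg_cong[OF x, of "\<lambda>y. y $ l"] by (simp add: matrix_vector_mult_def transpose_def mult.commute)
  have "(\<chi> i j. if i = b then c j else J $ i $ j) = (\<chi> i. if i = b then \<Sum>i\<in>UNIV. x $ i *s row i J
    else row i J)" for b
    by (simp add: vec_eq_iff row_def c)
  then have d: "det (\<chi> i j. if i = b then c j else J $ i $ j) = x $ b * det J" for b
    by (simp add: cramer_lemma_transpose)
  have "(\<Sum>l\<in>UNIV. c l * w $ l) = (\<Sum>i\<in>UNIV. x $ i * (J *v w) $ i)"
    unfolding c sum_distrib_right matrix_vector_mult_def
    by (subst sum.swap) (simp add: sum_distrib_left mult.assoc)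
  also have "\<dots> = (\<Sum>b\<in>UNIV. v $ b * (x $ b * det J)) / det J"
    using assms by (simp add: sum_divide_distrib mult.commute)
  finally show ?thesis
    by (simp add: d)
qed

abbreviation jacobian_matrix :: "('n \<Rightarrow> real ^ 'n \<Rightarrow> real) \<Rightarrow> real ^ 'n \<Rightarrow> real ^ 'n ^ 'n" where
  "jacobian_matrix G x \<equiv> \<chi> i j. partial (G i) j x"

lemma rpf_jacobian_det: "(\<And>i. rpf (G i)) \<Longrightarrow> rpf (\<lambda>x. det (jacobian_matrix G x))"
  by (intro rpf_det) (simp add: rpf_partial)

text \<open>The image of the chart is shrunk to a ball so that segments stay inside it. By Cramer's
  rule the derivative of \<open>g\<close> is a polynomial in \<open>g\<close> divided by the
  Jacobian determinant at \<open>g\<close>, which is the form needed for smoothness of all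
  orders.\<close>

lemma polynomial_local_inverse:
  fixes G :: "'n \<Rightarrow> real ^ 'n \<Rightarrow> real"
  assumes G: "\<And>i. rpf (G i)" and x0: "det (jacobian_matrix G x0) \<noteq> 0"
  obtains U V g g' where "open U" "x0 \<in> U" "\<And>x. x \<in> U \<Longrightarrow> det (jacobian_matrix G x) \<noteq> 0"
    "open V" "convex V" "homeomorphism U V (\<lambda>x. \<chi> i. G i x) g" "smooth_on g V"
    "\<And>y. y \<in> V \<Longrightarrow> (g has_derivative g' y) (at y)" "\<And>y h. y \<in> V \<Longrightarrow> jacobian_matrix G (g y) *v g' y h = h"
proof -
  let ?J = "jacobian_matrix G" and ?F = "\<lambda>x. \<chi> i. G i x"
  let ?\<delta> = "\<lambda>x. det (?J x)"
  define U0 where "U0 = {x. ?\<delta> x \<noteq> 0}"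
  have \<delta>: "rpf ?\<delta>"
    by (rule rpf_jacobian_det[OF G])
  have "open U0"
    unfolding U0_def by (intro open_Collect_neq rpf_continuous_on \<delta> continuous_on_const)
  define f' where "f' x = Blinfun ((*v) (?J x))" for x
  have f': "blinfun_apply (f' x) = (*v) (?J x)" for x
    unfolding f'_def by (rule bounded_linear_Blinfun_apply) (rule matrix_vector_mul_bounded_linear)
  have derF: "(?F has_derivative (*v) (?J x)) (at x)" for x
    by (rule has_derivative_vec) (simp add: matrix_vector_mult_def rpf_has_derivative G)
  have cont: "continuous_on U0 f'"
  proof (rule continuous_on_blinfun_componentwise)
    show "continuous_on U0 (\<lambda>x. blinfun_apply (f' x) b)" for b
      unfolding f' matrix_vector_mult_def vec_lambda_beta
      by (intro continuous_on_vec_lambda continuous_on_sum continuous_on_mult continuous_on_const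
        rpf_continuous_on rpf_partial G)
  qed
  obtain N where N: "N ** ?J x0 = mat 1"
    using x0 invertible_det_nz invertible_def by blast
  have inv: "Blinfun ((*v) N) o\<^sub>L f' x0 = id_blinfun"
    by (rule blinfun_eqI)
      (simp add: f' bounded_linear_Blinfun_apply matrix_vector_mul_bounded_linear
        matrix_vector_mul_assoc N)
  have d: "(?F has_derivative blinfun_apply (f' x)) (at x)" if "x \<in> U0" for x
    unfolding f' by (rule derF)
  have "x0 \<in> U0"
    using x0 by (simp add: U0_def)
  obtain U W g g' where U: "open U" "U \<subseteq> U0" "x0 \<in> U" and W: "open W" "?F x0 \<in> W" and hom:
    "homeomorphism U W ?F g"
    and g: "\<And>y. y \<in> W \<Longrightarrow> (g has_derivative (g' y)) (at y)"
    and g': "\<And>y. y \<in> W \<Longrightarrow> g' y = inv (blinfun_apply (f' (g y)))"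
    and bij: "\<And>y. y \<in> W \<Longrightarrow> bij (blinfun_apply (f' (g y)))"
    by (rule inverse_function_theorem[OF \<open>open U0\<close> d cont \<open>x0 \<in> U0\<close> inv]) (assumption, rule that)
  obtain r where r: "r > 0" "ball (?F x0) r \<subseteq> W"
    using W openE by blast
  let ?V = "ball (?F x0) r"
  define U1 where "U1 = U \<inter> ?F -` ?V"
  have "continuous_on U ?F"
    using hom by (auto simp: homeomorphism_def)
  then have U1: "open U1"
    unfolding U1_def using U(1) by (intro continuous_open_preimage) auto
  have im: "?F ` U1 = ?V"
  proof
    show "?V \<subseteq> ?F ` U1"
    proof
      fix y assume y: "y \<in> ?V"
      then have "y \<in> W"
        using r by blast
      then have "g y \<in> U" "?F (g y) = y"
        using hom by (auto simp: homeomorphism_def)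
      then show "y \<in> ?F ` U1"
        using y by (intro image_eqI[of _ _ "g y"]) (simp_all add: U1_def)
    qed
  qed (auto simp: U1_def)
  have hom1: "homeomorphism U1 ?V ?F g"
    by (rule homeomorphism_of_subsets[OF hom _ empty_subsetI im]) (simp add: U1_def)
  have J: "?J (g y) *v g' y h = h" if "y \<in> ?V" for y h
    using that r g'[of y] bij[of y] surj_f_inv_f[of "(*v) (?J (g y))" h] by (auto simp: f' bij_is_surj)
  have gU: "?\<delta> (g y) \<noteq> 0" if "y \<in> ?V" for y
  proof -
    have "g y \<in> U"
      using hom subsetD[OF r(2) that] unfolding homeomorphism_def by auto
    then show ?thesis
      using U(2) by (auto simp: U0_def)
  qed
  define A where "A b l x = det (\<chi> i j. if j = l then b $ i else ?J x $ i $ j)" for b l x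
  have A: "rpf (A b l)" for b l
    unfolding A_def
  proof (rule rpf_det)
    show "rpf (\<lambda>x. (\<chi> i j. if j = l then b $ i else ?J x $ i $ j) $ i $ j)" for i j
      by (cases "j = l") (simp_all add: rpf_partial G real_polynomial_function.intros(2))
  qed
  have A': "g' y b $ l = A b l (g y) / ?\<delta> (g y)" if "y \<in> ?V" for y b l
    using cramer_lemma[of l "?J (g y)" "g' y b"] gU[OF that] unfolding J[OF that] A_def by (simp
      add: field_simps)
  \<comment> \<open>The exponent \<open>0\<close> presents \<open>g\<close> itself as a quotient of
    the required form.\<close>
  have "C_k_on k (\<lambda>y. \<chi> i. g y $ i / ?\<delta> (g y) ^ 0) ?V" for k
    by (rule C_k_on_inverse[OF open_ball g[OF subsetD[OF r(2)]] \<delta> gU A A']) (auto intro: rpf_nth)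
  then have "smooth_on g ?V"
    by (simp add: smooth_on_def)
  show ?thesis
  proof (rule that[OF U1 _ _ open_ball convex_ball hom1 \<open>smooth_on g ?V\<close>])
    show "x0 \<in> U1"
      using U r by (simp add: U1_def)
    show "?\<delta> x \<noteq> 0" if "x \<in> U1" for x
      using that U by (auto simp: U1_def U0_def)
    show "(g has_derivative g' y) (at y)" if "y \<in> ?V" for y
      using g[OF subsetD[OF r(2) that]] .
    show "?J (g y) *v g' y h = h" if "y \<in> ?V" for y h
      using J[OF that] .
  qed
qed

text \<open>
  By minimality the ideal of \<open>V\<close> is closed under the derivations that replace a row of the Jacobian.
  Pulled back to the chart, finitely many generators of the ideal therefore solve a homogeneous
  linear system along each segment of the coordinate plane, hence vanish on it.
\<close>

lemma regular_stratum:
  fixes V :: "(real ^ 'n) set" and G :: "'n \<Rightarrow> real ^ 'n \<Rightarrow> real"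
  assumes P: "V = {x. \<forall>p\<in>P. p x = 0}" "\<forall>p\<in>P. rpf p"
    and G: "\<And>i. rpf (G i)" "\<And>i. i \<in> B \<Longrightarrow> G i = (\<lambda>x. x $ i)" "\<And>i x. i \<notin> B \<Longrightarrow> x \<in> V \<Longrightarrow> G i x = 0"
    and minimal: "\<And>f b x. rpf f \<Longrightarrow> (\<And>x. x \<in> V \<Longrightarrow> f x = 0) \<Longrightarrow> b \<in> B \<Longrightarrow> x \<in> V \<Longrightarrow> det (jacobian_matrix (G(b
      := f)) x) = 0"
  shows "smooth_submanifold (card B) (V \<inter> {x. det (jacobian_matrix G x) \<noteq> 0})"
  unfolding smooth_submanifold_def
proof (intro ballI)
  let ?F = "\<lambda>x. \<chi> i. G i x" and ?\<delta> = "\<lambda>x. det (jacobian_matrix G x)"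
  let ?M = "V \<inter> {x. ?\<delta> x \<noteq> 0}"
  fix x0 assume "x0 \<in> ?M"
  then have x0: "x0 \<in> V" "?\<delta> x0 \<noteq> 0"
    by auto
  obtain U W g g' where U: "open U" "x0 \<in> U" "\<And>x. x \<in> U \<Longrightarrow> ?\<delta> x \<noteq> 0"
    and W: "open W" "convex W" and hom: "homeomorphism U W ?F g" "smooth_on g W"
    and g: "\<And>y. y \<in> W \<Longrightarrow> (g has_derivative g' y) (at y)"
    and g': "\<And>y h. y \<in> W \<Longrightarrow> jacobian_matrix G (g y) *v g' y h = h"
    using polynomial_local_inverse[of G x0, OF G(1) x0(2)] by metis
  have gU: "g y \<in> U" "?F (g y) = y" if "y \<in> W" for y
    using hom that unfolding homeomorphism_def by auto
  have Fg: "?F x \<in> W" "g (?F x) = x" if "x \<in> U" for x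
    using hom that unfolding homeomorphism_def by auto
  define T where "T = {y :: real ^ 'n. \<forall>i. i \<notin> B \<longrightarrow> y $ i = 0}"
  have T: "subspace T" "dim T = card B"
    unfolding T_def using dim_substandard_cart[of B, where 'a=real] by (auto simp: subspace_def
      dim_vec_eq)
  define I where "I = {f. rpf f \<and> (\<forall>x\<in>V. f x = 0)}"
  have "I \<subseteq> Collect rpf"
    by (auto simp: I_def)
  from noetherian_polynomials[unfolded noetherian_def, rule_format, OF this]
  obtain F where F: "F \<subseteq> I" "finite F" "I \<subseteq> fun_ideal (Collect rpf) F"
    by blast
  \<comment> \<open>Divided by the Jacobian determinant of \<open>G\<close>, this is the partial
    derivative of \<open>f\<close> in the chart coordinate with index \<open>b\<close>.\<close>
  define D where "D b f x = det (jacobian_matrix (G(b := f)) x)" for b f x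
  have "\<exists>q. (\<forall>h. q h \<in> Collect rpf) \<and> D b f = (\<lambda>x. \<Sum>h\<in>F. q h x * h x)" if "b \<in> B" "f \<in> F" for b f
  proof (rule fun_ideal_combination[OF fun_subring_polynomials F(2)])
    have f: "rpf f" "\<And>x. x \<in> V \<Longrightarrow> f x = 0"
      using that(2) F(1) by (auto simp: I_def)
    have "rpf (D b f)"
      unfolding D_def by (rule rpf_jacobian_det) (simp add: G(1) f(1))
    moreover have "D b f x = 0" if "x \<in> V" for x
      unfolding D_def using minimal[OF f \<open>b \<in> B\<close> that] .
    ultimately have "D b f \<in> I"
      by (simp add: I_def)
    then show "D b f \<in> fun_ideal (Collect rpf) F"
      using F(3) by (rule subsetD[rotated])
  qed
  then have "\<forall>b f. \<exists>q. b \<in> B \<and> f \<in> F \<longrightarrow> (\<forall>h. rpf (q h)) \<and> D b f = (\<lambda>x. \<Sum>h\<in>F. q h x * h x)"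
    by simp
  then have "\<exists>q. \<forall>b f. b \<in> B \<and> f \<in> F \<longrightarrow> (\<forall>h. rpf (q b f h)) \<and> D b f = (\<lambda>x. \<Sum>h\<in>F. q b f h x * h x)"
    unfolding choice_iff .
  then obtain q where q0: "\<And>b f. b \<in> B \<Longrightarrow> f \<in> F \<Longrightarrow> (\<forall>h. rpf (q b f h)) \<and> D b f = (\<lambda>x. \<Sum>h\<in>F. q b f h x
    * h x)"
    by blast
  have q: "\<And>b f h. b \<in> B \<Longrightarrow> f \<in> F \<Longrightarrow> rpf (q b f h)"
    "\<And>b f x. b \<in> B \<Longrightarrow> f \<in> F \<Longrightarrow> D b f x = (\<Sum>h\<in>F. q b f h x * h x)"
    using q0 by simp_all
  have "g y \<in> V" if y: "y \<in> T" "y \<in> W" for y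
  proof -
    let ?y0 = "?F x0"
    have y0: "?y0 \<in> T" "?y0 \<in> W"
      using Fg[OF U(2)] x0(1) G(3) by (auto simp: T_def)
    define v where "v = y - ?y0"
    have v: "v $ b = 0" if "b \<notin> B" for b
      using y(1) y0(1) that by (simp add: v_def T_def)
    \<comment> \<open>The segment from the image of \<open>x0\<close> to \<open>y\<close> runs
      inside the coordinate plane \<open>T\<close>, so only derivatives with index in
      \<open>B\<close> occur along it, and these map the ideal to itself.\<close>
    define \<gamma> where "\<gamma> t = ?y0 + t *\<^sub>R v" for t
    have \<gamma>: "\<gamma> t \<in> W" if "t \<in> {0..1}" for t
    proof -
      have "\<gamma> t = (1 - t) *\<^sub>R ?y0 + t *\<^sub>R y"
        by (simp add: \<gamma>_def v_def algebra_simps)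
      then show ?thesis
        using convexD_alt[OF W(2) y0(2) y(2)] that by simp
    qed
    define c where "c f h t = (\<Sum>b\<in>B. v $ b * q b f h (g (\<gamma> t))) / ?\<delta> (g (\<gamma> t))" for f h t
    define u where "u f t = f (g (\<gamma> t))" for f :: "real ^ 'n \<Rightarrow> real" and t
    have cont: "continuous_on {0..1} (\<lambda>t. p (g (\<gamma> t)))" if "rpf p" for p
    proof -
      have "continuous_on W g"
        using hom by (simp add: homeomorphism_def)
      moreover have "continuous_on {0..1} \<gamma>"
        unfolding \<gamma>_def by (intro continuous_intros)
      moreover have "\<gamma> ` {0..1} \<subseteq> W"
        using \<gamma> by blast
      ultimately have "continuous_on {0..1} (\<lambda>t. g (\<gamma> t))"
        by (rule continuous_on_compose2)
      then show ?thesis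
        by (rule continuous_on_compose2[OF rpf_continuous_on[OF that, of UNIV] _ subset_UNIV])
    qed
    have "u f 1 = 0" if "f \<in> F" for f
    proof (rule linear_ode_zero[OF F(2), where c=c, OF _ _ _ that])
      show "u f 0 = 0" if "f \<in> F" for f
        using that F(1) x0(1) Fg(2)[OF U(2)] by (auto simp: u_def \<gamma>_def I_def)
      show "continuous_on {0..1} (c f h)" if "f \<in> F" "h \<in> F" for f h
        unfolding c_def
        using that q(1) U(3) gU(1) \<gamma>
        by (intro continuous_on_divide continuous_on_sum continuous_on_mult continuous_on_const cont
          rpf_jacobian_det G(1)) auto
      show "(u f has_real_derivative (\<Sum>h\<in>F. c f h t * u h t)) (at t)" if f: "f \<in> F" and t:
        "t \<in> {0..1}" for f t
      proof -
        let ?w = "g' (\<gamma> t) v"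
        have rf: "rpf f"
          using f F(1) by (auto simp: I_def)
        have "((\<lambda>t. \<gamma> t) has_derivative (\<lambda>s. s *\<^sub>R v)) (at t)"
          unfolding \<gamma>_def by (auto intro!: derivative_eq_intros)
        from has_derivative_compose[OF has_derivative_compose[OF this g[OF \<gamma>[OF t]]]
          rpf_has_derivative[OF rf]]
        have "(u f has_derivative (\<lambda>s. \<Sum>l\<in>UNIV. partial f l (g (\<gamma> t)) * g' (\<gamma> t) (s *\<^sub>R v) $ l)) (at t)"
          unfolding u_def .
        moreover have "linear (g' (\<gamma> t))"
          using g[OF \<gamma>[OF t]] by (rule has_derivative_linear)
        then have "(\<lambda>s. \<Sum>l\<in>UNIV. partial f l (g (\<gamma> t)) * g' (\<gamma> t) (s *\<^sub>R v) $ l)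
            = (*) (\<Sum>l\<in>UNIV. partial f l (g (\<gamma> t)) * ?w $ l)"
          by (intro ext) (simp add: linear_scale sum_distrib_left mult_ac)
        ultimately have "(u f has_real_derivative (\<Sum>l\<in>UNIV. partial f l (g (\<gamma> t)) * ?w $ l)) (at t)"
          by (simp add: has_field_derivative_def)
        also have "(\<Sum>l\<in>UNIV. partial f l (g (\<gamma> t)) * ?w $ l)
            = (\<Sum>b\<in>UNIV. v $ b * det (\<chi> i j. if i = b then partial f j (g (\<gamma> t)) else jacobian_matrix
              G (g (\<gamma> t)) $ i $ j)) / ?\<delta> (g (\<gamma> t))"
          using U(3) gU(1) \<gamma>[OF t] g' by (intro det_replace_row) auto
        also have "(\<lambda>b. det (\<chi> i j. if i = b then partial f j (g (\<gamma> t)) else jacobian_matrix G (g (\<gamma>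
          t)) $ i $ j)) = (\<lambda>b. D b f (g (\<gamma> t)))"
          unfolding D_def by (intro ext arg_cong[of _ _ det]) (simp add: vec_eq_iff)
        also have "(\<Sum>b\<in>UNIV. v $ b * D b f (g (\<gamma> t))) = (\<Sum>b\<in>B. v $ b * D b f (g (\<gamma> t)))"
          using v by (intro sum.mono_neutral_right) auto
        also have "\<dots> = (\<Sum>b\<in>B. v $ b * (\<Sum>h\<in>F. q b f h (g (\<gamma> t)) * u h t))"
          using f by (intro sum.cong refl) (simp add: q(2) u_def)
        also have "\<dots> / ?\<delta> (g (\<gamma> t)) = (\<Sum>h\<in>F. c f h t * u h t)"
          unfolding c_def sum_distrib_left sum_distrib_right sum_divide_distrib
          by (subst sum.swap) (simp add: mult.assoc)
        finally show ?thesis .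
      qed
    qed
    then have F0: "f (g y) = 0" if "f \<in> F" for f
      using that by (simp add: u_def \<gamma>_def v_def)
    have "p (g y) = 0" if "p \<in> P" for p
    proof -
      have "p \<in> I"
        using that P by (simp add: I_def)
      then have "p \<in> fun_ideal (Collect rpf) F"
        using F(3) by (rule subsetD[rotated])
      then show ?thesis
        by (rule fun_ideal_vanishes) (rule F0)
    qed
    then show ?thesis
      unfolding P(1) by simp
  qed
  note gV = this
  have "?F ` (?M \<inter> U) = T \<inter> W"
  proof
    show "?F ` (?M \<inter> U) \<subseteq> T \<inter> W"
      using Fg(1) G(3) by (auto simp: T_def)
    show "T \<inter> W \<subseteq> ?F ` (?M \<inter> U)"
    proof
      fix y assume "y \<in> T \<inter> W"
      then have "y = ?F (g y)" "g y \<in> V" "g y \<in> U"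
        using gV gU by auto
      then show "y \<in> ?F ` (?M \<inter> U)"
        using U(3) by (intro image_eqI[of _ _ "g y"]) auto
    qed
  qed
  moreover have "smooth_on ?F U"
    unfolding smooth_on_def by (intro allI C_k_on_polynomial) (simp add: G(1))
  ultimately show "\<exists>U V T. \<exists>(f :: real ^ 'n \<Rightarrow> real ^ 'n) g. open U \<and> x0 \<in> U \<and> open V \<and> homeomorphism
    U V f g \<and>
      smooth_on f U \<and> smooth_on g V \<and> subspace T \<and> dim T = card B \<and> f ` (?M \<inter> U) = T \<inter> V"
    using U(1,2) W(1) hom T by (intro exI[of _ U] exI[of _ W] exI[of _ T] exI[of _ ?F] exI[of _ g] conjI)
qed

theorem real_algebraic_stratification:
  fixes V :: "(real ^ 'n) set"
  assumes "real_algebraic V"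
  shows "\<exists>\<S>. finite \<S> \<and> disjoint \<S> \<and> \<Union>\<S> = V \<and>
    (\<forall>M\<in>\<S>. M \<noteq> {} \<and> semialgebraic M \<and> (\<exists>k. smooth_submanifold k M))"
  using wf_real_algebraic assms
proof (induction V rule: wf_induct_rule)
  case (less V)
  show ?case
  proof (cases "V = {}")
    case True
    then show ?thesis
      by (intro exI[of _ "{}"]) auto
  next
    case False
    obtain P where P: "\<forall>p\<in>P. rpf p" "V = {x. \<forall>p\<in>P. p x = 0}"
      using less.prems unfolding real_algebraic_def by blast
    \<comment> \<open>Outside \<open>B\<close> stand elements of the ideal with independent
      differentials at some point of \<open>V\<close>; the coordinates in \<open>B\<close> complete
      them to local coordinates. Least cardinality of \<open>B\<close> means maximal rank, and
      \<open>B = UNIV\<close>, with no equations at all, is admissible whenever \<open>V\<close> is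
      nonempty.\<close>
    define adm where "adm B G \<longleftrightarrow> (\<forall>i. rpf (G i)) \<and> (\<forall>i\<in>B. G i = (\<lambda>x. x $ i)) \<and>
      (\<forall>i. i \<notin> B \<longrightarrow> (\<forall>x\<in>V. G i x = 0)) \<and> (\<exists>x\<in>V. det (jacobian_matrix G x) \<noteq> 0)"
      for B :: "'n set" and G :: "'n \<Rightarrow> real ^ 'n \<Rightarrow> real"
    have "jacobian_matrix (\<lambda>i x. x $ i) x = mat 1" for x :: "real ^ 'n"
      by (simp add: vec_eq_iff partial_nth mat_def)
    then have "adm UNIV (\<lambda>i x. x $ i)"
      using False by (auto simp: adm_def)
    then have "\<exists>B. \<exists>G. adm B G"
      by blast
    then obtain B where "\<exists>G. adm B G" and least: "\<And>B'. \<exists>G. adm B' G \<Longrightarrow> card B \<le> card B'"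
      using ex_has_least_nat[of "\<lambda>B. \<exists>G. adm B G" _ card] by blast
    then obtain G where G: "adm B G"
      by blast
    let ?\<delta> = "\<lambda>x. det (jacobian_matrix G x)"
    have "smooth_submanifold (card B) (V \<inter> {x. ?\<delta> x \<noteq> 0})"
    proof (rule regular_stratum[OF P(2,1)])
      fix f b x assume f: "rpf f" "\<And>x. x \<in> V \<Longrightarrow> f x = 0" and b: "b \<in> B" and x: "x \<in> V"
      show "det (jacobian_matrix (G(b := f)) x) = 0"
      proof (rule ccontr)
        assume "det (jacobian_matrix (G(b := f)) x) \<noteq> 0"
        then have "adm (B - {b}) (G(b := f))"
          using G f x unfolding adm_def by auto
        then have "card B \<le> card (B - {b})"
          by (intro least) blast
        then show False
          using b by (metis card_Diff1_less finite not_le)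
      qed
    qed (use G in \<open>auto simp: adm_def\<close>)
    moreover have \<delta>: "rpf ?\<delta>"
      using G by (intro rpf_jacobian_det) (auto simp: adm_def)
    \<comment> \<open>Points of \<open>W\<close> need not be singular; all that the recursion asks
      is that \<open>W\<close> be algebraic and strictly smaller than \<open>V\<close>.\<close>
    define M W where "M = V \<inter> {x. ?\<delta> x \<noteq> 0}" and "W = {x \<in> V. ?\<delta> x = 0}"
    have "M \<noteq> {}"
      using G by (auto simp: adm_def M_def)
    have "M = V \<inter> - {x. ?\<delta> x = 0}"
      by (auto simp: M_def)
    then have "semialgebraic M"
      using semialgebraic.inter[OF semialgebraic_real_algebraic[OF less.prems]
          semialgebraic.compl[OF semialgebraic_zero[OF \<delta>]]] by simp
    have "W = {x. \<forall>p\<in>insert ?\<delta> P. p x = 0}"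
      by (auto simp: W_def P(2))
    then have W: "real_algebraic W"
      unfolding real_algebraic_def using P(1) \<delta> by (intro exI[of _ "insert ?\<delta> P"]) auto
    moreover have "W \<subset> V"
      using \<open>M \<noteq> {}\<close> by (auto simp: W_def M_def)
    ultimately obtain \<S> where S: "finite \<S>" "disjoint \<S>" "\<Union>\<S> = W"
        "\<forall>M\<in>\<S>. M \<noteq> {} \<and> semialgebraic M \<and> (\<exists>k. smooth_submanifold k M)"
      using less.IH[of W] by auto
    have "M \<inter> W = {}" "M \<union> W = V"
      by (auto simp: M_def W_def)
    have "disjoint (insert M \<S>)"
      using S(2,3) \<open>M \<inter> W = {}\<close> by (auto simp: disjoint_def)
    moreover have "smooth_submanifold (card B) M"
      unfolding M_def by fact
    ultimately show ?thesis
      using S \<open>semialgebraic M\<close> \<open>M \<noteq> {}\<close> \<open>M \<union> W = V\<close>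
      by (intro exI[of _ "insert M \<S>"]) auto
  qed
qed

section \<open>Sets of codimension two\<close>

lemma rpf_zero_on_open:
  fixes p :: "real ^ 'n \<Rightarrow> real"
  assumes p: "rpf p" and U: "open U" "x0 \<in> U" and zero: "\<And>x. x \<in> U \<Longrightarrow> p x = 0"
  shows "p y = 0"
proof -
  let ?l = "\<lambda>t :: real. x0 + t *\<^sub>R (y - x0)"
  have "polynomial_function ?l"
    by (intro polynomial_function_add polynomial_function_const polynomial_function_bounded_linear
        bounded_linear_scaleR_left)
  then have "rpf (p \<circ> ?l)"
    using p by (rule real_polynomial_function_compose)
  then obtain a n where an: "p \<circ> ?l = (\<lambda>t. \<Sum>i\<le>n. a i * t ^ i)"
    using real_polynomial_function_imp_sum by blast
  have "continuous_on UNIV ?l"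
    by (intro continuous_intros)
  then have "open (?l -` U)"
    using U(1) by (simp add: open_vimage)
  moreover have "0 \<in> ?l -` U"
    using U(2) by simp
  ultimately obtain e where e: "e > 0" "ball 0 e \<subseteq> ?l -` U"
    by (rule openE)
  then have "{0<..<e} \<subseteq> ?l -` U"
    by (auto simp: ball_def)
  then have "infinite (?l -` U)"
    using infinite_Ioo[OF e(1)] infinite_super by blast
  moreover have "?l -` U \<subseteq> {t. (\<Sum>i\<le>n. a i * t ^ i) = 0}"
    using zero fun_cong[OF an, symmetric] by auto
  ultimately have "infinite {t. (\<Sum>i\<le>n. a i * t ^ i) = 0}"
    by (meson finite_subset)
  then have "\<forall>i\<le>n. a i = 0"
    using polyfun_roots_finite[of a _ n] by blast
  then have "(p \<circ> ?l) 1 = 0"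
    unfolding an by simp
  then show ?thesis
    by simp
qed

lemma smooth_on_differentiable:
  assumes "smooth_on f U" "x \<in> U"
  shows "f differentiable (at x)"
proof -
  have "C_k_on (Suc 0) f U"
    using assms(1)[unfolded smooth_on_def, THEN spec[of _ "Suc 0"]] .
  then have "\<forall>x\<in>U. f differentiable (at x)"
    unfolding C_k_on.simps(2) by (rule conjunct1)
  then show ?thesis
    using assms(2) by (rule bspec)
qed

lemma submanifold_chart:
  fixes M :: "'a::euclidean_space set"
  assumes "smooth_submanifold k M" "x \<in> M"
  obtains U V T f g where "open U" "x \<in> U" "open V" "homeomorphism U V f (g :: 'a \<Rightarrow> 'a)" "smooth_on f U"
    "smooth_on g V" "subspace T" "dim T = k" "f ` (M \<inter> U) = T \<inter> V"
  using assms(1)[unfolded smooth_submanifold_def, THEN bspec, OF assms(2)]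
  by (elim exE conjE) (rule that)

lemma negligible_submanifold:
  fixes M :: "'a::euclidean_space set"
  assumes "smooth_submanifold k M" "k < DIM('a)"
  shows "negligible M"
proof (rule locally_negligible_alt[THEN iffD2], rule ballI)
  fix x assume "x \<in> M"
  with assms(1) obtain U V T f g where U: "open U" "x \<in> U" "open V" "homeomorphism U V f (g :: 'a \<Rightarrow> 'a)"
      "smooth_on f U" "smooth_on g V" and T: "subspace T" "dim T = k" "f ` (M \<inter> U) = T \<inter> V"
    by (rule submanifold_chart)
  have "negligible (T \<inter> V)"
    using negligible_lowdim[of T] T(2) assms(2) negligible_subset by (metis inf_le1)
  moreover have "g differentiable_on (T \<inter> V)"
    using smooth_on_differentiable[OF U(6)]
    by (auto simp: differentiable_on_def intro: differentiable_at_withinI)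
  ultimately have "negligible (g ` (T \<inter> V))"
    by (rule negligible_differentiable_image_negligible[OF order_refl])
  moreover have "g ` (T \<inter> V) = M \<inter> U"
  proof -
    have "g (f z) = z" if "z \<in> U" for z
      using homeomorphism_apply1[OF U(4) that] .
    then show ?thesis
      unfolding T(3)[symmetric] by (force simp: image_iff)
  qed
  ultimately show "\<exists>W. openin (top_of_set M) W \<and> x \<in> W \<and> negligible W"
    using U(1,2) \<open>x \<in> M\<close> by (intro exI[of _ "M \<inter> U"]) auto
qed

lemma full_submanifold_open:
  fixes M :: "'a::euclidean_space set"
  assumes "smooth_submanifold DIM('a) M" "x \<in> M"
  obtains U where "open U" "x \<in> U" "U \<subseteq> M"
proof -
  from assms obtain U V T f g where U: "open U" "x \<in> U" "open V" "homeomorphism U V f (g :: 'a \<Rightarrow> 'a)"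
      "smooth_on f U" "smooth_on g V" and T: "subspace T" "dim T = DIM('a)" "f ` (M \<inter> U) = T \<inter> V"
    by (rule submanifold_chart)
  have "T = UNIV"
    using T(1,2) by (metis dim_eq_full span_eq_iff)
  have "U \<subseteq> M"
  proof
    fix z assume "z \<in> U"
    then have "f z \<in> f ` (M \<inter> U)"
      using U(4) unfolding T(3) \<open>T = UNIV\<close> by (auto simp: homeomorphism_def)
    then obtain z' where "z' \<in> M" "z' \<in> U" "f z' = f z"
      by auto
    then show "z \<in> M"
      using \<open>z \<in> U\<close> homeomorphism_apply1[OF U(4)] by metis
  qed
  then show ?thesis
    using that U(1,2) by blast
qed

lemma submanifold_dim_le:
  fixes M :: "'a::euclidean_space set"
  assumes "smooth_submanifold k M" "M \<noteq> {}"
  shows "k \<le> DIM('a)"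
proof -
  obtain x where "x \<in> M"
    using assms(2) by blast
  with assms(1) obtain U V T f g where "open U" "x \<in> U" "open V" "homeomorphism U V f (g :: 'a \<Rightarrow> 'a)"
      "smooth_on f U" "smooth_on g V" "subspace T" "dim T = k" "f ` (M \<inter> U) = T \<inter> V"
    by (rule submanifold_chart)
  then show ?thesis
    using dim_subset_UNIV[of T] by simp
qed

text \<open>A by-product of the stratification: strata of lower dimension are null, and one of full
  dimension would contain an open set on which \<open>p\<close> vanishes, forcing
  \<open>p = 0\<close>.\<close>

lemma negligible_zero_set:
  fixes p :: "real ^ 'n \<Rightarrow> real"
  assumes p: "rpf p" "p z \<noteq> 0"
  shows "negligible {x. p x = 0}"
proof -
  have "real_algebraic {x. p x = 0}"
    unfolding real_algebraic_def using p(1) by (intro exI[of _ "{p}"]) auto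
  then obtain \<S> where S: "finite \<S>" "\<Union>\<S> = {x. p x = 0}"
    "\<And>M. M \<in> \<S> \<Longrightarrow> M \<noteq> {} \<and> (\<exists>k. smooth_submanifold k M)"
    using real_algebraic_stratification by metis
  have "negligible M" if M: "M \<in> \<S>" for M
  proof -
    obtain k x where k: "smooth_submanifold k M" and x: "x \<in> M"
      using S(3)[OF M] by blast
    have "k < DIM(real ^ 'n)"
    proof (rule ccontr)
      assume "\<not> ?thesis"
      then have "k = DIM(real ^ 'n)"
        using submanifold_dim_le[OF k] x by fastforce
      then obtain U where "open U" "x \<in> U" "U \<subseteq> M"
        using full_submanifold_open k x by blast
      then have "p z = 0"
        using rpf_zero_on_open[OF p(1), of U x z] S(2) M by blast
      then show False
        using p(2) by simp
    qed
    then show ?thesis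
      using negligible_submanifold k by blast
  qed
  then show ?thesis
    using S(1,2) negligible_Union by metis
qed

text \<open>
  Sets of codimension at least two: a differentiable family with one further real parameter does not
  sweep out a set of positive measure. No dimension theory is needed to check this property for the
  sets below, and it is exactly what is used about them.
\<close>

definition thin :: "'a::euclidean_space set \<Rightarrow> bool" where
  "thin E \<longleftrightarrow> (\<forall>(h :: 'a \<times> real \<Rightarrow> 'a) U. open U \<longrightarrow> (\<forall>z\<in>U \<times> UNIV. h differentiable (at z)) \<longrightarrow>
     negligible (h ` ((E \<inter> U) \<times> UNIV)))"

lemma thin_subset: "thin F \<Longrightarrow> E \<subseteq> F \<Longrightarrow> thin E"
  unfolding thin_def by (meson Int_mono Sigma_mono image_mono negligible_subset order_refl)

lemma thin_Un: "thin E \<Longrightarrow> thin F \<Longrightarrow> thin (E \<union> F)"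
  unfolding thin_def by (simp add: Int_Un_distrib2 Sigma_Un_distrib1 image_Un)

lemma thin_negligible:
  assumes "thin E"
  shows "negligible E"
proof -
  have "negligible (fst ` ((E \<inter> UNIV) \<times> (UNIV :: real set)))"
    by (rule assms[unfolded thin_def, rule_format, OF open_UNIV])
      (intro bounded_linear_imp_differentiable bounded_linear_fst)
  then show ?thesis
    by simp
qed

text \<open>The cone with apex \<open>a\<close> contains every \<open>w\<close> for which the
  segment from \<open>a\<close> to \<open>w\<close> meets \<open>E\<close> away from
  \<open>a\<close>.\<close>

lemma thin_cone:
  assumes "thin E"
  shows "negligible {a + s *\<^sub>R (x - a) |x s. x \<in> E}"
proof -
  have "negligible ((\<lambda>z. a + snd z *\<^sub>R (fst z - a)) ` ((E \<inter> UNIV) \<times> UNIV))"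
    by (rule assms[unfolded thin_def, rule_format, OF open_UNIV])
      (intro differentiable_add differentiable_scaleR differentiable_diff differentiable_const
        bounded_linear_imp_differentiable bounded_linear_fst bounded_linear_snd)
  moreover have "(\<lambda>z. a + snd z *\<^sub>R (fst z - a)) ` ((E \<inter> UNIV) \<times> UNIV) = {a + s *\<^sub>R (x - a) |x s. x \<in> E}"
    by (auto simp: image_iff) force
  ultimately show ?thesis
    by simp
qed

text \<open>Full dimension is excluded because thin sets are null. In codimension one, the chart
  \<open>f\<close> plus multiples of a vector \<open>\<nu>\<close> normal to \<open>T\<close> is an
  admissible family in the definition of \<open>thin\<close>, and it would cover a ball.\<close>

lemma thin_submanifold:
  fixes M :: "'a::euclidean_space set"
  assumes "thin E" "M \<subseteq> E" "M \<noteq> {}" "smooth_submanifold k M"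
  shows "k + 2 \<le> DIM('a)"
proof (rule ccontr)
  assume "\<not> k + 2 \<le> DIM('a)"
  moreover have "k \<noteq> DIM('a)"
    using thin_negligible[OF assms(1)] assms(2-4) full_submanifold_open[of M]
    by (metis ex_in_conv negligible_subset open_not_negligible)
  ultimately have k: "k + 1 = DIM('a)"
    using submanifold_dim_le[OF assms(4,3)] by simp
  obtain x where "x \<in> M"
    using assms(3) by blast
  with assms(4) obtain U V T f g where U: "open U" "x \<in> U" "open V" "homeomorphism U V f (g :: 'a \<Rightarrow> 'a)"
      "smooth_on f U" "smooth_on g V" and T: "subspace T" "dim T = k" "f ` (M \<inter> U) = T \<inter> V"
    by (rule submanifold_chart)
  obtain \<nu> where \<nu>: "\<nu> \<noteq> 0" "\<And>t. t \<in> T \<Longrightarrow> orthogonal \<nu> t"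
    using orthogonal_to_subspace_exists[of T] T(1,2) k by (metis Suc_eq_plus1 lessI span_eq_iff)
  have "\<nu> \<notin> span T"
    using \<nu> T(1) by (metis orthogonal_self span_eq_iff)
  then have "span (insert \<nu> T) = UNIV"
    using T(2) k by (simp add: dim_insert flip: dim_eq_full)
  let ?h = "\<lambda>z. f (fst z) + snd z *\<^sub>R \<nu>"
  have "?h differentiable (at z)" if "z \<in> U \<times> UNIV" for z
  proof -
    have "f differentiable (at (fst z))"
      using smooth_on_differentiable[OF U(5)] that by auto
    then have "(\<lambda>z. f (fst z)) differentiable (at z)"
      by (rule differentiable_compose) (intro bounded_linear_imp_differentiable bounded_linear_fst)
    then show ?thesis
      by (intro differentiable_add differentiable_scaleR differentiable_const
          bounded_linear_imp_differentiable[OF bounded_linear_snd])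
  qed
  then have neg: "negligible (?h ` ((E \<inter> U) \<times> UNIV))"
    using assms(1) U(1) unfolding thin_def by blast
  have fx: "f x \<in> T \<inter> V"
    using T(3) U(2) \<open>x \<in> M\<close> by blast
  then obtain r where r: "r > 0" "ball (f x) r \<subseteq> V"
    using U(3) openE by blast
  have "ball (f x) r \<subseteq> ?h ` ((E \<inter> U) \<times> UNIV)"
  proof
    fix y assume y: "y \<in> ball (f x) r"
    have "y - f x \<in> span (insert \<nu> T)"
      unfolding \<open>span (insert \<nu> T) = UNIV\<close> by simp
    then obtain s where "y - f x - s *\<^sub>R \<nu> \<in> span T"
      using span_insert by blast
    then have t: "y - f x - s *\<^sub>R \<nu> \<in> T"
      using T(1) by (metis span_eq_iff)
    let ?t = "y - f x - s *\<^sub>R \<nu>"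
    \<comment> \<open>The component in \<open>T\<close> is an orthogonal projection and hence no
      longer than \<open>y - f x\<close>, so its foot stays in the ball and therefore in the image
      of the chart.\<close>
    have "orthogonal ?t (s *\<^sub>R \<nu>)"
      using \<nu>(2)[OF t] by (simp add: orthogonal_clauses orthogonal_commute)
    from norm_add_Pythagorean[OF this] have "(norm ?t)\<^sup>2 \<le> (norm (y - f x))\<^sup>2"
      by simp
    then have "norm ?t \<le> norm (y - f x)"
      by (rule power2_le_imp_le) simp
    moreover have "dist (f x) (f x + ?t) = norm ?t"
      unfolding dist_norm by (metis add_diff_cancel_left' norm_minus_commute)
    moreover have "norm (y - f x) < r"
      using y by (simp add: dist_norm norm_minus_commute)
    ultimately have "f x + ?t \<in> ball (f x) r"
      by (simp only: mem_ball)
    then have "f x + ?t \<in> T \<inter> V"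
      using r fx t T(1) subspace_add by blast
    then obtain z where "z \<in> M" "z \<in> U" "f z = f x + ?t"
      unfolding T(3)[symmetric] by auto
    then show "y \<in> ?h ` ((E \<inter> U) \<times> UNIV)"
      using assms(2) by (intro image_eqI[of _ _ "(z, s)"]) auto
  qed
  then have "negligible (ball (f x) r)"
    using neg negligible_subset by blast
  then show False
    using r(1) by (metis centre_in_ball empty_iff open_ball open_not_negligible)
qed

text \<open>
  The coordinate \<open>i\<close> does not influence \<open>\<psi>\<close> and serves as the additional parameter in the definition
  of thinness.
\<close>

lemma thin_polynomial_image:
  fixes \<psi> :: "real ^ 'n \<Rightarrow> real ^ 'n"
  assumes \<psi>: "polynomial_function \<psi>" and q: "rpf q" "q z \<noteq> 0"
    and E: "\<And>x s. x \<in> E \<Longrightarrow> \<exists>y. y $ i = s \<and> \<psi> y = x \<and> q y = 0"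
  shows "thin E"
  unfolding thin_def
proof (intro allI impI)
  fix h :: "(real ^ 'n) \<times> real \<Rightarrow> real ^ 'n" and U
  assume U: "open U" and h: "\<forall>z\<in>U \<times> UNIV. h differentiable (at z)"
  let ?H = "\<lambda>y. h (\<psi> y, y $ i)" and ?S = "{y. q y = 0} \<inter> \<psi> -` U"
  have "negligible ?S"
    using negligible_zero_set[OF q] by (rule negligible_subset) simp
  moreover have "?H differentiable_on ?S"
    unfolding differentiable_on_def
  proof
    fix y assume "y \<in> ?S"
    have "h differentiable (at (\<psi> y, y $ i))"
      using h \<open>y \<in> ?S\<close> by auto
    moreover have "(\<lambda>y. (\<psi> y, y $ i)) differentiable (at y)"
    proof -
      obtain \<psi>' where "(\<psi> has_derivative \<psi>') (at y)"
        using differentiable_at_polynomial_function[OF \<psi>, of y UNIV] unfolding differentiable_def by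
          blast
      moreover have "((\<lambda>y. y $ i) has_derivative (\<lambda>y. y $ i)) (at y)"
        by (intro bounded_linear_imp_has_derivative bounded_linear_vec_nth)
      ultimately show ?thesis
        unfolding differentiable_def using has_derivative_Pair by blast
    qed
    ultimately have "?H differentiable (at y)"
      using differentiable_chain_at[of "\<lambda>y. (\<psi> y, y $ i)" y h] by (simp add: o_def)
    then show "?H differentiable (at y within ?S)"
      by (rule differentiable_at_withinI)
  qed
  ultimately have "negligible (?H ` ?S)"
    by (rule negligible_differentiable_image_negligible[OF order_refl])
  moreover have "h ` ((E \<inter> U) \<times> UNIV) \<subseteq> ?H ` ?S"
  proof
    fix w assume "w \<in> h ` ((E \<inter> U) \<times> UNIV)"
    then obtain x s where "x \<in> E" "x \<in> U" "w = h (x, s)"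
      by auto
    then show "w \<in> ?H ` ?S"
      using E[of x s] by (auto simp: image_iff)
  qed
  ultimately show "negligible (h ` ((E \<inter> U) \<times> UNIV))"
    by (rule negligible_subset)
qed

section \<open>The exceptional set is algebraic\<close>

lemma span_full_iff_det:
  fixes v :: "'k \<Rightarrow> real ^ 'n"
  shows "span (range v) = UNIV \<longleftrightarrow> (\<exists>w. det (\<chi> i. v (w i)) \<noteq> 0)"
proof
  assume sp: "span (range v) = UNIV"
  obtain B where B: "B \<subseteq> range v" "independent B" "range v \<subseteq> span B"
    using maximal_independent_subset by blast
  have "span B = UNIV"
    using B(3) sp span_minimal[OF _ subspace_span] by blast
  then have "card B = CARD('n)"
    using B(2) by (metis DIM_cart DIM_real dim_UNIV dim_span_eq_card_independent dim_span
      mult.right_neutral)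
  then obtain e :: "'n \<Rightarrow> real ^ 'n" where e: "bij_betw e UNIV B"
    using finiteI_independent[OF B(2)] by (metis finite finite_same_card_bij)
  have "\<forall>i. \<exists>k. v k = e i"
    using B(1) bij_betwE[OF e] by (metis UNIV_I imageE subsetD)
  then obtain w where w: "\<And>i. v (w i) = e i"
    by metis
  have "rows (\<chi> i. v (w i)) = B"
    using e by (auto simp: rows_def row_def w bij_betw_def vec_lambda_eta)
  then have "det (\<chi> i. v (w i)) \<noteq> 0"
    using matrix_left_invertible_span_rows[of "\<chi> i. v (w i)"] \<open>span B = UNIV\<close>
    by (metis invertible_det_nz invertible_left_inverse)
  then show "\<exists>w. det (\<chi> i. v (w i)) \<noteq> 0"
    by blast
next
  assume "\<exists>w. det (\<chi> i. v (w i)) \<noteq> 0"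
  then obtain w where w: "det (\<chi> i. v (w i)) \<noteq> 0"
    by blast
  then have "span (rows (\<chi> i. v (w i))) = UNIV"
    using matrix_left_invertible_span_rows[of
      "\<chi> i. v (w i)"] invertible_det_nz invertible_left_inverse by blast
  moreover have "rows (\<chi> i. v (w i)) \<subseteq> range v"
    by (auto simp: rows_def row_def vec_lambda_eta)
  ultimately show "span (range v) = UNIV"
    using span_mono by blast
qed

text \<open>The equations are all determinants of \<open>n\<close>-member selections. The index type
  may be infinite, since \<open>real_algebraic\<close> admits arbitrarily many polynomials; this
  allows all bracket words at once.\<close>

lemma real_algebraic_span_not_full:
  fixes v :: "'k \<Rightarrow> real ^ 'm \<Rightarrow> real ^ 'n"
  assumes "\<And>k i. rpf (\<lambda>x. v k x $ i)"
  shows "real_algebraic {x. span (range (\<lambda>k. v k x)) \<noteq> UNIV}"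
proof -
  have "rpf (\<lambda>x. det (\<chi> i. v (w i) x))" for w :: "'n \<Rightarrow> 'k"
    by (rule rpf_det) (simp add: assms)
  then show ?thesis
    unfolding real_algebraic_def
    by (intro exI[of _ "range (\<lambda>w x. det (\<chi> i. v (w i) x))"]) (auto simp: span_full_iff_det)
qed

datatype word = Gen1 | Gen2 | Br word word

primrec word_eval :: "oct_endo \<Rightarrow> oct_endo \<Rightarrow> word \<Rightarrow> oct_endo" where
  "word_eval X Y Gen1 = X"
| "word_eval X Y Gen2 = Y"
| "word_eval X Y (Br v w) = lie_bracket (word_eval X Y v) (word_eval X Y w)"

lemma bilinear_lie_bracket: "bilinear lie_bracket"
  unfolding bilinear_def lie_bracket_def
  by (auto intro!: linearI simp: matrix_add_ldistrib matrix_add_right matrix_scaleR_left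
    matrix_scaleR_right scaleR_diff_right)

text \<open>Words include all parenthesizations, so the bracket of two words is a word and
  bilinearity closes their span under the bracket.\<close>

lemma L_gen_eq_span:
  assumes Z: "Z \<in> g2"
  shows "L_gen Z = span (range (word_eval Z (S_mat ** Z ** S_mat)))"
proof -
  let ?Y = "S_mat ** Z ** S_mat"
  let ?W = "range (word_eval Z ?Y)"
  have Y: "?Y \<in> g2"
    using involution_conj_g2[OF S_mat_automorphism S_mat_involution Z] .
  have W: "word_eval Z ?Y w \<in> g2" for w
    by (induction w) (simp_all add: Z Y lie_bracket_g2)
  have br: "lie_bracket X X' \<in> span ?W" if "X \<in> span ?W" "X' \<in> span ?W" for X X'
  proof -
    interpret bounded_bilinear lie_bracket
      using bilinear_lie_bracket by (simp add: bilinear_conv_bounded_bilinear)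
    have 1: "lie_bracket X (word_eval Z ?Y w) \<in> span ?W" if "X \<in> span ?W" for X w
      using that
    proof (induction rule: span_induct_alt)
      case (step c x y)
      then obtain u where "x = word_eval Z ?Y u"
        by auto
      then have "lie_bracket x (word_eval Z ?Y w) \<in> ?W"
        using word_eval.simps(3)[of Z ?Y u w] by (metis rangeI)
      then show ?case
        using step.IH by (simp add: add_left scaleR_left span_add span_scale span_base)
    qed (simp add: zero_left span_zero)
    show ?thesis
      using that(2)
    proof (induction rule: span_induct_alt)
      case (step c x y)
      then show ?case
        using 1[OF that(1)] by (auto simp: add_right scaleR_right intro!: span_add span_scale)
    qed (simp add: zero_right span_zero)
  qed
  have "lie_subalgebra (span ?W) g2"
    unfolding lie_subalgebra_def
  proof (intro conjI ballI)
    show "span ?W \<subseteq> g2"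
      using W by (intro span_minimal[OF _ subspace_g2] image_subsetI)
  qed (rule subspace_span, rule br)
  moreover have "Z \<in> span ?W" "?Y \<in> span ?W"
    using span_base[OF rangeI, of "word_eval Z ?Y" Gen1] span_base[OF rangeI, of
      "word_eval Z ?Y" Gen2] by simp_all
  ultimately have le: "L_gen Z \<subseteq> span ?W"
    unfolding L_gen_def matrix_inv_S_mat by (intro Inter_lower) simp
  have "span ?W \<subseteq> L" if "lie_subalgebra L g2" "Z \<in> L" "?Y \<in> L" for L
  proof (rule span_minimal)
    have "word_eval Z ?Y w \<in> L" for w
    proof (induction w)
      case (Br v w)
      then show ?case
        using that(1) unfolding lie_subalgebra_def by simp
    qed (use that in simp_all)
    then show "?W \<subseteq> L"
      by (intro image_subsetI)
    show "subspace L"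
      using that(1) by (simp add: lie_subalgebra_def)
  qed
  then have "span ?W \<subseteq> L_gen Z"
    unfolding L_gen_def matrix_inv_S_mat by (intro Inter_greatest) simp
  with le show ?thesis
    by (rule equalityI)
qed

lemma subspace_eq_iff_span_complement:
  fixes L G :: "'a::euclidean_space set"
  assumes "subspace L" "subspace G" "L \<subseteq> G"
  shows "L = G \<longleftrightarrow> span (L \<union> {y. \<forall>x\<in>G. orthogonal y x}) = UNIV"
proof
  assume "L = G"
  show "span (L \<union> {y. \<forall>x\<in>G. orthogonal y x}) = UNIV"
  proof (intro equalityI subset_UNIV subsetI)
    fix x :: 'a
    obtain y z where "y \<in> span G" "\<And>w. w \<in> span G \<Longrightarrow> orthogonal z w" "x = y + z"
      using orthogonal_subspace_decomp_exists[of G x] by blast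
    then have "y \<in> L" "z \<in> {y. \<forall>x\<in>G. orthogonal y x}" "x = y + z"
      using \<open>L = G\<close> assms(2) span_base by (auto simp: span_eq_iff[THEN iffD2])
    then show "x \<in> span (L \<union> {y. \<forall>x\<in>G. orthogonal y x})"
      by (auto intro!: span_add intro: span_base)
  qed
next
  let ?C = "{y. \<forall>x\<in>G. orthogonal y x}"
  assume full: "span (L \<union> ?C) = UNIV"
  have C: "subspace ?C"
    by (auto simp: subspace_def orthogonal_clauses)
  show "L = G"
  proof (intro equalityI assms(3) subsetI)
    fix x assume x: "x \<in> G"
    have "x \<in> {l + c |l c. l \<in> span L \<and> c \<in> span ?C}"
      using full by (simp flip: span_Un)
    then obtain l c where lc: "l \<in> L" "c \<in> ?C" "x = l + c"
      using assms(1) C by (auto simp: span_eq_iff[THEN iffD2])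
    then have "c \<in> G"
      using subspace_diff[OF assms(2) x, of l] assms(3) by auto
    then have "orthogonal c c"
      using lc(2) by blast
    then show "x \<in> L"
      using lc by (simp add: orthogonal_self)
  qed
qed

text \<open>The determinant criterion speaks about vectors with real entries, so the nested vectors
  that represent matrices are reindexed by pairs.\<close>

definition flat :: "oct_endo \<Rightarrow> real ^ (8 \<times> 8)" where
  "flat Z = (\<chi> p. Z $ fst p $ snd p)"

lemma linear_flat: "linear flat"
  by (intro linearI) (simp_all add: flat_def vec_eq_iff)

lemma bij_flat: "bij flat"
proof (rule bijI)
  show "inj flat"
    by (rule injI) (auto simp: flat_def vec_eq_iff)
  show "surj flat"
  proof (rule surjI)
    show "flat (\<chi> i j. y $ (i, j)) = y" for y
      by (simp add: flat_def vec_eq_iff)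
  qed
qed

lemma span_flat_full: "span (flat ` X) = UNIV \<longleftrightarrow> span X = UNIV"
  by (metis bij_flat bij_is_inj bij_is_surj inj_image_eq_iff linear_flat linear_span_image)

lemma range_case_sum: "range (\<lambda>k. case k of Inl x \<Rightarrow> f x | Inr y \<Rightarrow> g y) = range f \<union> range g"
proof (intro equalityI subsetI)
  fix z assume "z \<in> range f \<union> range g"
  then show "z \<in> range (\<lambda>k. case k of Inl x \<Rightarrow> f x | Inr y \<Rightarrow> g y)"
  proof (elim UnE rangeE)
    show "z \<in> range (\<lambda>k. case k of Inl x \<Rightarrow> f x | Inr y \<Rightarrow> g y)" if "z = f x" for x
      using that by (intro range_eqI[of _ _ "Inl x"]) simp
    show "z \<in> range (\<lambda>k. case k of Inl x \<Rightarrow> f x | Inr y \<Rightarrow> g y)" if "z = g y" for y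
      using that by (intro range_eqI[of _ _ "Inr y"]) simp
  qed
qed (auto split: sum.splits)

text \<open>
  Adding the orthogonal complement of \<open>g2\<close> to the bracket words turns \<open>L_gen Z = g2\<close> into a
  statement about spanning the whole space of matrices, which needs no basis of \<open>g2\<close>.
\<close>

lemma real_algebraic_N:
  fixes \<phi> :: "real ^ 'm \<Rightarrow> oct_endo"
  assumes \<phi>: "linear \<phi>" "range \<phi> \<subseteq> k_A"
  shows "real_algebraic (\<phi> -` N_set)"
proof -
  define C where "C = {y. \<forall>x\<in>g2. orthogonal y x}"
  \<comment> \<open>The index \<open>Inr y\<close> runs over all matrices; those outside
    \<open>C\<close> contribute the harmless value \<open>0\<close>, so that the index set is a
    whole type.\<close>
  define v where "v k x = flat (case k of Inl w \<Rightarrow> word_eval (\<phi> x) (S_mat ** \<phi> x ** S_mat) w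
      | Inr y \<Rightarrow> if y \<in> C then y else 0)" for k x
  have g2: "\<phi> x \<in> g2" for x
    using \<phi>(2) by (auto simp: k_A_def)
  have "\<phi> x \<in> N_set \<longleftrightarrow> span (range (\<lambda>k. v k x)) \<noteq> UNIV" for x
  proof -
    let ?W = "range (word_eval (\<phi> x) (S_mat ** \<phi> x ** S_mat))"
    let ?g = "\<lambda>y. if y \<in> C then y else 0"
    have "(0 :: oct_endo) \<in> C"
      by (simp add: C_def orthogonal_clauses)
    then have "range ?g = C"
      by auto
    moreover have "range (\<lambda>k. v k x) = flat ` range (\<lambda>k. case k of Inl w \<Rightarrow> word_eval (\<phi> x) (S_mat **
      \<phi> x ** S_mat) w
        | Inr y \<Rightarrow> ?g y)"
      by (simp only: v_def image_image)
    ultimately have "range (\<lambda>k. v k x) = flat ` (?W \<union> C)"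
      by (simp only: range_case_sum)
    moreover have "span (?W \<union> C) = span (span ?W \<union> C)"
      by (simp only: span_Un span_span)
    moreover have "L_gen (\<phi> x) = g2 \<longleftrightarrow> span (span ?W \<union> C) = UNIV"
      unfolding L_gen_eq_span[OF g2] C_def
    proof (rule subspace_eq_iff_span_complement[OF subspace_span subspace_g2])
      have "word_eval (\<phi> x) (S_mat ** \<phi> x ** S_mat) w \<in> g2" for w
        by (induction w)
          (simp_all add: g2 lie_bracket_g2 involution_conj_g2[OF S_mat_automorphism S_mat_involution])
      then show "span ?W \<subseteq> g2"
        by (intro span_minimal subspace_g2) blast
    qed
    ultimately show ?thesis
      using \<phi>(2) by (auto simp: N_set_def span_flat_full)
  qed
  then have "\<phi> -` N_set = {x. span (range (\<lambda>k. v k x)) \<noteq> UNIV}"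
    by auto
  moreover have "real_algebraic {x. span (range (\<lambda>k. v k x)) \<noteq> UNIV}"
  proof (rule real_algebraic_span_not_full)
    have 1: "rpf (\<lambda>x. \<phi> x $ i $ j)" for i j
    proof (rule real_polynomial_function.intros(1))
      have "bounded_linear \<phi>"
        using \<phi>(1) by (rule linear_conv_bounded_linear[THEN iffD1])
      then show "bounded_linear (\<lambda>x. \<phi> x $ i $ j)"
        by (intro bounded_linear_compose[OF bounded_linear_vec_nth] bounded_linear_compose[OF
          bounded_linear_vec_nth])
    qed
    have prod: "rpf (\<lambda>x. (X x ** Y x) $ i $ j)" if "\<And>i j. rpf (\<lambda>x. X x $ i $ j)"
      "\<And>i j. rpf (\<lambda>x. Y x $ i $ j)"
      for X Y :: "real ^ 'm \<Rightarrow> oct_endo" and i j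
      unfolding matrix_matrix_mult_def vec_lambda_beta
      by (intro real_polynomial_function_sum finite real_polynomial_function.intros(4) that)
    have 2: "rpf (\<lambda>x. word_eval (\<phi> x) (S_mat ** \<phi> x ** S_mat) w $ i $ j)" for w i j
    proof (induction w arbitrary: i j)
      case Gen1
      then show ?case
        by (simp add: 1)
    next
      case Gen2
      have "rpf (\<lambda>x. (S_mat ** \<phi> x ** S_mat) $ i $ j)"
        by (intro prod 1 real_polynomial_function.intros(2))
      then show ?case
        by simp
    next
      case (Br v w)
      have "rpf (\<lambda>x. (word_eval (\<phi> x) (S_mat ** \<phi> x ** S_mat) v ** word_eval (\<phi> x) (S_mat ** \<phi> x **
        S_mat) w) $ i $ j
          - (word_eval (\<phi> x) (S_mat ** \<phi> x ** S_mat) w ** word_eval (\<phi> x) (S_mat ** \<phi> x ** S_mat) v)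
            $ i $ j)"
        by (intro real_polynomial_function_diff prod Br.IH)
      then show ?case
        by (simp add: lie_bracket_def)
    qed
    show "rpf (\<lambda>x. v k x $ p)" for k p
      by (cases k) (auto simp: v_def flat_def 2 real_polynomial_function.intros(2))
  qed
  ultimately show ?thesis
    by simp
qed

section \<open>Semialgebraic dimension and connectedness for thin sets\<close>

lemma C_k_on_subset: "C_k_on k f U \<Longrightarrow> U' \<subseteq> U \<Longrightarrow> C_k_on k f U'"
proof (induction k arbitrary: f)
  case 0
  then show ?case
    using continuous_on_subset by auto
next
  case (Suc k)
  then show ?case
    unfolding C_k_on.simps by (meson subsetD)
qed

lemma smooth_on_subset: "smooth_on f U \<Longrightarrow> U' \<subseteq> U \<Longrightarrow> smooth_on f U'"
  unfolding smooth_on_def by (intro allI C_k_on_subset[of _ f U U']) simp_all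

lemma smooth_submanifold_Diff:
  fixes M :: "'a::euclidean_space set"
  assumes "smooth_submanifold k M" "closed C"
  shows "smooth_submanifold k (M - C)"
  unfolding smooth_submanifold_def
proof
  fix x assume x: "x \<in> M - C"
  then have "x \<in> M"
    by simp
  with assms(1) obtain U V T f g where U: "open U" "x \<in> U" "open V" "homeomorphism U V f (g :: 'a \<Rightarrow> 'a)"
      "smooth_on f U" "smooth_on g V" and T: "subspace T" "dim T = k" "f ` (M \<inter> U) = T \<inter> V"
    by (rule submanifold_chart)
  have g: "\<And>y. y \<in> V \<Longrightarrow> g y \<in> U" "\<And>y. y \<in> V \<Longrightarrow> f (g y) = y" and f: "\<And>z. z \<in> U \<Longrightarrow> f z \<in> V"
    "\<And>z. z \<in> U \<Longrightarrow> g (f z) = z"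
    and cont: "continuous_on V g"
    using U(4) unfolding homeomorphism_def by auto
  define V' where "V' = V \<inter> g -` (- C)"
  have "open V'"
    unfolding V'_def using cont U(3) assms(2) by (intro continuous_open_preimage) auto
  moreover have "open (U - C)" "x \<in> U - C"
    using U(1,2) assms(2) x by auto
  moreover have im: "f ` (U - C) = V'"
  proof (intro equalityI subsetI)
    fix y assume "y \<in> V'"
    then show "y \<in> f ` (U - C)"
      using g by (intro image_eqI[of _ _ "g y"]) (auto simp: V'_def)
  qed (auto simp: V'_def f)
  moreover have "homeomorphism (U - C) V' f g"
    by (rule homeomorphism_of_subsets[OF U(4) _ empty_subsetI im]) auto
  moreover have "smooth_on f (U - C)" "smooth_on g V'"
    using smooth_on_subset[OF U(5)] smooth_on_subset[OF U(6)] by (auto simp: V'_def)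
  moreover have "f ` ((M - C) \<inter> (U - C)) = T \<inter> V'"
  proof (intro equalityI subsetI)
    fix y assume y: "y \<in> T \<inter> V'"
    then obtain z where z: "z \<in> M" "z \<in> U" "y = f z"
      using T(3) by (auto simp: V'_def)
    then have "z \<notin> C"
      using y f by (auto simp: V'_def)
    then show "y \<in> f ` ((M - C) \<inter> (U - C))"
      using z by auto
  next
    fix y assume "y \<in> f ` ((M - C) \<inter> (U - C))"
    then obtain z where z: "z \<in> M" "z \<in> U" "z \<notin> C" "y = f z"
      by auto
    then have "y \<in> T \<inter> V"
      using T(3) by blast
    then show "y \<in> T \<inter> V'"
      using z f by (auto simp: V'_def)
  qed
  ultimately show "\<exists>U V T. \<exists>(f :: 'a \<Rightarrow> 'a) g. open U \<and> x \<in> U \<and> open V \<and> homeomorphism U V f g \<and>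
      smooth_on f U \<and> smooth_on g V \<and> subspace T \<and> dim T = k \<and> f ` ((M - C) \<inter> U) = T \<inter> V"
    using T(1,2) by (intro exI[of _ "U - C"] exI[of _ V'] exI[of _ T] exI[of _ f] exI[of _ g] conjI)
qed

lemma smooth_submanifold_subspace:
  fixes T :: "(real ^ 'n) set"
  assumes "subspace T"
  shows "smooth_submanifold (dim T) T"
proof -
  have "smooth_on (\<lambda>x :: real ^ 'n. x) UNIV"
    unfolding smooth_on_def by (intro allI C_k_on_polynomial rpf_nth)
  moreover have "homeomorphism UNIV UNIV (\<lambda>x :: real ^ 'n. x) (\<lambda>x. x)"
    by (simp add: homeomorphism_def)
  ultimately show ?thesis
    unfolding smooth_submanifold_def using assms
    by (intro ballI exI[of _ UNIV] exI[of _ T] exI[of _ "\<lambda>x. x"] conjI) auto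
qed

text \<open>The subspace \<open>T\<close> becomes a stratum of its own and attains the dimension.
  The other strata are replaced by their differences with \<open>T\<close>, dropping empty ones, and
  thinness bounds their dimension from above.\<close>

lemma has_semialgebraic_dim_thin:
  fixes E T :: "(real ^ 'n) set"
  assumes E: "real_algebraic E" "thin E" and T: "subspace T" "T \<subseteq> E" "real_algebraic T" and d:
    "dim T + 2 = CARD('n)"
  shows "has_semialgebraic_dim E (dim T)"
proof -
  obtain \<S> where S: "finite \<S>" "disjoint \<S>" "\<Union>\<S> = E"
    "\<forall>M\<in>\<S>. M \<noteq> {} \<and> semialgebraic M \<and> (\<exists>k. smooth_submanifold k M)"
    using real_algebraic_stratification[OF E(1)] by blast
  define \<S>' where "\<S>' = insert T ((\<lambda>M. M - T) ` \<S> - {{}})"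
  have sT: "semialgebraic T"
    using T(3) by (rule semialgebraic_real_algebraic)
  have mT: "smooth_submanifold (dim T) T"
    using T(1) by (rule smooth_submanifold_subspace)
  have "M' \<noteq> {} \<and> semialgebraic M' \<and> (\<exists>k\<le>dim T. smooth_submanifold k M')" if "M' \<in> \<S>'" for M'
  proof (cases "M' = T")
    case True
    then show ?thesis
      using sT mT T(1) subspace_0 by blast
  next
    case False
    then have M': "M' \<in> (\<lambda>M. M - T) ` \<S>" "M' \<noteq> {}"
      using that by (simp_all add: \<S>'_def)
    then obtain M where "M \<in> \<S>" "M' = M - T"
      by blast
    note M = this M'(2)
    from M(1) obtain k where "smooth_submanifold k M" "semialgebraic M"
      using S(4) by blast
    then have k: "smooth_submanifold k M'"
      unfolding M(2) using closed_subspace[OF T(1)] by (intro smooth_submanifold_Diff)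
    have "semialgebraic M'"
      unfolding M(2) Diff_eq using \<open>semialgebraic M\<close> sT by (intro semialgebraic.inter
        semialgebraic.compl)
    moreover have "M' \<subseteq> E"
      using M S(3) by blast
    then have "k + 2 \<le> DIM(real ^ 'n)"
      using thin_submanifold[OF E(2) _ M(3) k] by simp
    then have "k \<le> dim T"
      using d by simp
    ultimately show ?thesis
      using M(3) k by blast
  qed
  moreover have "disjoint \<S>'"
    using S(2) unfolding \<S>'_def disjoint_def by blast
  moreover have "\<Union>\<S>' = E"
  proof -
    have "\<Union>\<S>' = T \<union> (\<Union>\<S> - T)"
      unfolding \<S>'_def by blast
    then show ?thesis
      using S(3) T(2) by blast
  qed
  moreover have "finite \<S>'" "T \<in> \<S>'"
    using S(1) by (auto simp: \<S>'_def)
  ultimately show ?thesis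
    unfolding has_semialgebraic_dim_def using mT by (intro exI[of _ \<S>'] conjI) auto
qed

text \<open>Any \<open>w\<close> outside the two cones over \<open>E\<close> with apexes
  \<open>x\<close> and \<open>y\<close> serves as corner, and both cones are null. If
  \<open>(1 - t) a + t w\<close> lay in \<open>E\<close>, dividing by \<open>t\<close> would put
  \<open>w\<close> on the cone with apex \<open>a\<close>.\<close>

lemma thin_two_segments:
  fixes E :: "'a::euclidean_space set"
  assumes "thin E" "x \<notin> E" "y \<notin> E"
  obtains w where "closed_segment x w \<union> closed_segment w y \<subseteq> - E"
proof -
  let ?C = "\<lambda>a. {a + s *\<^sub>R (z - a) |z s. z \<in> E}"
  have "negligible (?C x \<union> ?C y)"
    using thin_cone[OF assms(1)] by (intro negligible_Un)
  then have "?C x \<union> ?C y \<noteq> UNIV"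
    using non_negligible_UNIV by metis
  then obtain w where w: "w \<notin> ?C x" "w \<notin> ?C y"
    by blast
  have *: "closed_segment a w \<subseteq> - E" if a: "a \<notin> E" "w \<notin> ?C a" for a
  proof
    fix z assume "z \<in> closed_segment a w"
    then obtain t where t: "z = (1 - t) *\<^sub>R a + t *\<^sub>R w"
      by (auto simp: closed_segment_def)
    show "z \<in> - E"
    proof
      assume "z \<in> E"
      then have "t \<noteq> 0"
        using t a(1) by auto
      then have "w = a + (1 / t) *\<^sub>R (z - a)"
        by (simp add: t algebra_simps)
      then show False
        using a(2) \<open>z \<in> E\<close> by blast
    qed
  qed
  show ?thesis
    using that[of w] *[OF assms(2) w(1)] *[OF assms(3) w(2)] by (simp add: closed_segment_commute)
qed

lemma path_connected_Compl_thin: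
  fixes E :: "'a::euclidean_space set"
  assumes "thin E"
  shows "path_connected (- E)"
  unfolding path_connected_component
proof (intro ballI)
  fix x y assume "x \<in> - E" "y \<in> - E"
  then obtain w where w: "closed_segment x w \<union> closed_segment w y \<subseteq> - E"
    using thin_two_segments[OF assms, of x y] by auto
  have "path_component (- E) a b" if "closed_segment a b \<subseteq> - E" for a b
    using that by (metis path_component_def path_image_linepath path_linepath pathfinish_linepath
      pathstart_linepath)
  then show "path_component (- E) x y"
    using w path_component_trans[of "- E" x w y] by simp
qed

section \<open>The exceptional set has codimension two\<close>

lemma UNIV_6: "(UNIV :: 6 set) = {0, 1, 2, 3, 4, 5}"
proof (rule sym, rule card_subset_eq)
  show "card {0, 1, 2, 3, 4, 5 :: 6} = card (UNIV :: 6 set)"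
    by simp
qed auto

lemma forall_6: "(\<forall>i::6. P i) \<longleftrightarrow> P 0 \<and> P 1 \<and> P 2 \<and> P 3 \<and> P 4 \<and> P 5"
  using UNIV_6 by (metis UNIV_I insertE singletonD)

lemma vec_eq_6: "(x :: 'a ^ 6) = y \<longleftrightarrow> x $ 0 = y $ 0 \<and> x $ 1 = y $ 1 \<and> x $ 2 = y $ 2 \<and> x $ 3 = y $ 3
    \<and> x $ 4 = y $ 4 \<and> x $ 5 = y $ 5"
  by (simp add: vec_eq_iff forall_6)

definition vec6 :: "'a \<Rightarrow> 'a \<Rightarrow> 'a \<Rightarrow> 'a \<Rightarrow> 'a \<Rightarrow> 'a \<Rightarrow> 'a ^ 6" where
  "vec6 x0 x1 x2 x3 x4 x5 =
     (\<chi> i. if i = 0 then x0 else if i = 1 then x1 else if i = 2 then x2 else if i = 3 then x3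
           else if i = 4 then x4 else x5)"

lemma vec6_nth [simp]:
  "vec6 x0 x1 x2 x3 x4 x5 $ 0 = x0" "vec6 x0 x1 x2 x3 x4 x5 $ 1 = x1" "vec6 x0 x1 x2 x3 x4 x5 $ 2 = x2"
  "vec6 x0 x1 x2 x3 x4 x5 $ 3 = x3" "vec6 x0 x1 x2 x3 x4 x5 $ 4 = x4" "vec6 x0 x1 x2 x3 x4 x5 $ 5 = x5"
  by (simp_all add: vec6_def)

definition k_coords :: "real ^ 6 \<Rightarrow> oct_endo" where
  "k_coords x = gm (x $ 0) (x $ 1) (x $ 2) (x $ 3) (x $ 4) (x $ 5) 0 0 0 0 0 0 0 0"

lemma linear_k_coords: "linear k_coords"
  by (intro linearI) (simp_all add: k_coords_def gm_add gm_scaleR)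

lemma inj_k_coords: "inj k_coords"
  by (rule injI) (simp add: k_coords_def gm_inject vec_eq_6)

lemma range_k_coords: "range k_coords = k_A"
proof (intro equalityI subsetI)
  fix Z assume "Z \<in> k_A"
  then obtain a1 a2 a3 b1 b2 b3 where "Z = gm a1 a2 a3 b1 b2 b3 0 0 0 0 0 0 0 0"
    using k_A_iff by blast
  then have "Z = k_coords (vec6 a1 a2 a3 b1 b2 b3)"
    by (simp add: k_coords_def)
  then show "Z \<in> range k_coords"
    by blast
next
  fix Z assume "Z \<in> range k_coords"
  then show "Z \<in> k_A"
    unfolding k_A_iff k_coords_def by blast
qed

lemma dim_k_A: "dim k_A = 6"
proof -
  have "dim (k_coords ` UNIV) = dim (UNIV :: (real ^ 6) set)"
    using linear_k_coords inj_k_coords by (intro dim_image_eq) auto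
  then show ?thesis
    by (simp add: range_k_coords)
qed

text \<open>Invariance of \<open>N\<close> under nonzero scaling, which makes the radial projection
  to the sphere possible.\<close>

lemma L_gen_scaleR:
  assumes "c \<noteq> 0"
  shows "L_gen (c *\<^sub>R Z) = L_gen Z"
proof -
  have "X \<in> L \<longleftrightarrow> c *\<^sub>R X \<in> L" if "subspace L" for L and X :: oct_endo
    using subspace_scale[OF that, of X c] subspace_scale[OF that, of "c *\<^sub>R X" "1 / c"] assms by auto
  then have "lie_subalgebra L g2 \<and> c *\<^sub>R Z \<in> L \<and> S_mat ** (c *\<^sub>R Z) ** matrix_inv S_mat \<in> L \<longleftrightarrow>
      lie_subalgebra L g2 \<and> Z \<in> L \<and> S_mat ** Z ** matrix_inv S_mat \<in> L" for L
    unfolding lie_subalgebra_def matrix_scaleR_left matrix_scaleR_right by blast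
  then show ?thesis
    unfolding L_gen_def by simp
qed

lemma L_gen_eq_g2I:
  assumes "Z \<in> g2" "\<And>L. lie_subalgebra L g2 \<Longrightarrow> Z \<in> L \<Longrightarrow> S_mat ** Z ** S_mat \<in> L \<Longrightarrow> g2 \<subseteq> L"
  shows "L_gen Z = g2"
proof
  have "lie_subalgebra g2 g2"
    unfolding lie_subalgebra_def using subspace_g2 lie_bracket_g2 by simp
  then show "L_gen Z \<subseteq> g2"
    unfolding L_gen_def matrix_inv_S_mat
    using assms(1) involution_conj_g2[OF S_mat_automorphism S_mat_involution] by (intro Inter_lower) simp
  show "g2 \<subseteq> L_gen Z"
    unfolding L_gen_def matrix_inv_S_mat using assms(2) by (intro Inter_greatest) simp
qed

lemma S_conj_k_coords:
  "S_mat ** k_coords x ** S_mat = gm ((x $ 3 - x $ 0) / 2) 0 0 ((3 * x $ 0 + x $ 3) / 2) 0 0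
     (x $ 2) (- x $ 1) 0 0 0 0 (- x $ 4) (- x $ 5)"
  by (simp add: k_coords_def S_mat_conj_gm gm_inject field_simps)

lemma k_coords_N_iff: "k_coords x \<in> N_set \<longleftrightarrow> L_gen (k_coords x) \<noteq> g2"
  using range_k_coords by (auto simp: N_set_def)

lemma k_coords_notin_N:
  assumes "\<And>L. lie_subalgebra L g2 \<Longrightarrow> gm (x $ 0) (x $ 1) (x $ 2) (x $ 3) (x $ 4) (x $ 5) 0 0 0 0 0 0
    0 0 \<in> L \<Longrightarrow>
    gm ((x $ 3 - x $ 0) / 2) 0 0 ((3 * x $ 0 + x $ 3) / 2) 0 0 (x $ 2) (- x $ 1) 0 0 0 0 (- x $ 4)
      (- x $ 5) \<in> L \<Longrightarrow>
    g2 \<subseteq> L"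
  shows "k_coords x \<notin> N_set"
proof -
  have "L_gen (k_coords x) = g2"
  proof (rule L_gen_eq_g2I)
    fix L assume "lie_subalgebra L g2" "k_coords x \<in> L" "S_mat ** k_coords x ** S_mat \<in> L"
    then show "g2 \<subseteq> L"
      unfolding S_conj_k_coords unfolding k_coords_def by (rule assms)
  qed (simp add: k_coords_def gm_g2)
  then show ?thesis
    by (simp add: k_coords_N_iff)
qed

lemma N_subset:
  assumes "k_coords x \<in> N_set"
  shows "(3 * (x $ 1)\<^sup>2 * x $ 2 - x $ 2 ^ 3) * x $ 4 - (x $ 1 ^ 3 - 3 * x $ 1 * (x $ 2)\<^sup>2) * x $ 5 = 0 \<or>
    (x $ 0)\<^sup>2 + (x $ 1)\<^sup>2 + (x $ 2)\<^sup>2 = (x $ 3)\<^sup>2 + (x $ 4)\<^sup>2 + (x $ 5)\<^sup>2 \<or>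
    (x $ 3)\<^sup>2 + (x $ 4)\<^sup>2 + (x $ 5)\<^sup>2 = 9 * ((x $ 0)\<^sup>2 + (x $ 1)\<^sup>2 + (x $ 2)\<^sup>2)"
proof (rule ccontr)
  assume "\<not> ?thesis"
  then have "k_coords x \<notin> N_set"
    by (intro k_coords_notin_N g2_subset_generic) auto
  then show False
    using assms by simp
qed

text \<open>The first point lies on the cubic hypersurface and on \<open>|b| = |a|\<close>, the
  second on \<open>|b| = 3|a|\<close>. Both avoid \<open>a2 = a3 = 0\<close> and
  \<open>b2 = b3 = 0\<close>, where the parametrizations degenerate.\<close>

lemma generic_points: "k_coords (vec6 1 0 1 1 0 1) \<notin> N_set" "k_coords (vec6 0 1 0 0 0 3) \<notin> N_set"
  by (rule k_coords_notin_N; use g2_subset_point1 g2_subset_point2 in simp)+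

text \<open>
  If \<open>Z\<close> kills \<open>e\<^sub>1\<close> then so does its conjugate, and both lie in the stabilizer of \<open>e\<^sub>1\<close>.
\<close>

lemma stabilizer_subset_N:
  assumes "x $ 1 = 0" "x $ 2 = 0"
  shows "k_coords x \<in> N_set"
proof -
  define L where "L = {X \<in> g2. X *v oct_unit 1 = 0}"
  have "lie_subalgebra L g2"
    unfolding lie_subalgebra_def
  proof (intro conjI ballI)
    show "subspace L"
      using subspace_g2 unfolding L_def subspace_def
      by (auto simp: matrix_vector_mult_add_rdistrib simp flip: scaleR_matrix_vector_assoc)
    show "lie_bracket X Y \<in> L" if "X \<in> L" "Y \<in> L" for X Y
      using that lie_bracket_g2
      by (simp add: L_def lie_bracket_def matrix_vector_mult_diff_rdistrib flip: matrix_vector_mul_assoc)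
  qed (auto simp: L_def)
  moreover have "k_coords x \<in> L" "S_mat ** k_coords x ** S_mat \<in> L"
    unfolding L_def S_conj_k_coords using assms
    by (simp_all add: k_coords_def gm_g2 vec_eq_8 mult_oct_unit_nth gm_def[symmetric])
      (simp_all add: gm_def)
  ultimately have "L_gen (k_coords x) \<subseteq> L"
    unfolding L_gen_def matrix_inv_S_mat by (intro Inter_lower) simp
  moreover have "gm 0 0 1 0 0 0 0 0 0 0 0 0 0 0 \<notin> L"
    by (simp add: L_def vec_eq_8 mult_oct_unit_nth) (simp add: gm_def)
  ultimately have "L_gen (k_coords x) \<noteq> g2"
    using gm_g2 by blast
  then show ?thesis
    by (simp add: k_coords_N_iff)
qed

section \<open>Parametrizing the three hypersurfaces\<close>

lemma stereographic:
  fixes a1 a2 a3 :: real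
  assumes "(a2, a3) \<noteq> (0, 0)"
  obtains s u v where "s > 0" "2 * a1 = s * (1 - u\<^sup>2 - v\<^sup>2)" "a2 = s * u" "a3 = s * v"
    "4 * (a1\<^sup>2 + a2\<^sup>2 + a3\<^sup>2) = (s * (1 + u\<^sup>2 + v\<^sup>2))\<^sup>2"
proof -
  define A where "A = sqrt (a1\<^sup>2 + a2\<^sup>2 + a3\<^sup>2)"
  have pos: "a2\<^sup>2 + a3\<^sup>2 > 0"
    using assms by (simp add: sum_power2_gt_zero_iff)
  have A2: "A\<^sup>2 = a1\<^sup>2 + a2\<^sup>2 + a3\<^sup>2"
    unfolding A_def by (rule real_sqrt_pow2) simp
  have "\<bar>a1\<bar> < A"
    unfolding A_def using pos by (intro real_less_rsqrt) simp
  then have s: "A + a1 > 0"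
    by auto
  \<comment> \<open>Stereographic projection from the pole \<open>- A e_1\<close>; the hypothesis
    keeps \<open>a\<close> away from the pole, so \<open>s\<close> is positive.\<close>
  define s u v where "s = A + a1" and "u = a2 / s" and "v = a3 / s"
  have a: "a2 = s * u" "a3 = s * v"
    using s by (simp_all add: s_def u_def v_def)
  have "s * (s * (u\<^sup>2 + v\<^sup>2)) = s * (A - a1)"
    using A2 unfolding a s_def by (simp add: power2_eq_square algebra_simps)
  then have uv: "s * (u\<^sup>2 + v\<^sup>2) = A - a1"
    using s by (simp add: s_def)
  have "2 * a1 = s * (1 - u\<^sup>2 - v\<^sup>2)"
    using uv by (simp add: s_def algebra_simps)
  moreover have "s * (1 + u\<^sup>2 + v\<^sup>2) = 2 * A"
    using uv by (simp add: s_def algebra_simps)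
  then have "4 * (a1\<^sup>2 + a2\<^sup>2 + a3\<^sup>2) = (s * (1 + u\<^sup>2 + v\<^sup>2))\<^sup>2"
    by (simp add: A2 power_mult_distrib)
  ultimately show ?thesis
    using that[of s u v] s a by (simp add: s_def)
qed

text \<open>
  A polynomial parametrization of the cone \<open>|b| = k |a|\<close>, from stereographic coordinates on both
  spheres with the denominators cleared.
\<close>

definition sphere_param :: "real \<Rightarrow> real ^ 6 \<Rightarrow> real ^ 6" where
  "sphere_param k y = vec6
     (y $ 0 * (1 + (y $ 3)\<^sup>2 + (y $ 4)\<^sup>2) * (1 - (y $ 1)\<^sup>2 - (y $ 2)\<^sup>2))
     (y $ 0 * (1 + (y $ 3)\<^sup>2 + (y $ 4)\<^sup>2) * (2 * y $ 1))
     (y $ 0 * (1 + (y $ 3)\<^sup>2 + (y $ 4)\<^sup>2) * (2 * y $ 2))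
     (k * (y $ 0 * (1 + (y $ 1)\<^sup>2 + (y $ 2)\<^sup>2) * (1 - (y $ 3)\<^sup>2 - (y $ 4)\<^sup>2)))
     (k * (y $ 0 * (1 + (y $ 1)\<^sup>2 + (y $ 2)\<^sup>2) * (2 * y $ 3)))
     (k * (y $ 0 * (1 + (y $ 1)\<^sup>2 + (y $ 2)\<^sup>2) * (2 * y $ 4)))"

lemma sphere_param_surj:
  fixes x :: "real ^ 6"
  assumes "(x $ 1, x $ 2) \<noteq> (0, 0)" "(x $ 4, x $ 5) \<noteq> (0, 0)" "k > 0"
    and eq: "(x $ 3)\<^sup>2 + (x $ 4)\<^sup>2 + (x $ 5)\<^sup>2 = k\<^sup>2 * ((x $ 0)\<^sup>2 + (x $ 1)\<^sup>2 + (x $ 2)\<^sup>2)"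
  shows "\<exists>y. y $ 5 = t \<and> sphere_param k y = x"
proof -
  obtain s u v where s: "s > 0" "2 * x $ 0 = s * (1 - u\<^sup>2 - v\<^sup>2)" "x $ 1 = s * u" "x $ 2 = s * v"
    "4 * ((x $ 0)\<^sup>2 + (x $ 1)\<^sup>2 + (x $ 2)\<^sup>2) = (s * (1 + u\<^sup>2 + v\<^sup>2))\<^sup>2"
    using stereographic[OF assms(1), of "x $ 0"] by blast
  obtain s' u' v' where s': "s' > 0" "2 * x $ 3 = s' * (1 - u'\<^sup>2 - v'\<^sup>2)" "x $ 4 = s' * u'"
    "x $ 5 = s' * v'"
    "4 * ((x $ 3)\<^sup>2 + (x $ 4)\<^sup>2 + (x $ 5)\<^sup>2) = (s' * (1 + u'\<^sup>2 + v'\<^sup>2))\<^sup>2"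
    using stereographic[OF assms(2), of "x $ 3"] by blast
  define n n' where "n = 1 + u\<^sup>2 + v\<^sup>2" and "n' = 1 + u'\<^sup>2 + v'\<^sup>2"
  have n: "n > 0" "n' > 0"
    by (auto simp: n_def n'_def add_pos_nonneg)
  have "(s' * n')\<^sup>2 = (k * (s * n))\<^sup>2"
    unfolding n_def n'_def using eq s(5) s'(5) by algebra
  then have e: "s' * n' = k * (s * n)"
    using n s(1) s'(1) \<open>k > 0\<close> by (simp add: power2_eq_iff_nonneg)
  \<comment> \<open>One scale factor must serve both spheres: this value gives
    \<open>r * n' = s / 2\<close>, and the norm relation \<open>e\<close> then gives
    \<open>k * (r * n) = s' / 2\<close>.\<close>
  define r where "r = s / (2 * n')"
  have r: "r * n' = s / 2" "k * (r * n) = s' / 2"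
    using n e by (simp_all add: r_def field_simps)
  have "sphere_param k (vec6 r u v u' v' t) = x"
    unfolding sphere_param_def vec6_nth n_def[symmetric] n'_def[symmetric]
  proof -
    have k: "k * (r * n * z) = s' / 2 * z" for z
      using r(2) by (simp only: mult.assoc[symmetric])
    have x: "x $ 0 = s / 2 * (1 - u\<^sup>2 - v\<^sup>2)" "x $ 3 = s' / 2 * (1 - u'\<^sup>2 - v'\<^sup>2)"
      using s(2) s'(2) by simp_all
    show "vec6 (r * n' * (1 - u\<^sup>2 - v\<^sup>2)) (r * n' * (2 * u)) (r * n' * (2 * v))
        (k * (r * n * (1 - u'\<^sup>2 - v'\<^sup>2))) (k * (r * n * (2 * u'))) (k * (r * n * (2 * v'))) = x"
      unfolding vec_eq_6 vec6_nth k r(1) x s(3,4) s'(3,4) by simp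
  qed
  then show ?thesis
    by (intro exI[of _ "vec6 r u v u' v' t"]) simp
qed

text \<open>
  With \<open>\<nu> = a2 + i a3\<close> and \<open>\<mu> = b2 + i b3\<close>, this parametrizes the set where \<open>\<mu>\<close> is a real multiple
  of \<open>\<nu>\<^sup>3\<close>.
\<close>

definition cubic_param :: "real ^ 6 \<Rightarrow> real ^ 6" where
  "cubic_param y = vec6 (y $ 0) (y $ 1) (y $ 2) (y $ 3)
     (y $ 4 * (y $ 1 ^ 3 - 3 * y $ 1 * (y $ 2)\<^sup>2)) (y $ 4 * (3 * (y $ 1)\<^sup>2 * y $ 2 - y $ 2 ^ 3))"

lemma cubic_param_surj:
  fixes x :: "real ^ 6"
  assumes nz: "(x $ 1, x $ 2) \<noteq> (0, 0)"
    and eq: "(3 * (x $ 1)\<^sup>2 * x $ 2 - x $ 2 ^ 3) * x $ 4 - (x $ 1 ^ 3 - 3 * x $ 1 * (x $ 2)\<^sup>2) * x $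
      5 = 0"
  shows "\<exists>y. y $ 5 = t \<and> cubic_param y = x"
proof -
  define p q where "p = x $ 1 ^ 3 - 3 * x $ 1 * (x $ 2)\<^sup>2" and "q = 3 * (x $ 1)\<^sup>2 * x $ 2 - x $ 2 ^ 3"
  have "p\<^sup>2 + q\<^sup>2 = ((x $ 1)\<^sup>2 + (x $ 2)\<^sup>2) ^ 3"
    unfolding p_def q_def by algebra
  moreover have "(x $ 1)\<^sup>2 + (x $ 2)\<^sup>2 \<noteq> 0"
    using nz by (simp add: sum_power2_eq_zero_iff)
  ultimately have n: "p\<^sup>2 + q\<^sup>2 \<noteq> 0"
    by simp
  have eq': "q * x $ 4 = p * x $ 5"
    using eq by (simp add: p_def q_def)
  \<comment> \<open>The coefficient of the orthogonal projection of \<open>(b2, b3)\<close> onto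
    \<open>(p, q)\<close>, the vector representing \<open>\<nu>\<^sup>3\<close>.\<close>
  define r where "r = (p * x $ 4 + q * x $ 5) / (p\<^sup>2 + q\<^sup>2)"
  have "(p\<^sup>2 + q\<^sup>2) * (r * p) = (p\<^sup>2 + q\<^sup>2) * x $ 4" "(p\<^sup>2 + q\<^sup>2) * (r * q) = (p\<^sup>2 + q\<^sup>2) * x $ 5"
  proof -
    have r: "(p\<^sup>2 + q\<^sup>2) * r = p * x $ 4 + q * x $ 5"
      using n by (simp add: r_def)
    show "(p\<^sup>2 + q\<^sup>2) * (r * p) = (p\<^sup>2 + q\<^sup>2) * x $ 4" "(p\<^sup>2 + q\<^sup>2) * (r * q) = (p\<^sup>2 + q\<^sup>2) * x $ 5"
      using r eq' by algebra+
  qed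
  then have "r * p = x $ 4" "r * q = x $ 5"
    by (simp_all only: mult_left_cancel[OF n])
  then have "cubic_param (vec6 (x $ 0) (x $ 1) (x $ 2) (x $ 3) r t) = x"
    by (simp add: cubic_param_def vec_eq_6 p_def q_def)
  then show ?thesis
    by (intro exI[of _ "vec6 (x $ 0) (x $ 1) (x $ 2) (x $ 3) r t"]) simp
qed

lemma polynomial_function_vec6:
  assumes "rpf f0" "rpf f1" "rpf f2" "rpf f3" "rpf f4" "rpf f5"
  shows "polynomial_function (\<lambda>y :: real ^ 6. vec6 (f0 y) (f1 y) (f2 y) (f3 y) (f4 y) (f5 y))"
proof -
  have "\<forall>i. rpf (\<lambda>y. vec6 (f0 y) (f1 y) (f2 y) (f3 y) (f4 y) (f5 y) $ i)"
    by (simp add: forall_6 assms)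
  then show ?thesis
    unfolding polynomial_function_iff_Basis_inner
    by (auto simp: Basis_vec_def inner_axis real_polynomial_function_eq)
qed

lemma polynomial_params: "polynomial_function (sphere_param k)" "polynomial_function cubic_param"
  unfolding sphere_param_def[abs_def] cubic_param_def[abs_def]
  by (intro polynomial_function_vec6 real_polynomial_function.intros(2-4) real_polynomial_function_diff
      real_polynomial_function_power rpf_nth)+

text \<open>A polynomial that vanishes on \<open>N\<close> but not at \<open>z\<close> stays nonzero
  after composition with \<open>\<psi>\<close>, because \<open>z\<close> is in the image. The piece
  is thus parametrized by a proper zero set, and coordinate \<open>5\<close> is the dummy
  parameter.\<close>

lemma thin_param_piece:
  fixes M \<psi> :: "real ^ 6 \<Rightarrow> real ^ 6"
  assumes M: "linear M" and \<psi>: "polynomial_function \<psi>"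
    and surj: "\<And>x t. x \<in> H \<Longrightarrow> \<exists>y. y $ 5 = t \<and> \<psi> y = x"
    and N: "real_algebraic N" and z: "z \<in> H" "z \<notin> N"
  shows "thin (M ` (H \<inter> N))"
proof -
  obtain P where P: "\<forall>p\<in>P. rpf p" "N = {x. \<forall>p\<in>P. p x = 0}"
    using N unfolding real_algebraic_def by blast
  then obtain p where p: "p \<in> P" "p z \<noteq> 0"
    using z(2) by blast
  obtain y where y: "\<psi> y = z"
    using surj[OF z(1)] by blast
  show ?thesis
  proof (rule thin_polynomial_image[of "M \<circ> \<psi>" "p \<circ> \<psi>" y _ 5])
    have "bounded_linear M"
      using M by (rule linear_conv_bounded_linear[THEN iffD1])
    then show "polynomial_function (M \<circ> \<psi>)"
      by (intro polynomial_function_compose[OF \<psi>] polynomial_function_bounded_linear)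
    show "rpf (p \<circ> \<psi>)"
      using \<psi> P(1) p(1) by (intro real_polynomial_function_compose) auto
    show "(p \<circ> \<psi>) y \<noteq> 0"
      using p(2) y by simp
    show "\<exists>y. y $ 5 = s \<and> (M \<circ> \<psi>) y = x \<and> (p \<circ> \<psi>) y = 0" if x: "x \<in> M ` (H \<inter> N)" for x s
    proof -
      obtain w where w: "w \<in> H" "w \<in> N" "x = M w"
        using x by blast
      obtain y where "y $ 5 = s" "\<psi> y = w"
        using surj[OF w(1)] by blast
      moreover have "p w = 0"
        using w(2) p(1) P(2) by blast
      ultimately show ?thesis
        using w(3) by (intro exI[of _ y]) simp
    qed
  qed
qed

lemma thin_N:
  fixes M :: "real ^ 6 \<Rightarrow> real ^ 6"
  assumes M: "linear M"
  shows "thin (M ` (k_coords -` N_set))"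
proof -
  let ?N = "k_coords -` N_set"
  have N: "real_algebraic ?N"
    using linear_k_coords range_k_coords by (intro real_algebraic_N) auto
  \<comment> \<open>\<open>H0\<close> and \<open>H1\<close> have codimension two themselves and
    absorb the points that the parametrizations of \<open>H2\<close>, \<open>H3\<close>,
    \<open>H4\<close> miss.\<close>
  define H0 H1 H2 H3 H4 :: "(real ^ 6) set"
    where "H0 = {x. (x $ 1, x $ 2) = (0, 0)}"
      and "H1 = {x. (x $ 4, x $ 5) = (0, 0)}"
      and "H2 = {x. (x $ 1, x $ 2) \<noteq> (0, 0) \<and>
        (3 * (x $ 1)\<^sup>2 * x $ 2 - x $ 2 ^ 3) * x $ 4 - (x $ 1 ^ 3 - 3 * x $ 1 * (x $ 2)\<^sup>2) * x $ 5 = 0}"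
      and "H3 = {x. (x $ 1, x $ 2) \<noteq> (0, 0) \<and> (x $ 4, x $ 5) \<noteq> (0, 0) \<and>
        (x $ 3)\<^sup>2 + (x $ 4)\<^sup>2 + (x $ 5)\<^sup>2 = 1\<^sup>2 * ((x $ 0)\<^sup>2 + (x $ 1)\<^sup>2 + (x $ 2)\<^sup>2)}"
      and "H4 = {x. (x $ 1, x $ 2) \<noteq> (0, 0) \<and> (x $ 4, x $ 5) \<noteq> (0, 0) \<and>
        (x $ 3)\<^sup>2 + (x $ 4)\<^sup>2 + (x $ 5)\<^sup>2 = 3\<^sup>2 * ((x $ 0)\<^sup>2 + (x $ 1)\<^sup>2 + (x $ 2)\<^sup>2)}"
  have bl: "bounded_linear M"
    using M by (rule linear_conv_bounded_linear[THEN iffD1])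
  have q: "rpf (\<lambda>y :: real ^ 6. y $ 4)" "(vec6 0 0 0 0 1 0 :: real ^ 6) $ 4 \<noteq> 0"
    by (auto intro: rpf_nth)
  \<comment> \<open>The map parametrizes the hyperplane where coordinate \<open>2\<close> is zero;
    inside it \<open>H0\<close> is cut out by \<open>y $ 4 = 0\<close>, so that coordinate is the
    polynomial \<open>q\<close>. \<open>H1\<close> is treated likewise.\<close>
  have "thin (M ` H0)"
  proof (rule thin_polynomial_image[OF _ q, of "M \<circ> (\<lambda>y :: real ^ 6. vec6 (y $ 0) (y $ 4) 0 (y $ 1)
    (y $ 2) (y $ 3))" _ 5])
    show "polynomial_function (M \<circ> (\<lambda>y :: real ^ 6. vec6 (y $ 0) (y $ 4) 0 (y $ 1) (y $ 2) (y $ 3)))"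
      by (rule polynomial_function_compose[OF polynomial_function_vec6
        polynomial_function_bounded_linear[OF bl]])
        (intro rpf_nth real_polynomial_function.intros(2))+
    show "\<exists>y. y $ 5 = s \<and> (M \<circ> (\<lambda>y :: real ^ 6. vec6 (y $ 0) (y $ 4) 0 (y $ 1) (y $ 2) (y $ 3))) y =
      x \<and> y $ 4 = 0"
      if x: "x \<in> M ` H0" for x s
    proof -
      obtain w where w: "w $ 1 = 0" "w $ 2 = 0" "x = M w"
        using x by (auto simp: H0_def)
      then have "vec6 (w $ 0) 0 0 (w $ 3) (w $ 4) (w $ 5) = w"
        by (simp add: vec_eq_6)
      then show ?thesis
        using w(3) by (intro exI[of _ "vec6 (w $ 0) (w $ 3) (w $ 4) (w $ 5) 0 s"]) simp
    qed
  qed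
  moreover have "thin (M ` H1)"
  proof (rule thin_polynomial_image[OF _ q, of "M \<circ> (\<lambda>y :: real ^ 6. vec6 (y $ 0) (y $ 1) (y $ 2) (y
    $ 3) (y $ 4) 0)" _ 5])
    show "polynomial_function (M \<circ> (\<lambda>y :: real ^ 6. vec6 (y $ 0) (y $ 1) (y $ 2) (y $ 3) (y $ 4) 0))"
      by (rule polynomial_function_compose[OF polynomial_function_vec6
        polynomial_function_bounded_linear[OF bl]])
        (intro rpf_nth real_polynomial_function.intros(2))+
    show "\<exists>y. y $ 5 = s \<and> (M \<circ> (\<lambda>y :: real ^ 6. vec6 (y $ 0) (y $ 1) (y $ 2) (y $ 3) (y $ 4) 0)) y =
      x \<and> y $ 4 = 0"
      if x: "x \<in> M ` H1" for x s
    proof -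
      obtain w where w: "w $ 4 = 0" "w $ 5 = 0" "x = M w"
        using x by (auto simp: H1_def)
      then have "vec6 (w $ 0) (w $ 1) (w $ 2) (w $ 3) 0 0 = w"
        by (simp add: vec_eq_6)
      then show ?thesis
        using w(3) by (intro exI[of _ "vec6 (w $ 0) (w $ 1) (w $ 2) (w $ 3) 0 s"]) simp
    qed
  qed
  moreover have "thin (M ` (H2 \<inter> ?N))"
    by (rule thin_param_piece[OF M polynomial_params(2) _ N, where z="vec6 1 0 1 1 0 1"])
      (auto simp: H2_def generic_points intro: cubic_param_surj)
  moreover have "thin (M ` (H3 \<inter> ?N))"
    by (rule thin_param_piece[OF M polynomial_params(1)[of 1] _ N, where z="vec6 1 0 1 1 0 1"])
      (use sphere_param_surj[of _ 1] in \<open>simp_all add: H3_def generic_points\<close>)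
  moreover have "thin (M ` (H4 \<inter> ?N))"
    by (rule thin_param_piece[OF M polynomial_params(1)[of 3] _ N, where z="vec6 0 1 0 0 0 3"])
      (use sphere_param_surj[of _ 3] in \<open>simp_all add: H4_def generic_points\<close>)
  ultimately have "thin (M ` H0 \<union> M ` H1 \<union> M ` (H2 \<inter> ?N) \<union> M ` (H3 \<inter> ?N) \<union> M ` (H4 \<inter> ?N))"
    by (intro thin_Un)
  moreover have "M ` ?N \<subseteq> M ` H0 \<union> M ` H1 \<union> M ` (H2 \<inter> ?N) \<union> M ` (H3 \<inter> ?N) \<union> M ` (H4 \<inter> ?N)"
  proof -
    have "?N \<subseteq> H0 \<union> H1 \<union> (H2 \<inter> ?N) \<union> (H3 \<inter> ?N) \<union> (H4 \<inter> ?N)"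
    proof
      fix x assume x: "x \<in> ?N"
      then have "x \<in> H0 \<or> x \<in> H1 \<or> x \<in> H2 \<or> x \<in> H3 \<or> x \<in> H4"
        using N_subset[of x] unfolding H0_def H1_def H2_def H3_def H4_def mem_Collect_eq vimage_eq
          by auto
      then show "x \<in> H0 \<union> H1 \<union> (H2 \<inter> ?N) \<union> (H3 \<inter> ?N) \<union> (H4 \<inter> ?N)"
        using x by blast
    qed
    then have "M ` ?N \<subseteq> M ` (H0 \<union> H1 \<union> (H2 \<inter> ?N) \<union> (H3 \<inter> ?N) \<union> (H4 \<inter> ?N))"
      by (rule image_mono)
    then show ?thesis
      by (simp only: image_Un)
  qed
  ultimately show ?thesis
    by (rule thin_subset)
qed

lemma G_set_eq: "G_set = k_A - N_set"
  by (auto simp: N_set_def G_set_def)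

lemma G_set_image: "G_set = k_coords ` (- (k_coords -` N_set))"
  unfolding G_set_eq range_k_coords[symmetric] by blast

section \<open>Arbitrary linear coordinates on \<open>k_A\<close>\<close>

context
  fixes \<phi> :: "real ^ 6 \<Rightarrow> oct_endo"
  assumes \<phi>: "linear \<phi>" "bij_betw \<phi> UNIV k_A"
begin

lemma chart_inj: "inj \<phi>" and chart_range: "range \<phi> = k_A"
  using \<phi>(2) by (auto simp: bij_betw_def)

text \<open>\<open>M\<close> is the change of coordinates from \<open>k_coords\<close> to
  \<open>\<phi>\<close>; it is the reason why thinness was proved for linear images.\<close>

lemma chart_transition:
  obtains M where "linear M" "inj M" "\<And>X. \<phi> -` X = M ` (k_coords -` X)"
proof -
  define M where "M x = inv \<phi> (k_coords x)" for x
  have M: "\<phi> (M x) = k_coords x" for x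
    unfolding M_def using range_k_coords chart_range by (intro f_inv_into_f) auto
  have inv: "M x = y \<longleftrightarrow> k_coords x = \<phi> y" for x y
    using M[of x] chart_inj by (metis injD)
  show ?thesis
  proof
    show "linear M"
      by (intro linearI) (simp_all add: inv M linear_add[OF \<phi>(1)] linear_scale[OF \<phi>(1)]
          linear_add[OF linear_k_coords] linear_scale[OF linear_k_coords])
    show "inj M"
      using M inj_k_coords by (metis injD injI)
    show "\<phi> -` X = M ` (k_coords -` X)" for X
    proof (intro equalityI subsetI)
      fix y assume y: "y \<in> \<phi> -` X"
      have "\<phi> y \<in> range k_coords"
        using range_k_coords chart_range by blast
      then obtain x where x: "\<phi> y = k_coords x"
        by blast
      then show "y \<in> M ` (k_coords -` X)"
        using y inv[of x y] by auto
    qed (auto simp: M)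
  qed
qed

lemma chart_thin_N: "thin (\<phi> -` N_set)"
proof -
  obtain M where "linear M" "inj M" "\<And>X. \<phi> -` X = M ` (k_coords -` X)"
    by (rule chart_transition) (rule that)
  then show ?thesis
    using thin_N by simp
qed

lemma chart_algebraic_N: "real_algebraic (\<phi> -` N_set)"
  using \<phi>(1) chart_range by (intro real_algebraic_N) auto

lemma chart_G: "- (\<phi> -` G_set) = \<phi> -` N_set"
  unfolding G_set_eq using chart_range by auto

lemma chart_dim_N: "has_semialgebraic_dim (\<phi> -` N_set) 4"
proof -
  obtain M where M: "linear M" "inj M" "\<And>X. \<phi> -` X = M ` (k_coords -` X)"
    by (rule chart_transition) (rule that)
  let ?H = "{x :: real ^ 6. x $ 1 = 0 \<and> x $ 2 = 0}"
  \<comment> \<open>For elements of \<open>k_A\<close> these are the only entries of column 1 that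
    can be nonzero, so \<open>T\<close> describes the elements killing \<open>e_1\<close>.\<close>
  define T where "T = \<phi> -` {Z. Z $ 2 $ 1 = 0 \<and> Z $ 3 $ 1 = 0}"
  have TM: "T = M ` ?H"
    unfolding T_def M(3) by (rule arg_cong[of _ _ "(`) M"]) (auto simp: k_coords_def gm_def)
  have H: "?H = {x. \<forall>i. i \<notin> {0, 3, 4, 5} \<longrightarrow> x $ i = 0}"
    by (simp add: forall_6)
  have sH: "subspace ?H"
    by (auto simp: subspace_def)
  have "dim ?H = 4"
    unfolding H using dim_substandard_cart[of "{0, 3, 4, 5 :: 6}", where 'a=real] by (simp add:
      dim_vec_eq)
  moreover have "dim (M ` ?H) = dim ?H"
    by (rule dim_image_eq[OF M(1) inj_on_subset[OF M(2) subset_UNIV]])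
  ultimately have dT: "dim T = 4"
    by (simp only: TM)
  have sT: "subspace T"
    unfolding TM by (rule linear_subspace_image[OF M(1) sH])
  have "rpf (\<lambda>y. \<phi> y $ i $ j)" for i j
  proof (rule real_polynomial_function.intros(1))
    have "bounded_linear \<phi>"
      using \<phi>(1) by (rule linear_conv_bounded_linear[THEN iffD1])
    then show "bounded_linear (\<lambda>y. \<phi> y $ i $ j)"
      by (intro bounded_linear_compose[OF bounded_linear_vec_nth] bounded_linear_compose[OF
        bounded_linear_vec_nth])
  qed
  then have aT: "real_algebraic T"
    unfolding real_algebraic_def T_def
    by (intro exI[of _ "{\<lambda>y. \<phi> y $ 2 $ 1, \<lambda>y. \<phi> y $ 3 $ 1}"]) auto
  have TN: "T \<subseteq> \<phi> -` N_set"
    unfolding TM M(3) using stabilizer_subset_N by (intro image_mono) auto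
  show ?thesis
    using has_semialgebraic_dim_thin[OF chart_algebraic_N chart_thin_N sT TN aT] dT by simp
qed

lemma chart_null: "- (\<phi> -` G_set) \<in> null_sets lebesgue"
  unfolding chart_G using thin_negligible[OF chart_thin_N] by (simp add: negligible_iff_null_sets)

text \<open>The set is the image of the complement of a thin set under radial projection followed by
  \<open>\<phi>\<close>. The projection is defined there because \<open>0\<close> is exceptional,
  and it stays in the complement because \<open>N\<close> is invariant under nonzero
  scaling.\<close>

lemma chart_sphere_path_connected: "path_connected (G_set \<inter> \<phi> ` sphere 0 1)"
proof -
  let ?E = "\<phi> -` N_set" and ?f = "\<lambda>y. \<phi> ((1 / norm y) *\<^sub>R y)"
  have "k_coords 0 \<in> N_set"
    by (rule stabilizer_subset_N) simp_all
  then have 0: "0 \<in> ?E"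
    using linear_0[OF \<phi>(1)] linear_0[OF linear_k_coords] by simp
  have scale: "c *\<^sub>R y \<in> ?E \<longleftrightarrow> y \<in> ?E" if "c \<noteq> 0" for c y
    using L_gen_scaleR[OF that, of "\<phi> y"] chart_range
    by (auto simp: N_set_def linear_scale[OF \<phi>(1), symmetric])
  have nz: "y \<noteq> 0" if "y \<in> - ?E" for y
    using that 0 by auto
  have "continuous_on UNIV \<phi>"
    using \<phi>(1) by (intro linear_continuous_on) (simp add: linear_conv_bounded_linear)
  moreover have "continuous_on (- ?E) (\<lambda>y. (1 / norm y) *\<^sub>R y)"
    using nz by (intro continuous_intros) auto
  ultimately have "continuous_on (- ?E) ?f"
    by (rule continuous_on_compose2) (rule subset_UNIV)
  moreover have "?f ` (- ?E) = G_set \<inter> \<phi> ` sphere 0 1"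
  proof (intro equalityI subsetI)
    fix Z assume "Z \<in> ?f ` (- ?E)"
    then obtain y where y: "y \<in> - ?E" "Z = ?f y"
      by blast
    then have "(1 / norm y) *\<^sub>R y \<in> - ?E" "norm ((1 / norm y) *\<^sub>R y) = 1"
      using nz[OF y(1)] scale[of "1 / norm y" y] by auto
    then show "Z \<in> G_set \<inter> \<phi> ` sphere 0 1"
      unfolding y(2) G_set_eq using chart_range by auto
  next
    fix Z assume "Z \<in> G_set \<inter> \<phi> ` sphere 0 1"
    then obtain y where "Z = \<phi> y" "norm y = 1" "y \<in> - ?E"
      unfolding G_set_eq by auto
    then show "Z \<in> ?f ` (- ?E)"
      by (intro image_eqI[of _ _ y]) auto
  qed
  ultimately show ?thesis
    using path_connected_continuous_image[of
      "- ?E" ?f] path_connected_Compl_thin[OF chart_thin_N] by metis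
qed

end

lemma k_coords_thin_N: "thin (k_coords -` N_set)"
  using thin_N[OF linear_id] by simp

lemma G_set_two_segments:
  assumes "X \<in> G_set" "Y \<in> G_set"
  shows "\<exists>W. closed_segment X W \<union> closed_segment W Y \<subseteq> G_set"
proof -
  let ?E = "k_coords -` N_set"
  obtain x y where x: "X = k_coords x" "x \<notin> ?E" and y: "Y = k_coords y" "y \<notin> ?E"
    using assms unfolding G_set_image by blast
  obtain w where w: "closed_segment x w \<union> closed_segment w y \<subseteq> - ?E"
    using thin_two_segments[OF k_coords_thin_N x(2) y(2)] .
  have "k_coords ` closed_segment a b = closed_segment (k_coords a) (k_coords b)" for a b
    by (rule closed_segment_linear_image[OF linear_k_coords, symmetric])
  then have "closed_segment X (k_coords w) \<union> closed_segment (k_coords w) Y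
      = k_coords ` (closed_segment x w \<union> closed_segment w y)"
    by (simp add: image_Un x y)
  also have "\<dots> \<subseteq> G_set"
    unfolding G_set_image using w by (rule image_mono)
  finally show ?thesis
    by blast
qed

lemma path_connected_G_set: "path_connected G_set"
  unfolding G_set_image
proof (rule path_connected_continuous_image)
  show "continuous_on (- (k_coords -` N_set)) k_coords"
    using linear_k_coords by (intro linear_continuous_on) (simp add: linear_conv_bounded_linear)
qed (rule path_connected_Compl_thin[OF k_coords_thin_N])

text \<open>Polynomials, Lebesgue measure and the unit sphere on \<open>k_A\<close> depend on an
  identification with the six-dimensional coordinate space; quantifying over all linear bijections
  \<open>\<phi>\<close> covers every choice.\<close>

theorem corollary8p7:
  shows "dim k_A = 6 \<and>
    (\<forall>\<phi> :: real ^ 6 \<Rightarrow> oct_endo. linear \<phi> \<and> bij_betw \<phi> UNIV k_A \<longrightarrow>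
       real_algebraic (\<phi> -` N_set) \<and>
       has_semialgebraic_dim (\<phi> -` N_set) 4 \<and>
       - (\<phi> -` G_set) \<in> null_sets lebesgue \<and>
       path_connected (G_set \<inter> \<phi> ` sphere 0 1)) \<and>
    (\<forall>X\<in>G_set. \<forall>Y\<in>G_set. \<exists>W. closed_segment X W \<union> closed_segment W Y \<subseteq> G_set) \<and>
    path_connected G_set"
  using dim_k_A chart_algebraic_N chart_dim_N chart_null chart_sphere_path_connected
    G_set_two_segments path_connected_G_set by simp

end
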